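(* Let $\Omega=\mathbb T^3$ (periodic boundary conditions). Let $\alpha,\gamma>0$, $g\in L^2(\Omega)$ and let $f\in C^1(\mathbb R)$ satisfy, for some constants $C,\kappa,K>0$ and all $u\in\mathbb R$, $f(u)u\ge -C+\kappa|u|^2$, $f'(u)\ge -K$, $|f'(u)|\le C(1+|u|^4)$. Then any weak energy solution $u$ of $$\partial_t^2u+\gamma(-\Delta)^{1/2}\partial_tu+\alpha\partial_tu-\Delta u+f(u)=g,\quad u|_{t=0}=u_0,\ \partial_tu|_{t=0}=u_1,$$ with $(u_0,u_1)\in\mathcal E$, belongs to $L^2(0,T;H^{3/2}(\Omega))$ (for every $T>0$), and the following estimate holds for all $\tau\ge0$: $$\|u\|_{L^2([\tau,\tau+1],H^{3/2}(\Omega))}\le Q\big(\|\xi_u\|_{L^\infty([\tau,\tau+1],\mathcal E)}+\|\partial_tu\|_{L^2([\tau,\tau+1],H^{1/2}_\Delta)}+\|g\|_{L^2(\Omega)}\big),$$ where the monotone function $Q$ is independent of $\tau\in\mathbb R_+$ and $u$.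
   Context: $\mathbb T^3=[0,2\pi]^3$ with periodic boundary conditions; $(\cdot,\cdot)$ is the $L^2(\Omega)$ inner product. Let $\{\lambda_i\}$, $\{e_i\}$ be the eigenvalues and an $L^2$-orthonormal basis of eigenfunctions of $-\Delta$ on $\mathbb T^3$. For $u=\sum u_ie_i$, $(-\Delta)^\theta u:=\sum\lambda_i^\theta u_ie_i$ ($\theta\ge0$), and $H^s_\Delta$ is the Hilbert space with norm $\|u\|^2_{H^s_\Delta}=\sum(1+\lambda_i)^su_i^2$ (on the torus $H^s_\Delta=H^s(\mathbb T^3)$). The energy space is $\mathcal E:=H^1(\mathbb T^3)\times L^2(\mathbb T^3)$ and $\xi_u(t):=(u(t),\partial_tu(t))$. A function $\xi_u=(u,\partial_tu)$ is a weak energy solution if, for every $T>0$, $\xi_u\in L^\infty(0,T;\mathcal E)$, $\partial_tu\in L^2(0,T;H^{1/2}_\Delta)$, $\xi_u(0)=(u_0,u_1)$, and for every $\phi\in C_0^\infty((0,T)\times\Omega)$ $$-\int_0^T(\partial_tu,\partial_t\phi)dt+\int_0^T(\nabla u,\nabla\phi)dt+\alpha\int_0^T(\partial_tu,\phi)dt+\gamma\int_0^T(\partial_tu,(-\Delta)^{1/2}\phi)dt+\int_0^T(f(u),\phi)dt=\int_0^T(g,\phi)dt.$$ (Such a $\xi_u$ is weakly continuous in time with values in $\mathcal E$, so $\xi_u(0)$ makes sense.) *)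

theory Defs
  imports "HOL-Analysis.Analysis" "HOL-Probability.Essential_Supremum"
begin

text \<open>
  Functions on the torus are represented by functions on \<open>real ^ 3\<close>, of which only the values on the
  cell \<open>[0, 2 pi]^3\<close> matter; elements of \<open>L^2\<close> are considered up to null sets. Periodicity is imposed
  explicitly on smooth functions and is encoded in the Fourier side for the spaces \<open>H^s\<close>.
\<close>

definition cell :: "(real ^ 3) set" where
  "cell = cbox 0 (\<chi> i. 2 * pi)"

abbreviation torus :: "(real ^ 3) measure" where
  "torus \<equiv> lebesgue_on cell"

definition L2_torus :: "(real ^ 3 \<Rightarrow> real) \<Rightarrow> bool" where
  "L2_torus u \<longleftrightarrow> u \<in> borel_measurable torus \<and> integrable torus (\<lambda>x. (u x)\<^sup>2)"

definition L2_inner :: "(real ^ 3 \<Rightarrow> real) \<Rightarrow> (real ^ 3 \<Rightarrow> real) \<Rightarrow> real" where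
  "L2_inner u w = (\<integral>x. u x * w x \<partial>torus)"

definition L2_norm :: "(real ^ 3 \<Rightarrow> real) \<Rightarrow> real" where
  "L2_norm u = sqrt (L2_inner u u)"

definition wave_vector :: "int ^ 3 \<Rightarrow> real ^ 3" where
  "wave_vector k = (\<chi> i. of_int (k $ i))"

definition lex_pos :: "int ^ 3 \<Rightarrow> bool" where
  "lex_pos k \<longleftrightarrow> k $ 1 > 0 \<or> (k $ 1 = 0 \<and> (k $ 2 > 0 \<or> (k $ 2 = 0 \<and> k $ 3 > 0)))"

text \<open>
  The standard real \<open>L^2\<close>-orthonormal basis of eigenfunctions of the negative Laplacian: of each pair
  \<open>k, - k\<close> of nonzero frequencies, the lexicographically positive one labels the cosine and the
  other one the sine.
\<close>

definition eigval :: "int ^ 3 \<Rightarrow> real" where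
  "eigval k = (norm (wave_vector k))\<^sup>2"

definition eigfun :: "int ^ 3 \<Rightarrow> real ^ 3 \<Rightarrow> real" where
  "eigfun k x =
     (if k = 0 then 1
      else if lex_pos k then sqrt 2 * cos (wave_vector k \<bullet> x)
      else sqrt 2 * sin (wave_vector k \<bullet> x)) / sqrt ((2 * pi) ^ 3)"

definition coeff :: "(real ^ 3 \<Rightarrow> real) \<Rightarrow> int ^ 3 \<Rightarrow> real" where
  "coeff u k = L2_inner u (eigfun k)"

text \<open>
  \<open>(- \<Delta>)\<^sup>\<theta> u\<close> for \<open>\<theta> > 0\<close>, as a pointwise series. It is only applied to smooth periodic functions,
  for which the series converges absolutely. (For \<open>\<theta> = 0\<close> this would lose the mean of \<open>u\<close>,
  as \<open>0 powr 0 = 0\<close>.)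
\<close>

definition frac_laplacian :: "real \<Rightarrow> (real ^ 3 \<Rightarrow> real) \<Rightarrow> real ^ 3 \<Rightarrow> real" where
  "frac_laplacian \<theta> u x = (\<Sum>\<^sub>\<infinity>k. eigval k powr \<theta> * coeff u k * eigfun k x)"

definition Hs :: "real \<Rightarrow> (real ^ 3 \<Rightarrow> real) \<Rightarrow> bool" where
  "Hs s u \<longleftrightarrow> L2_torus u \<and> (\<lambda>k. (1 + eigval k) powr s * (coeff u k)\<^sup>2) summable_on UNIV"

definition Hs_inner :: "real \<Rightarrow> (real ^ 3 \<Rightarrow> real) \<Rightarrow> (real ^ 3 \<Rightarrow> real) \<Rightarrow> real" where
  "Hs_inner s u w = (\<Sum>\<^sub>\<infinity>k. (1 + eigval k) powr s * (coeff u k * coeff w k))"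

definition Hs_norm :: "real \<Rightarrow> (real ^ 3 \<Rightarrow> real) \<Rightarrow> real" where
  "Hs_norm s u = sqrt (\<Sum>\<^sub>\<infinity>k. (1 + eigval k) powr s * (coeff u k)\<^sup>2)"

definition energy_space :: "(real ^ 3 \<Rightarrow> real) \<Rightarrow> (real ^ 3 \<Rightarrow> real) \<Rightarrow> bool" where
  "energy_space u v \<longleftrightarrow> Hs 1 u \<and> L2_torus v"

definition energy_norm :: "(real ^ 3 \<Rightarrow> real) \<Rightarrow> (real ^ 3 \<Rightarrow> real) \<Rightarrow> real" where
  "energy_norm u v = sqrt ((Hs_norm 1 u)\<^sup>2 + (L2_norm v)\<^sup>2)"

text \<open>
  A Bochner class is represented by a function of \<open>(t, x)\<close> that is jointly Lebesgue measurable on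
  \<open>I \<times> cell\<close>; since the spaces \<open>H^s\<close> are separable, this is the same as
  strong measurability of \<open>t \<mapsto> u(t)\<close>, up to a choice of representative.
\<close>

definition jointly_measurable :: "real set \<Rightarrow> (real \<Rightarrow> real ^ 3 \<Rightarrow> real) \<Rightarrow> bool" where
  "jointly_measurable I u \<longleftrightarrow>
     (\<lambda>(t, x). u t x) \<in> borel_measurable (lebesgue_on (I \<times> cell))"

definition L2_Hs :: "real set \<Rightarrow> real \<Rightarrow> (real \<Rightarrow> real ^ 3 \<Rightarrow> real) \<Rightarrow> bool" where
  "L2_Hs I s u \<longleftrightarrow>
     jointly_measurable I u \<and>
     (AE t in lebesgue_on I. Hs s (u t)) \<and>
     integrable (lebesgue_on I) (\<lambda>t. (Hs_norm s (u t))\<^sup>2)"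

definition L2_Hs_norm :: "real set \<Rightarrow> real \<Rightarrow> (real \<Rightarrow> real ^ 3 \<Rightarrow> real) \<Rightarrow> real" where
  "L2_Hs_norm I s u = sqrt (\<integral>t. (Hs_norm s (u t))\<^sup>2 \<partial>lebesgue_on I)"

definition energy_esssup ::
    "real set \<Rightarrow> (real \<Rightarrow> real ^ 3 \<Rightarrow> real) \<Rightarrow> (real \<Rightarrow> real ^ 3 \<Rightarrow> real) \<Rightarrow> ereal" where
  "energy_esssup I u v = esssup (lebesgue_on I) (\<lambda>t. ereal (energy_norm (u t) (v t)))"

definition Linf_energy ::
    "real set \<Rightarrow> (real \<Rightarrow> real ^ 3 \<Rightarrow> real) \<Rightarrow> (real \<Rightarrow> real ^ 3 \<Rightarrow> real) \<Rightarrow> bool" where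
  "Linf_energy I u v \<longleftrightarrow>
     jointly_measurable I u \<and> jointly_measurable I v \<and>
     (AE t in lebesgue_on I. energy_space (u t) (v t)) \<and>
     energy_esssup I u v < \<infinity>"

definition Linf_energy_norm ::
    "real set \<Rightarrow> (real \<Rightarrow> real ^ 3 \<Rightarrow> real) \<Rightarrow> (real \<Rightarrow> real ^ 3 \<Rightarrow> real) \<Rightarrow> real" where
  "Linf_energy_norm I u v = real_of_ereal (energy_esssup I u v)"

primrec Ck :: "nat \<Rightarrow> ('a::euclidean_space \<Rightarrow> real) \<Rightarrow> bool" where
  "Ck 0 \<phi> \<longleftrightarrow> continuous_on UNIV \<phi>"
| "Ck (Suc n) \<phi> \<longleftrightarrow>
     (\<forall>x. \<phi> differentiable (at x)) \<and>
     (\<forall>b\<in>Basis. Ck n (\<lambda>x. frechet_derivative \<phi> (at x) b))"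

definition smooth :: "('a::euclidean_space \<Rightarrow> real) \<Rightarrow> bool" where
  "smooth \<phi> \<longleftrightarrow> (\<forall>n. Ck n \<phi>)"

definition periodic :: "(real ^ 3 \<Rightarrow> real) \<Rightarrow> bool" where
  "periodic \<psi> \<longleftrightarrow> (\<forall>x i. \<psi> (x + axis i (2 * pi)) = \<psi> x)"

definition grad :: "(real ^ 3 \<Rightarrow> real) \<Rightarrow> real ^ 3 \<Rightarrow> real ^ 3" where
  "grad \<psi> x = (\<chi> i. frechet_derivative \<psi> (at x) (axis i 1))"

definition is_weak_grad :: "(real ^ 3 \<Rightarrow> real) \<Rightarrow> (real ^ 3 \<Rightarrow> real ^ 3) \<Rightarrow> bool" where
  "is_weak_grad u G \<longleftrightarrow>
     (\<forall>i. L2_torus (\<lambda>x. G x $ i)) \<and>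
     (\<forall>\<psi>. smooth \<psi> \<and> periodic \<psi> \<longrightarrow>
        (\<forall>i. L2_inner u (\<lambda>x. grad \<psi> x $ i) = - L2_inner (\<lambda>x. G x $ i) \<psi>))"

text \<open>The weak gradient of \<open>u \<in> H^1\<close>; it is unique up to null sets.\<close>

definition weak_grad :: "(real ^ 3 \<Rightarrow> real) \<Rightarrow> real ^ 3 \<Rightarrow> real ^ 3" where
  "weak_grad u = (SOME G. is_weak_grad u G)"

text \<open>
  \<open>C_0^\<infinity>((0, T) \<times> \<Omega>)\<close> for the torus \<open>\<Omega>\<close>: the torus has no boundary, so the support is
  only constrained in time.
\<close>

definition test_function :: "real \<Rightarrow> (real \<Rightarrow> real ^ 3 \<Rightarrow> real) \<Rightarrow> bool" where
  "test_function T \<phi> \<longleftrightarrow>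
     smooth (\<lambda>(t, x). \<phi> t x) \<and>
     (\<forall>t. periodic (\<phi> t)) \<and>
     (\<exists>a b. 0 < a \<and> b < T \<and> (\<forall>t x. t \<notin> {a..b} \<longrightarrow> \<phi> t x = 0))"

definition time_deriv :: "(real \<Rightarrow> real ^ 3 \<Rightarrow> real) \<Rightarrow> real \<Rightarrow> real ^ 3 \<Rightarrow> real" where
  "time_deriv \<phi> t x = deriv (\<lambda>s. \<phi> s x) t"

definition has_weak_time_deriv ::
    "real \<Rightarrow> (real \<Rightarrow> real ^ 3 \<Rightarrow> real) \<Rightarrow> (real \<Rightarrow> real ^ 3 \<Rightarrow> real) \<Rightarrow> bool" where
  "has_weak_time_deriv T u v \<longleftrightarrow>
     (\<forall>\<phi>. test_function T \<phi> \<longrightarrow>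
        (\<integral>t. L2_inner (u t) (time_deriv \<phi> t) \<partial>lebesgue_on {0<..<T}) =
        - (\<integral>t. L2_inner (v t) (\<phi> t) \<partial>lebesgue_on {0<..<T}))"

definition weakly_continuous_energy ::
    "(real \<Rightarrow> real ^ 3 \<Rightarrow> real) \<Rightarrow> (real \<Rightarrow> real ^ 3 \<Rightarrow> real) \<Rightarrow> bool" where
  "weakly_continuous_energy u v \<longleftrightarrow>
     (\<forall>t\<ge>0. energy_space (u t) (v t)) \<and>
     (\<forall>w z. energy_space w z \<longrightarrow>
        continuous_on {0..} (\<lambda>t. Hs_inner 1 (u t) w + L2_inner (v t) z))"

text \<open>
  The initial condition refers to the weakly continuous representative of \<open>t \<mapsto> (u(t), v(t))\<close>.
\<close>

definition initial_value ::
    "(real \<Rightarrow> real ^ 3 \<Rightarrow> real) \<Rightarrow> (real \<Rightarrow> real ^ 3 \<Rightarrow> real) \<Rightarrow>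
     (real ^ 3 \<Rightarrow> real) \<Rightarrow> (real ^ 3 \<Rightarrow> real) \<Rightarrow> bool" where
  "initial_value u v u0 u1 \<longleftrightarrow>
     (\<exists>U V. weakly_continuous_energy U V \<and>
        (AE t in lebesgue_on {0<..}.
           (AE x in torus. U t x = u t x) \<and> (AE x in torus. V t x = v t x)) \<and>
        (AE x in torus. U 0 x = u0 x) \<and> (AE x in torus. V 0 x = u1 x))"

text \<open>The argument \<open>v\<close> is the time derivative of \<open>u\<close>.\<close>

definition weak_energy_solution ::
    "real \<Rightarrow> real \<Rightarrow> (real \<Rightarrow> real) \<Rightarrow> (real ^ 3 \<Rightarrow> real) \<Rightarrow>
     (real ^ 3 \<Rightarrow> real) \<Rightarrow> (real ^ 3 \<Rightarrow> real) \<Rightarrow>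
     (real \<Rightarrow> real ^ 3 \<Rightarrow> real) \<Rightarrow> (real \<Rightarrow> real ^ 3 \<Rightarrow> real) \<Rightarrow> bool" where
  "weak_energy_solution \<alpha> \<gamma> f g u0 u1 u v \<longleftrightarrow>
     (\<forall>T>0.
        Linf_energy {0<..<T} u v \<and>
        has_weak_time_deriv T u v \<and>
        L2_Hs {0<..<T} (1/2) v \<and>
        (\<forall>\<phi>. test_function T \<phi> \<longrightarrow>
           - (\<integral>t. L2_inner (v t) (time_deriv \<phi> t) \<partial>lebesgue_on {0<..<T})
           + (\<integral>t. (\<integral>x. weak_grad (u t) x \<bullet> grad (\<phi> t) x \<partial>torus) \<partial>lebesgue_on {0<..<T})
           + \<alpha> * (\<integral>t. L2_inner (v t) (\<phi> t) \<partial>lebesgue_on {0<..<T})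
           + \<gamma> * (\<integral>t. L2_inner (v t) (frac_laplacian (1/2) (\<phi> t)) \<partial>lebesgue_on {0<..<T})
           + (\<integral>t. L2_inner (\<lambda>x. f (u t x)) (\<phi> t) \<partial>lebesgue_on {0<..<T})
           = (\<integral>t. L2_inner g (\<phi> t) \<partial>lebesgue_on {0<..<T}))) \<and>
     initial_value u v u0 u1"

end

theory Submission
  imports Defs
begin

text \<open>
  Formally, the estimate follows by testing the equation with \<open>A u\<close>, where \<open>A = (- \<Delta>)\<^sup>1\<^sup>/\<^sup>2\<close>:
  after integration in time, the square of the \<open>L\<^sup>2\<close> norm of \<open>A\<^sup>3\<^sup>/\<^sup>2 u\<close> equals the square of the norm of
  \<open>A\<^sup>1\<^sup>/\<^sup>2 \<partial>\<^sub>t u\<close>, plus \<open>(g, A u) - (f(u), A u)\<close>, plus boundary terms that the energy norm controls.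
  All of them except \<open>(f(u), A u)\<close> are bounded by the norms on the right-hand side of the estimate, and this
  one has a sign up to lower order: \<open>A\<close> is the limit of operators \<open>N (1 - P)\<close>, where \<open>P\<close> is the convolution with
  the Poisson kernel at time \<open>1 / N\<close>, and for a nondecreasing
  function \<open>F\<close> the pairing \<open>(F(u), u - P u)\<close> is half the double integral of a nonnegative kernel times
  \<open>(F(u(x)) - F(u(y))) (u(x) - u(y)) \<ge> 0\<close>. This is applied to \<open>F(s) = f(s) + K s\<close>. The growth
  condition on \<open>f\<close> guarantees that the pairings are finite. The resulting \<open>Q\<close> is linear.

  In the rigorous argument \<open>P\<close> is the convolution with the Fejer kernel of order \<open>N\<close>, a trigonometric
  polynomial; \<open>N (1 - P)\<close> is then only comparable to \<open>A\<close>, which suffices. The multiplier of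
  \<open>N (1 - P)\<close> is bounded, at most \<open>3 |k|\<close> everywhere, and at least the largest component of \<open>k\<close> on frequencies
  up to \<open>N\<close> (\<open>fejer_defect_bounds\<close>); the sign condition is \<open>fejer_dissipative\<close>. The Fourier modes of the weakly
  continuous representative of the solution satisfy scalar ordinary differential equations
  (\<open>mode_odes\<close>), so that the energy identity can be derived mode by mode (\<open>mode_identity\<close>) and added up with
  the weights of \<open>N (1 - P)\<close> over finitely many modes (\<open>weighted_modes_bound\<close>). The number of modes tends to
  infinity for fixed \<open>N\<close>, which produces the sign of the nonlinear term; then \<open>N\<close> grows with the finite set
  of frequencies that one wants to control (\<open>height_weighted_bound\<close>), and monotone convergence yields
  \<open>H32_smoothing\<close>.

  Two facts about the torus carry this: the completeness of the trigonometric system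
  (\<open>eigfun_total\<close>), which together with the Riesz--Fischer theorem gives the Parseval identity and the
  existence of weak gradients, and the embedding of \<open>H\<^sup>1\<close> into \<open>L\<^sup>6\<close> (\<open>sobolev_L6\<close>), which makes \<open>f(u) u\<close>
  integrable for a quintic \<open>f\<close>.
\<close>

section \<open>Integration over the periodic cell\<close>

lemma Basis_real3: "(Basis :: (real^3) set) = range (\<lambda>i. axis i 1)"
  by (auto simp: Basis_vec_def)

lemma cell_eq: "cell = {x. \<forall>i. 0 \<le> x $ i \<and> x $ i \<le> 2 * pi}"
  by (auto simp: cell_def mem_box_cart)

lemma compact_cell: "compact cell" by (simp add: cell_def compact_cbox)

lemma cell_sets [measurable, simp]: "cell \<in> sets lebesgue" "cell \<in> sets borel" "cell \<in> sets lborel"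
  by (simp_all add: cell_def)

lemma emeasure_cell: "emeasure lborel cell = ennreal ((2*pi)^3)"
proof -
  have "(\<Prod>b\<in>Basis. (\<chi> i. 2*pi) \<bullet> (b::real^3)) = (2*pi)^3"
    by (simp add: Basis_real3 prod.reindex inj_on_def axis_eq_axis inner_axis)
  moreover have "b \<in> Basis \<Longrightarrow> (0::real^3) \<bullet> b \<le> (\<chi> i. 2*pi) \<bullet> b" for b
    by (auto simp: Basis_real3 inner_axis)
  ultimately show ?thesis unfolding cell_def by (simp add: emeasure_lborel_cbox_eq)
qed

lemma measure_cell: "measure lebesgue cell = (2*pi)^3"
  using emeasure_cell by (simp add: measure_def)

lemma finite_measure_torus: "finite_measure torus"
  by (rule finite_measureI) (use emeasure_cell in \<open>simp add: emeasure_restrict_space\<close>)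

interpretation torus: finite_measure torus by (rule finite_measure_torus)

lemma measure_torus: "measure torus cell = (2*pi)^3"
  by (simp add: measure_restrict_space measure_cell)

lemma continuous_borel_torus: "continuous_on cell f \<Longrightarrow> f \<in> borel_measurable torus"
  by (rule continuous_imp_measurable_on_sets_lebesgue) simp_all

lemma integrable_torus_bounded:
  fixes f :: "real^3 \<Rightarrow> real"
  assumes "f \<in> borel_measurable torus" "\<And>x. x \<in> cell \<Longrightarrow> \<bar>f x\<bar> \<le> B"
  shows "integrable torus f"
  by (rule torus.integrable_const_bound[of _ B]) (use assms in auto)

lemma integrable_torus_continuous:
  fixes f :: "real^3 \<Rightarrow> real"
  assumes "continuous_on cell f"
  shows "integrable torus f"
proof -
  obtain B where "\<And>x. x \<in> cell \<Longrightarrow> \<bar>f x\<bar> \<le> B"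
    using compact_imp_bounded[OF compact_continuous_image[OF assms compact_cell]]
    by (auto simp: bounded_iff)
  then show ?thesis using integrable_torus_bounded continuous_borel_torus assms by blast
qed

lemma integral_torus_continuous:
  fixes f :: "real^3 \<Rightarrow> real"
  assumes "continuous_on cell f"
  shows "integral\<^sup>L torus f = integral cell f"
  by (rule lebesgue_integral_eq_integral[OF integrable_torus_continuous[OF assms]]) simp

text \<open>
  Translation along one axis by at most a period: cut the shifted cell at the face where the coordinate
  equals \<open>2 * pi\<close> and move the protruding slab back by one period.
\<close>

lemma integral_cell_shift:
  fixes F :: "real^3 \<Rightarrow> real"
  assumes c: "continuous_on UNIV F" and p: "\<And>x. F (x + axis i (2*pi)) = F x"
    and s: "0 \<le> s" "s \<le> 2*pi"
  shows "integral cell (\<lambda>x. F (x + axis i s)) = integral cell F"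
proof -
  let ?k = "axis i 1 :: real^3"
  define L U :: "real^3" where "L = 0" and "U = (\<chi> j. 2*pi)"
  have cell: "cell = cbox L U" by (simp add: cell_def L_def U_def)
  have mem: "x \<in> cbox (L + axis i p) (U + axis i q) \<longleftrightarrow>
      (\<forall>j. j \<noteq> i \<longrightarrow> 0 \<le> x $ j \<and> x $ j \<le> 2*pi) \<and> p \<le> x $ i \<and> x $ i \<le> 2*pi + q" for x p q
    by (auto simp: mem_box_cart L_def U_def axis_def)
  have a0: "axis i 0 = (0::real^3)" by (simp add: vec_eq_iff axis_def)
  have k: "?k \<in> Basis" by (simp add: Basis_real3)
  have int: "F integrable_on cbox a b" for a b
    by (rule integrable_continuous) (use c continuous_on_subset in blast)
  have "integral cell (\<lambda>x. F (x + axis i s)) = integral (cbox (L + axis i s) (U + axis i s)) F"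
    using integral_shift_cbox_plus[where a=L and c="axis i s" and b=U and f=F] by (simp add: cell add.commute o_def)
  also have "\<dots> = integral (cbox (L + axis i s) (U + axis i s) \<inter> {x. x \<bullet> ?k \<le> 2*pi}) F
      + integral (cbox (L + axis i s) (U + axis i s) \<inter> {x. x \<bullet> ?k \<ge> 2*pi}) F"
    by (rule integral_split[OF int k])
  also have "cbox (L + axis i s) (U + axis i s) \<inter> {x. x \<bullet> ?k \<le> 2*pi} = cbox L U \<inter> {x. x \<bullet> ?k \<ge> s}"
    using s mem[of _ s s] mem[of _ "2*pi" s] mem[of _ 0 0] mem[of _ 0 "s - 2*pi"] by (auto simp: inner_axis L_def a0)
  also have "cbox (L + axis i s) (U + axis i s) \<inter> {x. x \<bullet> ?k \<ge> 2*pi} = cbox (L + axis i (2*pi)) (U + axis i s)"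
    using s mem[of _ s s] mem[of _ "2*pi" s] mem[of _ 0 0] mem[of _ 0 "s - 2*pi"] by (auto simp: inner_axis L_def a0)
  also have "integral (cbox (L + axis i (2*pi)) (U + axis i s)) F = integral (cbox L (U + axis i (s - 2*pi))) F"
  proof -
    have "U + axis i s = (U + axis i (s - 2*pi)) + axis i (2*pi)"
      by (simp add: vec_eq_iff axis_def)
    then show ?thesis
      using integral_shift_cbox_plus[where a=L and c="axis i (2*pi)" and b="U + axis i (s - 2*pi)" and f=F] p
      by (simp add: o_def add_ac)
  qed
  also have "cbox L (U + axis i (s - 2*pi)) = cbox L U \<inter> {x. x \<bullet> ?k \<le> s}"
    using s mem[of _ s s] mem[of _ "2*pi" s] mem[of _ 0 0] mem[of _ 0 "s - 2*pi"] by (auto simp: inner_axis L_def a0)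
  also have "integral (cbox L U \<inter> {x. s \<le> x \<bullet> ?k}) F + integral (cbox L U \<inter> {x. x \<bullet> ?k \<le> s}) F = integral cell F"
    using integral_split[OF int k, of L U s] by (simp add: cell)
  finally show ?thesis .
qed

text \<open>
  Averaging over all shifts in the direction \<open>i\<close> leaves the integral unchanged; after exchanging the
  two integrations, the inner one is the integral of a derivative over a full period. This is what
  integration by parts on the torus rests on, without boundary terms.
\<close>

lemma integral_cell_partial_0:
  fixes G F :: "real^3 \<Rightarrow> real"
  assumes c: "continuous_on UNIV F" and p: "\<And>x. G (x + axis i (2*pi)) = G x"
    and d: "\<And>x. ((\<lambda>s. G (x + axis i s)) has_real_derivative F x) (at 0)"
  shows "integral cell F = 0"
proof -
  have d': "((\<lambda>s. G (x + axis i s)) has_real_derivative F (x + axis i s)) (at s)" for x s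
  proof -
    have "((\<lambda>r. G ((x + axis i s) + axis i r)) has_real_derivative F (x + axis i s)) (at (s + (-s)))"
      using d[of "x + axis i s"] by simp
    then have *: "((\<lambda>r. G ((x + axis i s) + axis i (r + (-s)))) has_real_derivative F (x + axis i s)) (at s)"
      by (subst (asm) DERIV_shift)
    have eq: "(\<lambda>r. G ((x + axis i s) + axis i (r + (-s)))) = (\<lambda>r. G (x + axis i r))"
      by (rule ext, rule arg_cong[of _ _ G]) (simp add: vec_eq_iff axis_def)
    show ?thesis by (rule back_subst[of "\<lambda>g. (g has_real_derivative _) _", OF * eq])
  qed
  have pF: "F (x + axis i (2*pi)) = F x" for x
  proof -
    have "((\<lambda>s. G (x + axis i s)) has_real_derivative F (x + axis i (2*pi))) (at 0)"
      using d[of "x + axis i (2*pi)"] p[of "x + axis i s" for s] by (simp add: add_ac)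
    then show ?thesis using d DERIV_unique by blast
  qed
  have z: "integral {0..2*pi} (\<lambda>s. F (x + axis i s)) = 0" for x
  proof -
    have "((\<lambda>s. F (x + axis i s)) has_integral (G (x + axis i (2*pi)) - G (x + axis i 0))) {0..2*pi}"
      by (rule fundamental_theorem_of_calculus)
        (auto simp flip: has_real_derivative_iff_has_vector_derivative intro: DERIV_subset[OF d'])
      moreover have "axis i 0 = (0::real^3)" by (simp add: vec_eq_iff axis_def)
    ultimately show ?thesis using p[of x] by (simp add: integral_unique)
  qed
  have cont2: "continuous_on S (\<lambda>(s, x). F (x + axis i s))" for S
  proof -
    have ax: "axis i t = t *\<^sub>R (axis i 1 :: real^3)" for t :: real
      by (simp add: vec_eq_iff axis_def)
    have "continuous_on S (\<lambda>z. F (snd z + fst z *\<^sub>R axis i 1))"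
      by (rule continuous_on_compose2[OF c]) (intro continuous_intros, simp)
    moreover have "(\<lambda>(s, x). F (x + axis i s)) = (\<lambda>z. F (snd z + fst z *\<^sub>R axis i 1))"
      by (rule ext) (simp add: case_prod_unfold ax[symmetric])
    ultimately show ?thesis by (simp only:)
  qed
  have "integral {0..2*pi} (\<lambda>s. integral cell F) = integral {0..2*pi} (\<lambda>s. integral cell (\<lambda>x. F (x + axis i s)))"
    by (rule integral_cong) (simp add: integral_cell_shift[OF c pF])
  also have "\<dots> = integral cell (\<lambda>x. integral {0..2*pi} (\<lambda>s. F (x + axis i s)))"
    using integral_swap_continuous[of 0 0 "2*pi" "\<chi> j. 2*pi" "\<lambda>s x. F (x + axis i s)", OF cont2]
    by (simp add: cell_def)
  also have "\<dots> = 0" by (simp add: z)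
  finally show ?thesis by simp
qed

lemma integral_torus_partial_0:
  fixes G F :: "real^3 \<Rightarrow> real"
  assumes c: "continuous_on UNIV F" and p: "\<And>x. G (x + axis i (2*pi)) = G x"
    and d: "\<And>x. ((\<lambda>s. G (x + axis i s)) has_real_derivative F x) (at 0)"
  shows "integral\<^sup>L torus F = 0"
  using integral_torus_continuous[of F] integral_cell_partial_0[OF assms] continuous_on_subset[OF c]
  by auto

section \<open>Orthonormality of the eigenfunctions\<close>

lemma wave_vector_nth [simp]: "wave_vector k $ i = of_int (k $ i)"
  by (simp add: wave_vector_def)

lemma wave_vector_0 [simp]: "wave_vector 0 = 0"
  by (simp add: vec_eq_iff)

lemma wave_vector_minus [simp]: "wave_vector (- k) = - wave_vector k"
  by (simp add: vec_eq_iff)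

lemma wave_vector_diff: "wave_vector (j - k) = wave_vector j - wave_vector k"
  by (simp add: vec_eq_iff)

lemma eigval_eq: "eigval k = (\<Sum>i\<in>UNIV. (of_int (k $ i))\<^sup>2)"
  unfolding eigval_def power2_norm_eq_inner inner_vec_def by (simp add: power2_eq_square)

lemma eigval_nonneg [simp]: "eigval k \<ge> 0" by (simp add: eigval_def)

lemma eigval_minus [simp]: "eigval (- k) = eigval k" by (simp add: eigval_def)

lemma lex_pos_minus: "k \<noteq> 0 \<Longrightarrow> lex_pos (- k) \<longleftrightarrow> \<not> lex_pos k"
  by (auto simp: lex_pos_def vec_eq_iff forall_3)

lemma eigfun_minus:
  "k \<noteq> 0 \<Longrightarrow> eigfun (- k) x = (if lex_pos k then - (sqrt 2 * sin (wave_vector k \<bullet> x)) else sqrt 2 * cos (wave_vector k \<bullet> x)) / sqrt ((2*pi)^3)"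
  by (simp add: eigfun_def lex_pos_minus)

lemma eigfun_0: "eigfun 0 x = 1 / sqrt ((2*pi)^3)" by (simp add: eigfun_def)

text \<open>
  The products for \<open>k\<close> and \<open>- k\<close> add up to a function of \<open>x - y\<close>; this is what turns even Fourier
  multipliers into convolutions.
\<close>

lemma eigfun_addition:
  "eigfun k x * eigfun k y + eigfun (- k) x * eigfun (- k) y
     = 2 * cos (wave_vector k \<bullet> (x - y)) / (2*pi)^3"
proof (cases "k = 0")
  case False
  define q C1 S1 C2 S2 where "q = sqrt ((2*pi)^3)"
    and "C1 = cos (wave_vector k \<bullet> x)" and "S1 = sin (wave_vector k \<bullet> x)"
    and "C2 = cos (wave_vector k \<bullet> y)" and "S2 = sin (wave_vector k \<bullet> y)"
  have q: "(2*pi)^3 = q * q" "q \<noteq> 0" by (simp_all add: q_def)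
  have "sqrt 2 * sqrt 2 = 2" by simp
  then have *: "(sqrt 2 * a / q) * (sqrt 2 * b / q) = 2 * (a * b) / (q * q)" for a b :: real
    using q by (simp add: field_simps)
  have e: "eigfun k x = sqrt 2 * (if lex_pos k then C1 else S1) / q"
      "eigfun k y = sqrt 2 * (if lex_pos k then C2 else S2) / q"
      "eigfun (- k) x = sqrt 2 * (if lex_pos k then - S1 else C1) / q"
      "eigfun (- k) y = sqrt 2 * (if lex_pos k then - S2 else C2) / q"
    using False by (auto simp: lex_pos_minus eigfun_def C1_def C2_def S1_def S2_def q_def)
  have "eigfun k x * eigfun k y + eigfun (- k) x * eigfun (- k) y = 2 * (C1 * C2 + S1 * S2) / (q * q)"
    unfolding e * by (simp add: add_divide_distrib[symmetric] distrib_left)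
  then show ?thesis
    by (simp only: inner_diff_right cos_diff q(1) C1_def C2_def S1_def S2_def)
qed (simp add: eigfun_0 field_simps)

lemma eigfun_bound: "\<bar>eigfun k x\<bar> \<le> sqrt (2 / (2*pi)^3)"
proof -
  have "(eigfun k x)\<^sup>2 \<le> 2 / (2*pi)^3"
    using eigfun_addition[of k x x] zero_le_square[of "eigfun (-k) x"] by (simp add: power2_eq_square del: zero_le_square)
  then show ?thesis by (subst real_sqrt_abs[symmetric]) (rule real_sqrt_le_mono)
qed

lemma continuous_eigfun: "continuous_on S (eigfun k)"
  unfolding eigfun_def
  by (cases "k = 0"; cases "lex_pos k"; simp only: if_True if_False simp_thms; intro continuous_intros) simp_all

lemma measurable_eigfun [measurable]: "eigfun k \<in> borel_measurable borel" "eigfun k \<in> borel_measurable torus"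
  using continuous_eigfun by (auto intro: borel_measurable_continuous_onI continuous_borel_torus)

lemma inner_axis': "w \<bullet> (x + axis i s) = w \<bullet> x + w $ i * (s::real)"
  by (simp add: inner_add_right inner_axis)

lemma eigfun_periodic: "eigfun k (x + axis i (2*pi)) = eigfun k x"
proof -
  have "wave_vector k \<bullet> (x + axis i (2*pi)) = wave_vector k \<bullet> x + of_int (k $ i) * (2*pi)"
    by (simp add: inner_axis')
  moreover have "sin (t + of_int n * (2*pi)) = sin t" "cos (t + of_int n * (2*pi)) = cos t" for t and n :: int
    using sin_int_2pin[of n] cos_int_2pin[of n]
    by (simp_all only: sin_add cos_add mult.commute[of "of_int n"])
  ultimately show ?thesis by (simp only: eigfun_def)
qed

text \<open>
  The labelling of cosines and sines by \<open>k\<close> and \<open>- k\<close> makes differentiation uniform: it multiplies by a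
  component of \<open>k\<close> and exchanges \<open>k\<close> with \<open>- k\<close>.
\<close>

lemma eigfun_partial:
  "((\<lambda>s. eigfun k (x + axis i s)) has_real_derivative of_int (k $ i) * eigfun (- k) x) (at 0)"
proof (cases "k = 0")
  case False
  have c: "((\<lambda>s. sqrt 2 * cos (a + b * s) / q) has_real_derivative b * (- (sqrt 2 * sin a) / q)) (at 0)"
    and s: "((\<lambda>s. sqrt 2 * sin (a + b * s) / q) has_real_derivative b * (sqrt 2 * cos a / q)) (at 0)"
    for a b q :: real
    by (cases "q = 0"; auto intro!: derivative_eq_intros simp: field_simps)+
  show ?thesis
    using c[of "wave_vector k \<bullet> x" "of_int (k $ i)"] s[of "wave_vector k \<bullet> x" "of_int (k $ i)"] False
    by (cases "lex_pos k") (simp_all only: eigfun_minus[OF False] eigfun_def[of k] inner_axis' wave_vector_nth if_True if_False simp_thms)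
qed (simp add: eigfun_0)

abbreviation inner_ee :: "int^3 \<Rightarrow> int^3 \<Rightarrow> real" where
  "inner_ee j k \<equiv> L2_inner (eigfun j) (eigfun k)"

lemma L2_inner_commute: "L2_inner u w = L2_inner w u"
  by (simp add: L2_inner_def mult.commute)

lemma integrable_ee: "integrable torus (\<lambda>x. eigfun j x * eigfun k x)"
  by (intro integrable_torus_continuous continuous_intros continuous_eigfun)

lemma eigfun_parts: "of_int (j $ i) * inner_ee (- j) k = - (of_int (k $ i) * inner_ee j (- k))"
proof -
  let ?F = "\<lambda>x. of_int (j $ i) * (eigfun (- j) x * eigfun k x) + of_int (k $ i) * (eigfun j x * eigfun (- k) x)"
  have "integral\<^sup>L torus ?F = 0"
  proof (rule integral_torus_partial_0[where G="\<lambda>x. eigfun j x * eigfun k x" and i=i])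
    fix x
    show "((\<lambda>s. eigfun j (x + axis i s) * eigfun k (x + axis i s)) has_real_derivative ?F x) (at 0)"
      by (rule derivative_eq_intros eigfun_partial | simp add: axis_def zero_vec_def[symmetric])+
  qed (auto simp: eigfun_periodic intro!: continuous_intros continuous_eigfun)
  then show ?thesis
    by (simp add: integrable_ee L2_inner_def)
qed

text \<open>
  Write \<open>X = (e\<^sub>j, e\<^sub>k)\<close> and \<open>Y = (e\<^sub>-\<^sub>j, e\<^sub>-\<^sub>k)\<close>. Integration by parts gives \<open>j\<^sub>i X = k\<^sub>i Y\<close> and
  \<open>k\<^sub>i X = j\<^sub>i Y\<close> for every component, so \<open>X \<noteq> 0\<close> forces \<open>j = k\<close> or \<open>j = - k\<close>; in the second case symmetry
  gives \<open>X = Y\<close>, which contradicts the first relation. The normalization follows from the constancy of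
  \<open>e\<^sub>k\<^sup>2 + e\<^sub>-\<^sub>k\<^sup>2\<close>.
\<close>

lemma eigfun_orthonormal: "inner_ee j k = (if j = k then 1 else 0)"
proof -
  let ?X = "inner_ee j k" and ?Y = "inner_ee (- j) (- k)"
  have 1: "of_int (j $ i) * ?X = of_int (k $ i) * ?Y" for i
    using eigfun_parts[of "- j" i k] by simp
  have 2: "of_int (k $ i) * ?X = of_int (j $ i) * ?Y" for i
    using eigfun_parts[of j i "- k"] by simp
  have sq: "inner_ee k k + inner_ee (- k) (- k) = 2"
  proof -
    have "inner_ee k k + inner_ee (- k) (- k) = (\<integral>x. 2 / (2*pi)^3 \<partial>torus)"
      unfolding L2_inner_def using eigfun_addition[of k x x for x]
      by (subst Bochner_Integration.integral_add[symmetric]) (simp_all add: integrable_ee)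
    then show ?thesis by (simp add: measure_torus)
  qed
  show ?thesis
  proof (cases "j = k")
    case True
    then have "?X = ?Y"
    proof (cases "k = 0")
      case False
      then obtain i where "k $ i \<noteq> 0" by (auto simp: vec_eq_iff)
      then show ?thesis using 1[of i] True by simp
    qed simp
    then show ?thesis using sq True by simp
  next
    case False
    show ?thesis
    proof (rule ccontr)
      assume "\<not> ?thesis"
      then have X: "?X \<noteq> 0" using False by simp
      have r: "of_int (j $ i) * (?X\<^sup>2 - ?Y\<^sup>2) = 0" for i
        using 1[of i] 2[of i] by algebra
      obtain i where i: "j $ i \<noteq> 0"
      proof (rule ccontr)
        assume "\<not> thesis"
        then have "j = 0" using that by (auto simp: vec_eq_iff)
        then show False using 2 X False by (auto simp: vec_eq_iff)
      qed
      then have "?X\<^sup>2 = ?Y\<^sup>2" using r[of i] by simp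
      then consider "?X = ?Y" | "?X = - ?Y" by (auto simp: power2_eq_iff)
      then show False
      proof cases
        case 1
        then have "of_int (j $ i) = (of_int (k $ i) :: real)" for i using \<open>\<And>i. of_int (j $ i) * ?X = of_int (k $ i) * ?Y\<close>[of i] X by simp
        then show False using False by (simp add: vec_eq_iff)
      next
        case c2: 2
        then have "of_int (j $ i) = (- of_int (k $ i) :: real)" for i
        proof -
          have "(of_int (j $ i) + of_int (k $ i)) * ?Y = 0" using 1[of i] c2 by algebra
          then show ?thesis using X c2 by simp
        qed
        then have "j = - k" by (simp add: vec_eq_iff) (metis of_int_eq_iff of_int_minus)
        then have "?X = ?Y" by (simp add: L2_inner_commute)
        then show False using c2 X by simp
      qed
    qed
  qed
qed

section \<open>Finite Fourier sums and the Bessel inequality\<close>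

text \<open>
  Completeness of Lebesgue measure: solutions are determined almost everywhere only, so their
  representatives are changed on null sets throughout.
\<close>

lemma borel_measurable_lebesgue_on_cong_AE:
  assumes S: "S \<in> sets lebesgue" and f: "f \<in> borel_measurable (lebesgue_on S)"
    and ae: "AE x in lebesgue_on S. g x = f x"
  shows "g \<in> borel_measurable (lebesgue_on S)"
proof -
  from AE_E3[OF ae] obtain N where N1: "\<And>x. x \<in> space (lebesgue_on S) - N \<Longrightarrow> g x = f x"
    and N2: "N \<in> null_sets (lebesgue_on S)" by blast
  then have N: "N \<in> null_sets (lebesgue_on S)" "{x \<in> S. g x \<noteq> f x} \<subseteq> N" by auto
  then have N': "N \<in> null_sets lebesgue" using S by (simp add: null_sets_restrict_space)
  show ?thesis
  proof (rule borel_measurableI)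
    fix A :: "'b set" assume "open A"
    then have fA: "f -` A \<inter> S \<in> sets lebesgue"
      using measurable_sets[OF f, of A] S by (simp add: sets_restrict_space_iff)
    have sub: "(g -` A \<inter> S) \<inter> N \<in> sets lebesgue"
      using null_sets_completion_subset[OF _ N', of "(g -` A \<inter> S) \<inter> N"] by auto
    have eq: "g -` A \<inter> S = ((f -` A \<inter> S) - N) \<union> ((g -` A \<inter> S) \<inter> N)"
      using N(2) by auto
    have "g -` A \<inter> S \<in> sets lebesgue"
      by (subst eq) (use fA sub N' in auto)
    then show "g -` A \<inter> space (lebesgue_on S) \<in> sets (lebesgue_on S)"
      using S by (simp add: sets_restrict_space_iff)
  qed
qed

lemma L2_torus_measurable: "L2_torus u \<Longrightarrow> u \<in> borel_measurable torus"
  by (simp add: L2_torus_def)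

lemma abs_mult_le_squares: "\<bar>a * b\<bar> \<le> a\<^sup>2 + b\<^sup>2" for a b :: real
proof -
  have "2 * (\<bar>a\<bar> * \<bar>b\<bar>) \<le> a\<^sup>2 + b\<^sup>2"
    using sum_squares_bound[of "\<bar>a\<bar>" "\<bar>b\<bar>"] by (simp add: mult.assoc)
  moreover have "0 \<le> \<bar>a\<bar> * \<bar>b\<bar>" by simp
  ultimately show ?thesis unfolding abs_mult by linarith
qed

lemma L2_torus_mult: assumes "L2_torus u" "L2_torus w" shows "integrable torus (\<lambda>x. u x * w x)"
proof (rule Bochner_Integration.integrable_bound)
  show "integrable torus (\<lambda>x. (u x)\<^sup>2 + (w x)\<^sup>2)"
    using assms by (simp add: L2_torus_def)
  show "(\<lambda>x. u x * w x) \<in> borel_measurable torus"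
    using assms[THEN L2_torus_measurable] by (rule borel_measurable_times)
  show "AE x in torus. norm (u x * w x) \<le> norm ((u x)\<^sup>2 + (w x)\<^sup>2)"
    using abs_mult_le_squares by (simp add: abs_of_nonneg)
qed

lemma L2_torus_add: assumes "L2_torus u" "L2_torus w" shows "L2_torus (\<lambda>x. u x + w x)"
proof -
  have "integrable torus (\<lambda>x. (u x)\<^sup>2 + (w x)\<^sup>2 + 2 * (u x * w x))"
    using assms L2_torus_mult[OF assms] by (simp add: L2_torus_def)
  moreover have "(\<lambda>x. u x + w x) \<in> borel_measurable torus"
    using assms[THEN L2_torus_measurable] by (rule borel_measurable_add)
  ultimately show ?thesis by (simp add: L2_torus_def power2_sum mult.assoc)
qed

lemma L2_torus_cmult: "L2_torus u \<Longrightarrow> L2_torus (\<lambda>x. c * u x)"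
  using borel_measurable_times[of "\<lambda>x. c" torus u]
  by (simp add: L2_torus_def power_mult_distrib)

lemma L2_torus_diff: "L2_torus u \<Longrightarrow> L2_torus w \<Longrightarrow> L2_torus (\<lambda>x. u x - w x)"
  using L2_torus_add[of u "\<lambda>x. (-1) * w x"] L2_torus_cmult[of w "-1"] by simp

lemma L2_torus_continuous: "continuous_on cell f \<Longrightarrow> L2_torus f"
  unfolding L2_torus_def by (auto intro!: continuous_borel_torus integrable_torus_continuous continuous_intros)

lemma L2_eigfun: "L2_torus (eigfun k)"
  by (intro L2_torus_continuous continuous_eigfun)

lemma L2_torus_cong_AE:
  assumes "L2_torus u" "AE x in torus. w x = u x"
  shows "L2_torus w"
proof -
  have w: "w \<in> borel_measurable torus"
    by (rule borel_measurable_lebesgue_on_cong_AE[OF _ L2_torus_measurable[OF assms(1)] assms(2)]) simp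
  have "integrable torus (\<lambda>x. (w x)\<^sup>2)"
    by (rule integrable_cong_AE_imp[where g="\<lambda>x. (u x)\<^sup>2"])
      (use assms w in \<open>auto simp: L2_torus_def intro: borel_measurable_power\<close>)
  then show ?thesis using w by (simp add: L2_torus_def)
qed

lemma L2_inner_cong_AE:
  assumes "L2_torus u" "L2_torus w" "AE x in torus. u' x = u x" "AE x in torus. w' x = w x"
  shows "L2_inner u' w' = L2_inner u w"
  unfolding L2_inner_def
proof (rule integral_cong_AE)
  show "(\<lambda>x. u' x * w' x) \<in> borel_measurable torus" "(\<lambda>x. u x * w x) \<in> borel_measurable torus"
    using L2_torus_mult[OF L2_torus_cong_AE[OF assms(1,3)] L2_torus_cong_AE[OF assms(2,4)]] L2_torus_mult[OF assms(1,2)]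
    by (auto dest: borel_measurable_integrable)
qed (use assms(3,4) in auto)

lemma coeff_cong_AE: "L2_torus u \<Longrightarrow> AE x in torus. w x = u x \<Longrightarrow> coeff w k = coeff u k"
  unfolding coeff_def by (rule L2_inner_cong_AE[OF _ L2_eigfun]) auto

lemma L2_inner_add_left: "L2_torus u \<Longrightarrow> L2_torus v \<Longrightarrow> L2_torus w \<Longrightarrow> L2_inner (\<lambda>x. u x + v x) w = L2_inner u w + L2_inner v w"
  by (simp add: L2_inner_def distrib_right L2_torus_mult)

lemma L2_inner_diff_left: "L2_torus u \<Longrightarrow> L2_torus v \<Longrightarrow> L2_torus w \<Longrightarrow> L2_inner (\<lambda>x. u x - v x) w = L2_inner u w - L2_inner v w"
  by (simp add: L2_inner_def left_diff_distrib L2_torus_mult)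

lemma L2_inner_cmult_left: "L2_inner (\<lambda>x. c * u x) w = c * L2_inner u w"
  by (simp add: L2_inner_def mult.assoc)

lemma L2_inner_cmult_right: "L2_inner u (\<lambda>x. c * w x) = c * L2_inner u w"
  by (simp add: L2_inner_commute[of u] L2_inner_cmult_left)

lemma L2_inner_nonneg: "0 \<le> L2_inner u u"
  unfolding L2_inner_def by (intro integral_nonneg_AE) auto

definition fsum :: "(int^3 \<Rightarrow> real) \<Rightarrow> (int^3) set \<Rightarrow> real^3 \<Rightarrow> real" where
  "fsum a F x = (\<Sum>k\<in>F. a k * eigfun k x)"

lemma continuous_fsum: "continuous_on S (fsum a F)"
  unfolding fsum_def by (intro continuous_intros continuous_eigfun)

lemma L2_fsum: "L2_torus (fsum a F)"
  by (intro L2_torus_continuous continuous_fsum)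

lemma L2_inner_fsum_integrable:
  assumes "\<And>k. integrable torus (\<lambda>x. w x * eigfun k x)"
  shows "L2_inner w (fsum a F) = (\<Sum>k\<in>F. a k * coeff w k)"
proof -
  have "L2_inner w (fsum a F) = (\<integral>x. (\<Sum>k\<in>F. a k * (w x * eigfun k x)) \<partial>torus)"
    by (simp add: L2_inner_def fsum_def sum_distrib_left mult_ac)
  also have "\<dots> = (\<Sum>k\<in>F. a k * coeff w k)"
    by (subst Bochner_Integration.integral_sum) (auto simp: coeff_def L2_inner_def assms)
  finally show ?thesis .
qed

lemma L2_inner_fsum: "L2_torus w \<Longrightarrow> L2_inner w (fsum a F) = (\<Sum>k\<in>F. a k * coeff w k)"
  by (rule L2_inner_fsum_integrable) (rule L2_torus_mult[OF _ L2_eigfun])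

lemma coeff_fsum: "finite F \<Longrightarrow> coeff (fsum a F) k = (if k \<in> F then a k else 0)"
  using L2_inner_fsum[OF L2_eigfun[of k], of a F]
  by (simp add: coeff_def L2_inner_commute[of "fsum a F"] eigfun_orthonormal if_distrib[of "\<lambda>x. _ * x"] sum.delta' cong: if_cong)

lemma coeff_add: "L2_torus u \<Longrightarrow> L2_torus w \<Longrightarrow> coeff (\<lambda>x. u x + w x) k = coeff u k + coeff w k"
  by (simp add: coeff_def L2_inner_add_left L2_eigfun)

lemma coeff_diff: "L2_torus u \<Longrightarrow> L2_torus w \<Longrightarrow> coeff (\<lambda>x. u x - w x) k = coeff u k - coeff w k"
  by (simp add: coeff_def L2_inner_diff_left L2_eigfun)

lemma norm_fsum: "finite F \<Longrightarrow> L2_inner (fsum a F) (fsum a F) = (\<Sum>k\<in>F. (a k)\<^sup>2)"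
  by (simp add: L2_inner_fsum[OF L2_fsum] coeff_fsum power2_eq_square)

lemma bessel_identity:
  assumes "L2_torus w" "finite F"
  shows "L2_inner (\<lambda>x. w x - fsum (coeff w) F x) (\<lambda>x. w x - fsum (coeff w) F x)
    = L2_inner w w - (\<Sum>k\<in>F. (coeff w k)\<^sup>2)"
proof -
  let ?s = "fsum (coeff w) F"
  have d: "L2_torus (\<lambda>x. w x - ?s x)" by (intro L2_torus_diff assms L2_fsum)
  have "L2_inner (\<lambda>x. w x - ?s x) (\<lambda>x. w x - ?s x) =
     L2_inner w (\<lambda>x. w x - ?s x) - L2_inner ?s (\<lambda>x. w x - ?s x)"
    by (rule L2_inner_diff_left[OF assms(1) L2_fsum d])
  also have "\<dots> = (L2_inner w w - L2_inner w ?s) - (L2_inner w ?s - L2_inner ?s ?s)"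
    using L2_inner_diff_left[OF assms(1) L2_fsum assms(1)] L2_inner_diff_left[OF assms(1) L2_fsum L2_fsum]
    by (simp add: L2_inner_commute)
  finally show ?thesis
    using assms by (simp add: L2_inner_fsum norm_fsum power2_eq_square)
qed

lemma bessel: "L2_torus w \<Longrightarrow> finite F \<Longrightarrow> (\<Sum>k\<in>F. (coeff w k)\<^sup>2) \<le> L2_inner w w"
  using bessel_identity[of w F] L2_inner_nonneg[of "\<lambda>x. w x - fsum (coeff w) F x"] by simp

lemma bessel_single: "L2_torus w \<Longrightarrow> (coeff w k)\<^sup>2 \<le> L2_inner w w"
  using bessel[of w "{k}"] by simp

lemma coeff_sq_summable: "L2_torus w \<Longrightarrow> (\<lambda>k. (coeff w k)\<^sup>2) summable_on UNIV"
  by (rule nonneg_bdd_above_summable_on) (auto intro!: bdd_aboveI[of _ "L2_inner w w"] bessel)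

section \<open>Completeness of the trigonometric system\<close>

lemma AE_zero_if_boxes:
  fixes g :: "'a::euclidean_space \<Rightarrow> real"
  assumes g: "integrable lborel g" and box: "\<And>l u. (LINT x:box l u|lborel. g x) = 0"
  shows "AE x in lborel. g x = 0"
proof (rule sigma_finite_measure.density_zero[OF sigma_finite_lborel g])
  have gi: "set_integrable lborel A g" if "A \<in> sets borel" for A
    unfolding set_integrable_def by (rule integrable_mult_indicator) (use that g in auto)
  have tot: "integral\<^sup>L lborel g = 0"
  proof -
    have "(\<lambda>n. \<integral>x. indicator (box (- real n *\<^sub>R One) (real n *\<^sub>R One)) x *\<^sub>R g x \<partial>lborel) \<longlonglongrightarrow> integral\<^sup>L lborel g"
    proof (rule integral_dominated_convergence[where w="\<lambda>x. norm (g x)"])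
      show "AE x in lborel. (\<lambda>n. indicator (box (- real n *\<^sub>R One) (real n *\<^sub>R One)) x *\<^sub>R g x) \<longlonglongrightarrow> g x"
      proof (rule AE_I2)
        fix x :: 'a
        obtain N :: nat where N: "norm x < real N" using reals_Archimedean2 by blast
        have "x \<in> box (- real n *\<^sub>R One) (real n *\<^sub>R One)" if "n \<ge> N" for n
          unfolding mem_box
        proof
          fix i :: 'a assume i: "i \<in> Basis"
          have "\<bar>x \<bullet> i\<bar> \<le> norm x" using i by (rule Basis_le_norm)
          moreover have "real N \<le> real n" using that by simp
          ultimately show "(- real n *\<^sub>R One) \<bullet> i < x \<bullet> i \<and> x \<bullet> i < (real n *\<^sub>R One) \<bullet> i"
            using N i by auto
        qed
        then have "eventually (\<lambda>n. indicator (box (- real n *\<^sub>R One) (real n *\<^sub>R One)) x *\<^sub>R g x = g x) sequentially"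
          using eventually_sequentially by (auto intro!: exI[of _ N])
        then show "(\<lambda>n. indicator (box (- real n *\<^sub>R One) (real n *\<^sub>R One)) x *\<^sub>R g x) \<longlonglongrightarrow> g x"
          by (rule tendsto_eventually)
      qed
    qed (use g in \<open>auto intro!: AE_I2 simp: indicator_def\<close>)
    moreover have "(\<integral>x. indicator (box (- real n *\<^sub>R One) (real n *\<^sub>R One)) x *\<^sub>R g x \<partial>lborel) = 0" for n
      using box by (simp add: set_lebesgue_integral_def)
    ultimately show ?thesis by (simp only: LIMSEQ_const_iff)
  qed
  have sets: "sets borel = sigma_sets UNIV (range (\<lambda>(a, b). box a b :: 'a set))"
    by (subst borel_eq_box) (simp add: sets_measure_of)
  fix A :: "'a set" assume "A \<in> sets lborel"
  then have A: "A \<in> sigma_sets UNIV (range (\<lambda>(a, b). box a b))"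
    by (simp add: sets)
  have stable: "Int_stable (range (\<lambda>(a, b). box a b :: 'a set))"
    by (auto simp: Int_stable_def box_Int_box)
  from stable subset_UNIV[of "range (\<lambda>(a, b). box a b :: 'a set)", folded Pow_UNIV] A
  show "(LINT x:A|lborel. g x) = 0"
  proof (induction rule: sigma_sets_induct_disjoint)
    case (basic A)
    then show ?case using box by auto
  next
    case (compl A)
    then have A: "A \<in> sets borel" by (simp add: sets)
    have "(LINT x:UNIV - A|lborel. g x) + (LINT x:A|lborel. g x) = (LINT x:(UNIV - A) \<union> A|lborel. g x)"
      by (rule set_integral_Un[symmetric]) (use A gi in auto)
    moreover have "(LINT x:(UNIV - A) \<union> A|lborel. g x) = 0"
      using tot by (simp add: set_lebesgue_integral_def)
    ultimately show ?case using compl by simp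
  next
    case (union A)
    then have A: "A i \<in> sets lborel" for i by (auto simp: sets)
    have "(LINT x:(\<Union>i. A i)|lborel. g x) = (\<Sum>i. (LINT x:(A i)|lborel. g x))"
      by (rule lebesgue_integral_countable_add)
        (use A gi[of "\<Union>i. A i"] union(1) in \<open>auto simp: disjoint_family_on_def\<close>)
    then show ?case using union by simp
  qed (auto simp: set_lebesgue_integral_def)
qed

text \<open>
  Trigonometric polynomials, generated by plane waves so that closure under products reduces to the
  addition formulas.
\<close>

inductive trig :: "(real^3 \<Rightarrow> real) \<Rightarrow> bool" where
  wave: "trig (\<lambda>x. A * cos (wave_vector k \<bullet> x) + B * sin (wave_vector k \<bullet> x))"
| add: "trig f \<Longrightarrow> trig g \<Longrightarrow> trig (\<lambda>x. f x + g x)"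

lemma trig_const: "trig (\<lambda>x. c)"
  using trig.wave[of c 0 0] by simp

lemma trig_mult_waves:
  "trig (\<lambda>x. (A * cos (wave_vector j \<bullet> x) + B * sin (wave_vector j \<bullet> x)) *
             (C * cos (wave_vector k \<bullet> x) + D * sin (wave_vector k \<bullet> x)))"
proof -
  have *: "(A * cos a + B * sin a) * (C * cos b + D * sin b) =
      ((A * C + B * D) / 2 * cos (a - b) + (B * C - A * D) / 2 * sin (a - b)) +
      ((A * C - B * D) / 2 * cos (a + b) + (B * C + A * D) / 2 * sin (a + b))" for a b :: real
    by (simp add: cos_add cos_diff sin_add sin_diff field_simps)
  have "trig (\<lambda>x. ((A * C + B * D) / 2 * cos (wave_vector (j - k) \<bullet> x) + (B * C - A * D) / 2 * sin (wave_vector (j - k) \<bullet> x)) +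
      ((A * C - B * D) / 2 * cos (wave_vector (j - - k) \<bullet> x) + (B * C + A * D) / 2 * sin (wave_vector (j - - k) \<bullet> x)))"
    by (intro trig.add trig.wave)
  then show ?thesis
    unfolding * wave_vector_diff by (simp only: wave_vector_minus inner_diff_left inner_minus_left inner_add_left diff_minus_eq_add)
qed

lemma trig_mult: "trig f \<Longrightarrow> trig g \<Longrightarrow> trig (\<lambda>x. f x * g x)"
proof (induction rule: trig.induct)
  case (wave A k B)
  from wave show ?case
  proof (induction rule: trig.induct)
    case (wave A' k' B')
    show ?case by (rule trig_mult_waves)
  next
    case (add f g)
    show ?case using trig.add[OF add.IH] by (simp only: distrib_left)
  qed
next
  case (add f1 f2)
  then show ?case by (auto simp: distrib_right intro: trig.add)
qed

lemma trig_continuous: "trig f \<Longrightarrow> continuous_on S f"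
  by (induction rule: trig.induct) (auto intro!: continuous_intros)

lemma wave_eigfun:
  "\<exists>a b. \<forall>x. A * cos (wave_vector k \<bullet> x) + B * sin (wave_vector k \<bullet> x) = a * eigfun k x + b * eigfun (- k) x"
proof (cases "k = 0")
  case True
  then show ?thesis by (intro exI[of _ "A * sqrt ((2*pi)^3)"] exI[of _ 0]) (simp add: eigfun_0)
next
  case False
  define q where "q = sqrt ((2*pi)^3)"
  have q: "q \<noteq> 0" by (simp add: q_def)
  have e: "eigfun k x = sqrt 2 * (if lex_pos k then cos (wave_vector k \<bullet> x) else sin (wave_vector k \<bullet> x)) / q"
    "eigfun (- k) x = sqrt 2 * (if lex_pos k then - sin (wave_vector k \<bullet> x) else cos (wave_vector k \<bullet> x)) / q" for x
    using False by (auto simp: lex_pos_minus eigfun_def q_def)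
  show ?thesis
  proof (cases "lex_pos k")
    case True
    then show ?thesis using False q
      by (intro exI[of _ "A * q / sqrt 2"] exI[of _ "- (B * q / sqrt 2)"]) (simp add: e)
  next
    case F: False
    then show ?thesis using False q
      by (intro exI[of _ "B * q / sqrt 2"] exI[of _ "A * q / sqrt 2"]) (simp add: e)
  qed
qed

lemma trig_orthogonal:
  assumes w: "L2_torus w" and c: "\<And>k. coeff w k = 0"
  shows "trig h \<Longrightarrow> L2_inner w h = 0"
proof (induction rule: trig.induct)
  case (wave A k B)
  obtain a b where ab: "\<And>x. A * cos (wave_vector k \<bullet> x) + B * sin (wave_vector k \<bullet> x) = a * eigfun k x + b * eigfun (- k) x"
    using wave_eigfun by metis
  have "L2_inner (\<lambda>x. a * eigfun k x + b * eigfun (- k) x) w = a * coeff w k + b * coeff w (- k)"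
    by (subst L2_inner_add_left)
      (auto simp: L2_inner_cmult_left coeff_def L2_inner_commute w intro: L2_torus_cmult L2_eigfun)
  then show ?case by (simp add: ab c L2_inner_commute)
next
  case (add f g)
  then show ?case
    using L2_inner_add_left[of f g w] L2_torus_continuous trig_continuous w
    by (simp add: L2_inner_commute[of w])
qed

lemma trig_polynomial:
  assumes T: "trig T" shows "real_polynomial_function p \<Longrightarrow> trig (\<lambda>x. p (T x))"
proof (induction rule: real_polynomial_function.induct)
  case (linear f)
  then interpret bounded_linear f .
  have "(\<lambda>x. f (T x)) = (\<lambda>x. f 1 * T x)" using scaleR[of "T x" 1 for x] by (simp add: mult.commute)
  moreover have "trig (\<lambda>x. f 1 * T x)" by (rule trig_mult[OF trig_const T])
  ultimately show ?case by (simp only:)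
qed (auto intro: trig_const trig.add trig_mult)

text \<open>
  Inside one period an interval is a superlevel set of a trigonometric polynomial.
\<close>

lemma cos_ball_iff:
  fixes t c r :: real
  assumes "0 \<le> t" "t \<le> 2*pi" "0 < r" "r \<le> c" "c + r \<le> 2*pi"
  shows "cos r < cos (t - c) \<longleftrightarrow> \<bar>t - c\<bar> < r"
proof -
  let ?d = "\<bar>t - c\<bar>"
  have c: "cos (t - c) = cos ?d" by (simp add: abs_if) (metis cos_minus minus_diff_eq)
  have r: "r \<le> pi" using assms by linarith
  have d: "?d \<le> 2*pi - r" using assms by (auto simp: abs_if)
  show ?thesis
  proof (cases "?d \<le> pi")
    case True
    show ?thesis by (subst c, rule cos_mono_less_eq) (use True r assms(3) in auto)
  next
    case False
    have "cos ?d = cos (2*pi - ?d)" by (simp add: cos_diff)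
    also have "\<dots> \<le> cos r"
      using False d assms(3) r by (intro cos_monotone_0_pi_le) auto
    finally have "cos (t - c) \<le> cos r" unfolding c .
    moreover have "\<not> ?d < r" using False r by linarith
    ultimately show ?thesis by (simp add: not_less[symmetric])
  qed
qed

text \<open>
  Polynomials that stay bounded and converge to the indicator of the positive half line, by the
  Weierstrass theorem applied to \<open>min 1 (max 0 (n t))\<close>.
\<close>

lemma soft_threshold:
  "\<exists>p. \<forall>n. real_polynomial_function (p n) \<and> (\<forall>t\<in>{-2..2::real}. \<bar>p n t\<bar> \<le> 2) \<and> 
     (\<forall>t\<in>{-2..2}. (\<lambda>n. p n t) \<longlonglongrightarrow> (if t > 0 then 1 else 0 :: real))"
proof -
  let ?q = "\<lambda>n t. min 1 (max 0 (real n * t))"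
  have "\<exists>p. real_polynomial_function p \<and> (\<forall>t\<in>{-2..2}. \<bar>?q n t - p t\<bar> < 1 / (real n + 1))" for n
  proof -
    have c: "continuous_on {-2..2} (?q n)" by (intro continuous_intros)
    have e: "0 < 1 / (real n + 1)" by simp
    show ?thesis
      by (rule Stone_Weierstrass_real_polynomial_function[OF compact_Icc c e]) auto
  qed
  then obtain p where p: "\<And>n. real_polynomial_function (p n)"
    "\<And>n t. t \<in> {-2..2} \<Longrightarrow> \<bar>?q n t - p n t\<bar> < 1 / (real n + 1)" by metis
  have b: "\<bar>p n t\<bar> \<le> 2" if "t \<in> {-2..2}" for n t
  proof -
    have "1 / (real n + 1) \<le> 1" by simp
    moreover have "\<bar>?q n t\<bar> \<le> 1" by auto
    ultimately show ?thesis using p(2)[OF that, of n] by linarith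
  qed
  have l: "(\<lambda>n. p n t) \<longlonglongrightarrow> (if t > 0 then 1 else 0)" if t: "t \<in> {-2..2}" for t
  proof -
    have q: "(\<lambda>n. ?q n t) \<longlonglongrightarrow> (if t > 0 then 1 else 0)"
    proof (cases "t > 0")
      case True
      then obtain N :: nat where N: "1 / t < real N" using reals_Archimedean2 by blast
      have "?q n t = 1" if "n \<ge> N" for n
      proof -
        have "1 / t \<le> real n" using N that by linarith
        then show ?thesis using True by (simp add: field_simps)
      qed
      then have "eventually (\<lambda>n. ?q n t = 1) sequentially"
        unfolding eventually_sequentially by blast
      then show ?thesis using True by (simp add: tendsto_eventually)
    next
      case False
      then have "real n * t \<le> 0" for n by (intro mult_nonneg_nonpos) auto
      then have "?q n t = 0" for n by (simp add: max.absorb1)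
      then show ?thesis using False by simp
    qed
    have "(\<lambda>n. ?q n t - p n t) \<longlonglongrightarrow> 0"
    proof (rule tendsto_rabs_zero_cancel, rule tendsto_sandwich[OF _ _ tendsto_const])
      show "(\<lambda>n. 1 / (real n + 1)) \<longlonglongrightarrow> 0"
        using LIMSEQ_inverse_real_of_nat by (simp add: inverse_eq_divide add.commute)
    qed (use p(2)[OF t] in \<open>auto intro: always_eventually less_imp_le\<close>)
    from tendsto_diff[OF q this] show ?thesis by simp
  qed
  show ?thesis using p(1) b l by blast
qed

text \<open>
  Passage to Borel measurable integrands, for which product measures and the uniqueness of densities are
  available.
\<close>

lemma torus_eq_lborel:
  fixes f :: "real^3 \<Rightarrow> real"
  assumes "f \<in> borel_measurable borel"
  shows "integral\<^sup>L torus f = (\<integral>x. indicator cell x * f x \<partial>lborel)"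
    "integrable torus f \<longleftrightarrow> integrable lborel (\<lambda>x. indicator cell x * f x)"
proof -
  have m: "(\<lambda>x. indicator cell x * f x) \<in> borel_measurable lborel"
    using assms by (intro borel_measurable_times) auto
  show "integral\<^sup>L torus f = (\<integral>x. indicator cell x * f x \<partial>lborel)"
    by (simp add: integral_restrict_space integral_completion[OF m])
  show "integrable torus f \<longleftrightarrow> integrable lborel (\<lambda>x. indicator cell x * f x)"
    by (simp add: integrable_restrict_space integrable_completion[OF m])
qed

lemma AE_torus_iff: "(AE x in torus. P x) \<longleftrightarrow> (AE x in lborel. x \<in> cell \<longrightarrow> P x)"
  by (simp add: AE_restrict_space_iff AE_completion_iff)

lemma torus_borel_representative:
  fixes w :: "real^3 \<Rightarrow> real"
  assumes "w \<in> borel_measurable torus"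
  obtains g where "g \<in> borel_measurable borel" "AE x in torus. g x = w x"
proof -
  have "(\<lambda>x. indicator cell x *\<^sub>R w x) \<in> borel_measurable lebesgue"
    using assms by (simp add: borel_measurable_restrict_space_iff)
  from completion_ex_borel_measurable_real[OF this]
  obtain g where g: "g \<in> borel_measurable lborel" "AE x in lborel. indicator cell x *\<^sub>R w x = g x"
    by blast
  have "AE x in torus. g x = w x" unfolding AE_torus_iff using g(2) by eventually_elim auto
  then show ?thesis using that g(1) by simp
qed

lemma borel_measurable_torus: "f \<in> borel_measurable borel \<Longrightarrow> f \<in> borel_measurable torus"
  by (intro measurable_restrict_space1 measurable_completion) simp

lemma AE_interior_cell: "AE x in lborel. x \<in> cell \<longrightarrow> x \<in> box 0 (\<chi> i. 2*pi)"
proof -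
  have "negligible (cell - box 0 (\<chi> i. 2*pi))"
    unfolding cell_def by (rule negligible_frontier_interval)
  then have "AE x in lebesgue. x \<notin> cell - box 0 (\<chi> i. 2*pi)"
    by (intro AE_not_in) (simp only: negligible_iff_null_sets)
  then show ?thesis by (simp only: AE_completion_iff) (auto elim: eventually_mono)
qed

text \<open>
  The indicator of a box is a product of three indicators of superlevel sets of the functions
  \<open>cos (x\<^sub>i - m\<^sub>i) - cos r\<^sub>i\<close>, hence a bounded pointwise limit of trigonometric polynomials.
\<close>

lemma box_integral_0:
  assumes w: "L2_torus w" and c: "\<And>k. coeff w k = 0"
    and lu: "\<And>i. 0 \<le> l $ i" "\<And>i. l $ i < u $ i" "\<And>i. u $ i \<le> 2 * pi"
  shows "L2_inner w (indicator (box l u)) = 0"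
proof -
  obtain p where p: "\<And>n::nat. real_polynomial_function (p n)" "\<And>n t. t \<in> {-2..2::real} \<Longrightarrow> \<bar>p n t\<bar> \<le> 2"
     "\<And>t. t \<in> {-2..2} \<Longrightarrow> (\<lambda>n. p n t) \<longlonglongrightarrow> (if t > 0 then 1 else 0 :: real)"
    using soft_threshold by blast
  define m r where "m = (\<lambda>i. (l $ i + u $ i) / 2)" and "r = (\<lambda>i. (u $ i - l $ i) / 2)"
  (* T i is positive exactly on the i-th side of the box. *)
  define T where "T = (\<lambda>i x. cos ((x::real^3) $ i - m i) - cos (r i))"
  have T2: "T i x \<in> {-2..2}" for i x
    using cos_le_one[of "x $ i - m i"] cos_ge_minus_one[of "x $ i - m i"] cos_le_one[of "r i"] cos_ge_minus_one[of "r i"]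
    by (simp add: T_def del: cos_le_one cos_ge_minus_one)
  have trT: "trig (T i)" for i
  proof -
    have "wave_vector (axis i 1) \<bullet> x = x $ i" for x
      by (simp add: wave_vector_def inner_axis' axis_def inner_vec_def if_distrib[of "\<lambda>y. y * _"] if_distrib[of real_of_int] sum.delta cong: if_cong)
    then have "T i = (\<lambda>x. (cos (m i) * cos (wave_vector (axis i 1) \<bullet> x) + sin (m i) * sin (wave_vector (axis i 1) \<bullet> x)) + (- cos (r i)))"
      by (auto simp: T_def cos_diff fun_eq_iff)
    moreover have "trig \<dots>" by (intro trig.add trig.wave trig_const)
    ultimately show ?thesis by (simp only:)
  qed
  have Tpos: "T i x > 0 \<longleftrightarrow> l $ i < x $ i \<and> x $ i < u $ i" if "x \<in> cell" for i x
  proof -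
    have "cos (r i) < cos (x $ i - m i) \<longleftrightarrow> \<bar>x $ i - m i\<bar> < r i"
      by (rule cos_ball_iff) (use that lu[of i] in \<open>auto simp: cell_eq m_def r_def field_simps\<close>)
    then show ?thesis by (auto simp: T_def m_def r_def abs_less_iff field_simps)
  qed
  define h where "h = (\<lambda>n x. p n (T 1 x) * p n (T 2 x) * p n (T 3 x))"
  have "trig (\<lambda>x. p n (T i x))" for n i by (rule trig_polynomial[OF trT p(1)])
  then have trh: "trig (h n)" for n unfolding h_def
    by (intro trig_mult)
  have hb: "\<bar>h n x\<bar> \<le> 8" for n x
  proof -
    have "\<bar>h n x\<bar> \<le> 2 * 2 * 2" unfolding h_def abs_mult
      by (intro mult_mono) (use p(2) T2 in auto)
    then show ?thesis by simp
  qed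
  have hl: "(\<lambda>n. h n x) \<longlonglongrightarrow> indicator (box l u) x" if "x \<in> cell" for x
  proof -
    have "(\<lambda>n. h n x) \<longlonglongrightarrow> (if T 1 x > 0 then 1 else 0) * (if T 2 x > 0 then 1 else 0) * (if T 3 x > 0 then 1 else 0)"
      unfolding h_def by (intro tendsto_mult p(3) T2)
    also have "(if T 1 x > 0 then 1 else 0) * (if T 2 x > 0 then 1 else 0) * (if T 3 x > 0 then 1 else 0) = (indicator (box l u) x :: real)"
      using Tpos[OF that] by (auto simp: indicator_def mem_box_cart forall_3)
    finally show ?thesis .
  qed
  have wm: "w \<in> borel_measurable torus" using w by (rule L2_torus_measurable)
  have hm: "h n \<in> borel_measurable torus" for n by (intro continuous_borel_torus trig_continuous trh)
  have wi: "integrable torus w"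
    using L2_torus_mult[OF w L2_torus_continuous[of "\<lambda>x. 1"]] by simp
  have "(\<lambda>n. L2_inner w (h n)) \<longlonglongrightarrow> L2_inner w (indicator (box l u))"
    unfolding L2_inner_def
  proof (rule integral_dominated_convergence[where w="\<lambda>x. 8 * \<bar>w x\<bar>"])
    have "indicator (box l u) \<in> borel_measurable torus"
      by (rule borel_measurable_torus) simp
    with wm show "(\<lambda>x. w x * indicator (box l u) x) \<in> borel_measurable torus" 
      by (rule borel_measurable_times)
    show "(\<lambda>x. w x * h n x) \<in> borel_measurable torus" for n using wm hm by (rule borel_measurable_times)
    show "integrable torus (\<lambda>x. 8 * \<bar>w x\<bar>)" using wi by simp
    show "AE x in torus. (\<lambda>n. w x * h n x) \<longlonglongrightarrow> w x * indicator (box l u) x"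
      by (rule AE_I2) (auto intro!: tendsto_intros hl)
    show "AE x in torus. norm (w x * h n x) \<le> 8 * \<bar>w x\<bar>" for n
      using hb[of n] by (auto simp: abs_mult mult.commute[of 8] intro!: mult_left_mono)
  qed
  moreover have "L2_inner w (h n) = 0" for n by (rule trig_orthogonal[OF w c trh])
  ultimately show ?thesis by (simp add: LIMSEQ_const_iff)
qed

text \<open>
  A function orthogonal to all eigenfunctions integrates to 0 over every box, hence over every Borel set.
\<close>

theorem eigfun_total:
  assumes w: "L2_torus w" and c: "\<And>k. coeff w k = 0"
  shows "AE x in torus. w x = 0"
proof -
  obtain g where g: "g \<in> borel_measurable borel" "AE x in torus. g x = w x"
    using torus_borel_representative[OF L2_torus_measurable[OF w]] by blast
  have gw: "L2_torus g" using L2_torus_cong_AE[OF w g(2)] .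
  have gc: "coeff g k = 0" for k using coeff_cong_AE[OF w g(2)] c by simp
  let ?g = "\<lambda>x. indicator cell x * g x"
  have "integrable torus g"
    using L2_torus_mult[OF gw L2_torus_continuous[of "\<lambda>x. 1"]] by simp
  then have gi: "integrable lborel ?g" using torus_eq_lborel(2)[OF g(1)] by simp
  have "AE x in lborel. ?g x = 0"
  proof (rule AE_zero_if_boxes[OF gi])
    fix l u :: "real^3"
    define l' u' :: "real^3" where "l' = (\<chi> i. max 0 (l $ i))" and "u' = (\<chi> i. min (2*pi) (u $ i))"
    show "(LINT x:box l u|lborel. ?g x) = 0"
    proof (cases "\<forall>i. l' $ i < u' $ i")
      case True
      have "0 = L2_inner g (indicator (box l' u'))"
        by (rule box_integral_0[OF gw gc, symmetric]) (use True in \<open>auto simp: l'_def u'_def\<close>)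
      also have "\<dots> = (\<integral>x. indicator cell x * (g x * indicator (box l' u') x) \<partial>lborel)"
        unfolding L2_inner_def by (rule torus_eq_lborel) (use g(1) in measurable)
      also have "\<dots> = (LINT x:box l u|lborel. ?g x)"
        unfolding set_lebesgue_integral_def
      proof (rule integral_cong_AE)
        from AE_interior_cell
        show "AE x in lborel. indicator cell x * (g x * indicator (box l' u') x) = indicator (box l u) x *\<^sub>R ?g x"
          by eventually_elim (auto simp: indicator_def mem_box_cart l'_def u'_def cell_eq)
      qed (use g(1) in measurable)
      finally show ?thesis by simp
    next
      case False
      then obtain i where i: "u' $ i \<le> l' $ i" by (auto simp: not_less)
      have z: "indicator (box l u) x *\<^sub>R ?g x = 0 \<or> x \<in> cell - box 0 (\<chi> i. 2*pi)" for x
      proof -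
        have "\<not> (x \<in> box l u \<and> x \<in> box 0 (\<chi> i. 2*pi))"
        proof
          assume "x \<in> box l u \<and> x \<in> box 0 (\<chi> i. 2*pi)"
          then have "l $ i < x $ i" "x $ i < u $ i" "0 < x $ i" "x $ i < 2 * pi" by (auto simp: mem_box_cart)
          then show False using i by (auto simp: l'_def u'_def)
        qed
        then show ?thesis by (auto simp: indicator_def)
      qed
      have "AE x in lborel. indicator (box l u) x *\<^sub>R ?g x = 0"
      proof -
        from AE_interior_cell show ?thesis
        proof eventually_elim
          case (elim x)
          then show ?case using z[of x] by (auto simp: indicator_def)
        qed
      qed
      then show ?thesis unfolding set_lebesgue_integral_def by (rule integral_eq_zero_AE)
    qed
  qed
  then have "AE x in torus. g x = 0" unfolding AE_torus_iff by eventually_elim auto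
  with g(2) show ?thesis by eventually_elim simp
qed

section \<open>Riesz--Fischer theorem and Parseval identity\<close>

text \<open>
  The geometric rate is what makes the partial sums along this exhaustion converge almost everywhere.
\<close>

lemma summable_finite_exhaustion:
  fixes a :: "'k \<Rightarrow> real"
  assumes a: "a summable_on UNIV" and nn: "\<And>k. 0 \<le> a k"
  obtains F :: "nat \<Rightarrow> 'k set" where "\<And>n. finite (F n)" "\<And>m n. m \<le> n \<Longrightarrow> F m \<subseteq> F n"
    "\<And>n. infsum a UNIV - (1/4)^n \<le> sum a (F n)"
proof -
  have "\<exists>G. finite G \<and> infsum a UNIV - (1/4)^n \<le> sum a G" for n :: nat
  proof -
    have "(sum a \<longlongrightarrow> infsum a UNIV) (finite_subsets_at_top UNIV)"
      using has_sum_infsum[OF a] by (simp add: has_sum_def)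
    then have "\<forall>\<^sub>F G in finite_subsets_at_top UNIV. infsum a UNIV - (1/4)^n < sum a G"
      by (rule order_tendstoD) simp
    then show ?thesis unfolding eventually_finite_subsets_at_top by force
  qed
  then obtain G where G: "\<And>n. finite (G n)" "\<And>n. infsum a UNIV - (1/4)^n \<le> sum a (G n)" by metis
  show ?thesis
  proof (rule that[of "\<lambda>n. \<Union>i\<le>n. G i"])
    fix n
    have "sum a (G n) \<le> sum a (\<Union>i\<le>n. G i)" by (rule sum_mono2) (use G nn in auto)
    then show "infsum a UNIV - (1/4)^n \<le> sum a (\<Union>i\<le>n. G i)" using G(2)[of n] by linarith
  next
    fix m n :: nat assume "m \<le> n"
    then show "(\<Union>i\<le>m. G i) \<subseteq> (\<Union>i\<le>n. G i)" by (intro UN_mono) auto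
  qed (use G in auto)
qed

lemma L2_inner_le_nn_integral: "f \<in> borel_measurable torus \<Longrightarrow> (\<integral>\<^sup>+x. ennreal ((f x)\<^sup>2) \<partial>torus) \<le> ennreal B \<Longrightarrow> 0 \<le> B \<Longrightarrow> L2_torus f \<and> L2_inner f f \<le> B"
proof -
  assume f: "f \<in> borel_measurable torus" and le: "(\<integral>\<^sup>+x. ennreal ((f x)\<^sup>2) \<partial>torus) \<le> ennreal B" and B: "0 \<le> B"
  have m: "(\<lambda>x. (f x)\<^sup>2) \<in> borel_measurable torus" using f by (rule borel_measurable_power)
  have i: "integrable torus (\<lambda>x. (f x)\<^sup>2)"
    by (rule integrableI_nonneg[OF m]) (use le in \<open>auto simp: le_less_trans ennreal_less_top\<close>)
  have "ennreal (\<integral>x. (f x)\<^sup>2 \<partial>torus) \<le> ennreal B"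
    using nn_integral_eq_integral[OF i] le by simp
  then have "(\<integral>x. (f x)\<^sup>2 \<partial>torus) \<le> B" using B by (simp add: ennreal_le_iff)
  then show ?thesis using f i by (simp add: L2_torus_def L2_inner_def power2_eq_square)
qed

lemma nn_integral_L2: "L2_torus f \<Longrightarrow> (\<integral>\<^sup>+x. ennreal ((f x)\<^sup>2) \<partial>torus) = ennreal (L2_inner f f)"
  by (subst nn_integral_eq_integral) (auto simp: L2_torus_def L2_inner_def power2_eq_square)

text \<open>
  Along an exhaustion with geometrically small tails the increments of the partial sums are summable in
  \<open>L\<^sup>1\<close>, so the partial sums converge almost everywhere; Fatou's lemma identifies the limit in \<open>L\<^sup>2\<close>.
\<close>

theorem riesz_fischer:
  assumes a: "(\<lambda>k. (a k)\<^sup>2) summable_on UNIV"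
  obtains w where "L2_torus w" "\<And>k. coeff w k = a k" "L2_inner w w \<le> (\<Sum>\<^sub>\<infinity>k. (a k)\<^sup>2)"
proof -
  define S where "S = (\<Sum>\<^sub>\<infinity>k. (a k)\<^sup>2)"
  obtain F where F: "\<And>n. finite (F n)" "\<And>m n. m \<le> n \<Longrightarrow> F m \<subseteq> F n" "\<And>n. S - (1/4)^n \<le> (\<Sum>k\<in>F n. (a k)\<^sup>2)"
    unfolding S_def by (rule summable_finite_exhaustion[OF a]) auto
  have le_S: "(\<Sum>k\<in>G. (a k)\<^sup>2) \<le> S" if "finite G" for G
    unfolding S_def by (rule finite_sum_le_infsum[OF a]) (use that in auto)
  define s where "s n = fsum a (F n)" for n
  have sL2: "L2_torus (s n)" for n unfolding s_def by (rule L2_fsum)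
  have sc: "continuous_on cell (s n)" for n unfolding s_def by (rule continuous_fsum)
  have s_diff: "(\<lambda>x. s m x - s n x) = fsum a (F m - F n)" if "n \<le> m" for m n
    unfolding s_def fsum_def by (rule ext, rule sum_diff[symmetric]) (rule F(1), rule F(2)[OF that])
  have s_dist: "L2_inner (\<lambda>x. s m x - s n x) (\<lambda>x. s m x - s n x) \<le> (1/4)^n" if "n \<le> m" for m n
  proof -
    have "L2_inner (\<lambda>x. s m x - s n x) (\<lambda>x. s m x - s n x) = (\<Sum>k\<in>F m - F n. (a k)\<^sup>2)"
      unfolding s_diff[OF that] by (rule norm_fsum) (use F(1) in auto)
    also have "\<dots> = (\<Sum>k\<in>F m. (a k)\<^sup>2) - (\<Sum>k\<in>F n. (a k)\<^sup>2)"
      by (rule sum_diff[OF F(1) F(2)[OF that]])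
    also have "\<dots> \<le> (1/4)^n" using le_S[OF F(1)[of m]] F(3)[of n] by linarith
    finally show ?thesis .
  qed
  let ?d = "\<lambda>n x. \<bar>s (Suc n) x - s n x\<bar>"
  have d_int: "integrable torus (?d n)" for n
    by (intro integrable_torus_continuous continuous_intros sc)
  have d_le: "(\<integral>x. ?d n x \<partial>torus) \<le> (1 + (2*pi)^3) * (1/2)^n" for n
  proof -
    have "(\<integral>x. ?d n x \<partial>torus) \<le> (\<integral>x. 2^n * ((s (Suc n) x - s n x) * (s (Suc n) x - s n x)) + (1/2)^n \<partial>torus)"
    proof (rule integral_mono[OF d_int])
      show "integrable torus (\<lambda>x. 2^n * ((s (Suc n) x - s n x) * (s (Suc n) x - s n x)) + (1/2)^n)"
        by (intro integrable_torus_continuous continuous_intros sc)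
      fix x
      (* trades the L1 norm for the squared L2 norm, of size (1/4)^n *)
      have "\<bar>y\<bar> \<le> 2^n * (y * y) + (1/2)^n" for y :: real
      proof (cases "\<bar>y\<bar> \<le> (1/2)^n")
        case False
        then have "1 \<le> 2^n * \<bar>y\<bar>" by (simp add: field_simps)
        then have "1 * \<bar>y\<bar> \<le> 2^n * \<bar>y\<bar> * \<bar>y\<bar>" by (rule mult_right_mono) simp
        moreover have "2^n * \<bar>y\<bar> * \<bar>y\<bar> = 2^n * (y * y)" by simp
        moreover have "0 \<le> (1/2::real)^n" by simp
        ultimately show ?thesis by linarith
      qed (simp add: add_increasing)
      then show "?d n x \<le> 2^n * ((s (Suc n) x - s n x) * (s (Suc n) x - s n x)) + (1/2)^n" .
    qed
    also have "\<dots> = 2^n * L2_inner (\<lambda>x. s (Suc n) x - s n x) (\<lambda>x. s (Suc n) x - s n x) + (2*pi)^3 * (1/2)^n"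
      unfolding L2_inner_def
      by (subst Bochner_Integration.integral_add)
        (auto intro!: integrable_torus_continuous continuous_intros sc simp: measure_torus)
    also have "\<dots> \<le> 2^n * (1/4)^n + (2*pi)^3 * (1/2)^n"
      using s_dist[of n "Suc n"] by (intro add_mono mult_left_mono) auto
    also have "2^n * (1/4)^n = (1/2::real)^n" by (simp add: power_mult_distrib[symmetric])
    finally show ?thesis by (simp add: distrib_right)
  qed
  have ae_sum: "AE x in torus. summable (\<lambda>n. ?d n x)"
  proof -
    have "(\<integral>\<^sup>+x. (\<Sum>n. ennreal (?d n x)) \<partial>torus) = (\<Sum>n. \<integral>\<^sup>+x. ennreal (?d n x) \<partial>torus)"
      by (rule nn_integral_suminf) (use d_int in auto)
    also have "\<dots> = (\<Sum>n. ennreal (\<integral>x. ?d n x \<partial>torus))"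
      by (simp add: nn_integral_eq_integral d_int)
    also have "\<dots> \<le> (\<Sum>n. ennreal ((1 + (2*pi)^3) * (1/2)^n))"
      by (rule suminf_le[OF ennreal_leI[OF d_le] summableI summableI])
    also have "\<dots> = ennreal (\<Sum>n. (1 + (2*pi)^3) * (1/2)^n)"
      by (rule suminf_ennreal2) (auto intro!: summable_mult summable_geometric add_nonneg_nonneg)
    finally have "(\<integral>\<^sup>+x. (\<Sum>n. ennreal (?d n x)) \<partial>torus) \<noteq> \<infinity>"
      by (auto simp: top_unique)
    then have "AE x in torus. (\<Sum>n. ennreal (?d n x)) \<noteq> \<infinity>"
      by (intro nn_integral_PInf_AE) (use d_int in auto)
    then show ?thesis
      by eventually_elim (auto intro!: summable_suminf_not_top)
  qed
  define w where "w x = lim (\<lambda>n. s n x)" for x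
  have wm: "w \<in> borel_measurable torus" unfolding w_def
    by (rule borel_measurable_lim_metric) (intro continuous_borel_torus sc)
  have lim: "AE x in torus. (\<lambda>n. s n x) \<longlonglongrightarrow> w x"
    using ae_sum
  proof eventually_elim
    case (elim x)
    then have "summable (\<lambda>n. s (Suc n) x - s n x)" by (rule summable_rabs_cancel)
    then have "convergent (\<lambda>n. \<Sum>i<n. s (Suc i) x - s i x)" by (simp add: summable_iff_convergent)
    then have "convergent (\<lambda>n. s n x - s 0 x)" by (simp only: sum_lessThan_telescope[of "\<lambda>n. s n x"])
    then have "convergent (\<lambda>n. (s n x - s 0 x) + s 0 x)" by (intro convergent_add convergent_const)
    then show ?case by (simp add: convergent_LIMSEQ_iff w_def)
  qed
  have fatou: "L2_torus (\<lambda>x. w x - h x) \<and> L2_inner (\<lambda>x. w x - h x) (\<lambda>x. w x - h x) \<le> B"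
    if h: "continuous_on cell h" and B: "0 \<le> B"
      and le: "\<And>m. m \<ge> n \<Longrightarrow> L2_inner (\<lambda>x. s m x - h x) (\<lambda>x. s m x - h x) \<le> B" for h B n
  proof (rule L2_inner_le_nn_integral[OF _ _ B])
    have hm: "h \<in> borel_measurable torus" by (rule continuous_borel_torus[OF h])
    show "(\<lambda>x. w x - h x) \<in> borel_measurable torus" using wm hm by (rule borel_measurable_diff)
    have "(\<integral>\<^sup>+x. ennreal ((w x - h x)\<^sup>2) \<partial>torus) = (\<integral>\<^sup>+x. liminf (\<lambda>m. ennreal ((s (m + n) x - h x)\<^sup>2)) \<partial>torus)"
    proof (rule nn_integral_cong_AE)
      from lim show "AE x in torus. ennreal ((w x - h x)\<^sup>2) = liminf (\<lambda>m. ennreal ((s (m + n) x - h x)\<^sup>2))"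
      proof eventually_elim
        case (elim x)
        then have "(\<lambda>m. s (m + n) x) \<longlonglongrightarrow> w x" by (rule LIMSEQ_ignore_initial_segment)
        then have "(\<lambda>m. ennreal ((s (m + n) x - h x)\<^sup>2)) \<longlonglongrightarrow> ennreal ((w x - h x)\<^sup>2)"
          by (intro tendsto_ennrealI tendsto_intros)
        then show ?case by (rule lim_imp_Liminf[OF trivial_limit_sequentially, symmetric])
      qed
    qed
    also have "\<dots> \<le> liminf (\<lambda>m. \<integral>\<^sup>+x. ennreal ((s (m + n) x - h x)\<^sup>2) \<partial>torus)"
      by (rule nn_integral_liminf) (use continuous_borel_torus[OF sc] hm in measurable)
    also have "\<dots> \<le> ennreal B"
    proof (rule Liminf_le[OF _])
      show "\<forall>\<^sub>F m in sequentially. (\<integral>\<^sup>+x. ennreal ((s (m + n) x - h x)\<^sup>2) \<partial>torus) \<le> ennreal B"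
      proof (rule always_eventually, rule allI)
        fix m
        have "(\<integral>\<^sup>+x. ennreal ((s (m + n) x - h x)\<^sup>2) \<partial>torus) = ennreal (L2_inner (\<lambda>x. s (m + n) x - h x) (\<lambda>x. s (m + n) x - h x))"
          by (rule nn_integral_L2) (intro L2_torus_diff sL2 L2_torus_continuous[OF h])
        also have "\<dots> \<le> ennreal B" using le[of "m + n"] by (intro ennreal_leI) simp
        finally show "(\<integral>\<^sup>+x. ennreal ((s (m + n) x - h x)\<^sup>2) \<partial>torus) \<le> ennreal B" .
      qed
    qed simp
    finally show "(\<integral>\<^sup>+x. ennreal ((w x - h x)\<^sup>2) \<partial>torus) \<le> ennreal B" .
  qed
  have w: "L2_torus w" "L2_inner w w \<le> S"
    using fatou[of "\<lambda>x. 0" S 0] le_S[of "{}"] le_S[OF F(1)]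
    by (auto simp: s_def norm_fsum[OF F(1)])
  have w_dist: "L2_inner (\<lambda>x. w x - s n x) (\<lambda>x. w x - s n x) \<le> (1/4)^n" for n
    using fatou[OF sc, of "(1/4)^n" n n] s_dist[of n] by simp
  have "coeff w k = a k" for k
  proof -
    have "\<bar>coeff w k - a k\<bar> \<le> 2 * (1/2)^n" for n
    proof -
      have sq: "\<bar>y\<bar> \<le> (1/2)^n" if "y\<^sup>2 \<le> (1/4)^n" for y :: real
      proof -
        have "(1/4::real)^n = ((1/2)^n)\<^sup>2" by (simp add: power2_eq_square power_mult_distrib[symmetric])
        then show ?thesis using that by (simp add: abs_le_square_iff[symmetric])
      qed
      have "\<bar>coeff w k - coeff (s n) k\<bar> \<le> (1/2)^n"
      proof (rule sq)
        show "(coeff w k - coeff (s n) k)\<^sup>2 \<le> (1/4)^n"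
        using bessel_single[OF L2_torus_diff[OF w(1) sL2[of n]], of k] w_dist[of n]
          by (simp add: coeff_diff[OF w(1) sL2])
      qed
      moreover have "\<bar>coeff (s n) k - a k\<bar> \<le> (1/2)^n"
      proof (rule sq, cases "k \<in> F n")
        case False
        have "(a k)\<^sup>2 + (\<Sum>k\<in>F n. (a k)\<^sup>2) \<le> S"
          using le_S[of "insert k (F n)"] F(1)[of n] False by simp
        then show "(coeff (s n) k - a k)\<^sup>2 \<le> (1/4)^n" using F(3)[of n] False F(1)[of n] by (simp add: s_def coeff_fsum)
      qed (simp add: s_def coeff_fsum F(1))
      ultimately show ?thesis by linarith
    qed
    moreover have "(\<lambda>n. 2 * (1/2::real)^n) \<longlonglongrightarrow> 0"
      using tendsto_mult[OF tendsto_const[of 2] LIMSEQ_power_zero[of "1/2::real"]] by simp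
    ultimately have "\<bar>coeff w k - a k\<bar> \<le> 0"
      using LIMSEQ_le_const by blast
    then show ?thesis by simp
  qed
  then show ?thesis using that w unfolding S_def by blast
qed

text \<open>
  The Riesz--Fischer function with the coefficients of \<open>w\<close> agrees with \<open>w\<close> by completeness, and its norm
  does not exceed the sum of the squared coefficients.
\<close>

theorem parseval:
  assumes w: "L2_torus w"
  shows "((\<lambda>k. (coeff w k)\<^sup>2) has_sum L2_inner w w) UNIV"
proof -
  note sm = coeff_sq_summable[OF w]
  obtain w' where w': "L2_torus w'" "\<And>k. coeff w' k = coeff w k" "L2_inner w' w' \<le> (\<Sum>\<^sub>\<infinity>k. (coeff w k)\<^sup>2)"
    using riesz_fischer[OF sm] by blast
  have "AE x in torus. w x - w' x = 0"
    by (rule eigfun_total) (use w w' in \<open>auto intro: L2_torus_diff simp: coeff_diff\<close>)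
  then have "AE x in torus. w x = w' x" by eventually_elim simp
  then have "L2_inner w w = L2_inner w' w'"
    by (intro L2_inner_cong_AE w')
  moreover have "(\<Sum>\<^sub>\<infinity>k. (coeff w k)\<^sup>2) \<le> L2_inner w w"
    by (rule infsum_le_finite_sums[OF sm]) (use bessel[OF w] in auto)
  ultimately have "(\<Sum>\<^sub>\<infinity>k. (coeff w k)\<^sup>2) = L2_inner w w" using w'(3) by linarith
  then show ?thesis using has_sum_infsum[OF sm] by simp
qed

corollary parseval_inner:
  assumes u: "L2_torus u" and w: "L2_torus w"
  shows "((\<lambda>k. coeff u k * coeff w k) has_sum L2_inner u w) UNIV"
proof -
  have uw: "L2_torus (\<lambda>x. u x + w x)" by (rule L2_torus_add[OF u w])
  have "((\<lambda>k. ((coeff (\<lambda>x. u x + w x) k)\<^sup>2 + - (coeff u k)\<^sup>2) + - (coeff w k)\<^sup>2) has_sum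
     (L2_inner (\<lambda>x. u x + w x) (\<lambda>x. u x + w x) + - L2_inner u u) + - L2_inner w w) UNIV"
    by (intro has_sum_add has_sum_uminusI parseval u w uw)
  then have "((\<lambda>k. (1/2) * (((coeff (\<lambda>x. u x + w x) k)\<^sup>2 + - (coeff u k)\<^sup>2) + - (coeff w k)\<^sup>2)) has_sum
     (1/2) * ((L2_inner (\<lambda>x. u x + w x) (\<lambda>x. u x + w x) + - L2_inner u u) + - L2_inner w w)) UNIV"
    by (rule has_sum_cmult_right)
  moreover have "(1/2) * (((coeff (\<lambda>x. u x + w x) k)\<^sup>2 + - (coeff u k)\<^sup>2) + - (coeff w k)\<^sup>2) = coeff u k * coeff w k" for k
    by (simp add: coeff_add[OF u w] power2_sum)
  moreover have "(1/2) * ((L2_inner (\<lambda>x. u x + w x) (\<lambda>x. u x + w x) + - L2_inner u u) + - L2_inner w w) = L2_inner u w"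
  proof -
    let ?s = "\<lambda>x. u x + w x"
    have "L2_inner ?s ?s = L2_inner u ?s + L2_inner w ?s" by (rule L2_inner_add_left[OF u w uw])
    moreover have "L2_inner u ?s = L2_inner u u + L2_inner u w"
      using L2_inner_add_left[OF u w u] by (simp only: L2_inner_commute[of u ?s] L2_inner_commute[of w u])
    moreover have "L2_inner w ?s = L2_inner u w + L2_inner w w"
      using L2_inner_add_left[OF u w w] by (simp only: L2_inner_commute[of w ?s])
    ultimately show ?thesis by (simp only:) simp
  qed
  ultimately show ?thesis by simp
qed

section \<open>The Sobolev embedding of H1 into L6\<close>

lemma card_vec3: "card {k :: int^3. \<forall>i. k $ i \<in> A i} = (\<Prod>i\<in>UNIV. card (A i))"
proof -
  have "bij_betw (\<lambda>k i. k $ i) {k :: int^3. \<forall>i. k $ i \<in> A i} (PiE UNIV A)"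
    by (rule bij_betwI[where g="\<lambda>f. \<chi> i. f i"]) (auto simp: PiE_def)
  then have "card {k :: int^3. \<forall>i. k $ i \<in> A i} = card (PiE UNIV A)" by (rule bij_betw_same_card)
  then show ?thesis by (simp add: card_PiE)
qed

lemma finite_vec3: "(\<And>i. finite (A i)) \<Longrightarrow> finite {k :: int^3. \<forall>i. k $ i \<in> A i}"
proof -
  assume f: "\<And>i. finite (A i)"
  have "bij_betw (\<lambda>f. \<chi> i. f i) (PiE UNIV A) {k :: int^3. \<forall>i. k $ i \<in> A i}"
    by (rule bij_betwI[where g="\<lambda>k i. k $ i"]) (auto simp: PiE_def)
  then show ?thesis using finite_PiE[of UNIV A] f by (simp add: bij_betw_finite)
qed

definition height :: "int^3 \<Rightarrow> nat" where
  "height k = Max (range (\<lambda>i. nat \<bar>k $ i\<bar>))"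

lemma height_less_iff: "height k < n \<longleftrightarrow> (\<forall>i. nat \<bar>k $ i\<bar> < n)"
  unfolding height_def by (subst Max_less_iff) auto

lemma abs_le_height: "nat \<bar>k $ i\<bar> \<le> height k"
  unfolding height_def by (rule Max_ge) auto

lemma height_attained: obtains i where "height k = nat \<bar>k $ i\<bar>"
proof -
  have "height k \<in> range (\<lambda>i. nat \<bar>k $ i\<bar>)" unfolding height_def by (rule Max_in) auto
  then show ?thesis using that by auto
qed

lemma height_sq_le_eigval: "(real (height k))\<^sup>2 \<le> eigval k"
proof -
  obtain i where "height k = nat \<bar>k $ i\<bar>" by (rule height_attained)
  then have "(real (height k))\<^sup>2 = (of_int (k $ i))\<^sup>2" by simp
  also have "\<dots> \<le> eigval k" unfolding eigval_eq by (rule member_le_sum) auto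
  finally show ?thesis .
qed

definition low :: "nat \<Rightarrow> (int^3) set" where "low n = {k. height k < n}"

lemma low_0 [simp]: "low 0 = {}" by (simp add: low_def)

lemma low_Suc_eq: "low (Suc n) = {k. \<forall>i. k $ i \<in> {- int n..int n}}"
proof -
  have "nat \<bar>a\<bar> < Suc n \<longleftrightarrow> a \<in> {- int n..int n}" for a :: int by auto
  then show ?thesis unfolding low_def height_less_iff by simp
qed

lemma finite_low [simp]: "finite (low n)"
proof (cases n)
  case (Suc m)
  show ?thesis unfolding Suc low_Suc_eq by (rule finite_vec3) simp
qed simp

lemma card_low_Suc: "card (low (Suc n)) = (2 * n + 1)^3"
  unfolding low_Suc_eq by (subst card_vec3) (simp add: nat_add_distrib nat_mult_distrib power3_eq_cube)

text \<open>
  The shell of height \<open>n\<close> contains at most \<open>26 (1 + n\<^sup>2)\<close> frequencies, each contributing at most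
  \<open>1 / (1 + n\<^sup>2)\<close>.
\<close>

lemma sum_low: "(\<Sum>k\<in>low n. 1 / (1 + eigval k)) \<le> 26 * real n"
proof (induction n)
  case (Suc n)
  have sub: "low n \<subseteq> low (Suc n)" by (auto simp: low_def)
  have "(\<Sum>k\<in>low (Suc n) - low n. 1 / (1 + eigval k)) \<le> (\<Sum>k\<in>low (Suc n) - low n. 1 / (1 + (real n)\<^sup>2))"
  proof (rule sum_mono)
    fix k assume "k \<in> low (Suc n) - low n"
    then have "height k = n" by (auto simp: low_def)
    then have "(real n)\<^sup>2 \<le> eigval k" using height_sq_le_eigval[of k] by simp
    then show "1 / (1 + eigval k) \<le> 1 / (1 + (real n)\<^sup>2)"
      by (intro divide_left_mono mult_pos_pos add_pos_nonneg) auto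
  qed
  also have "\<dots> = real (card (low (Suc n) - low n)) / (1 + (real n)\<^sup>2)" by simp
  also have "\<dots> \<le> 26"
  proof -
    have c: "real (card (low (Suc n) - low n)) = real (card (low (Suc n))) - real (card (low n))"
      using card_mono[OF finite_low sub] by (simp add: card_Diff_subset sub of_nat_diff)
    have "real (card (low (Suc n) - low n)) \<le> 26 * (1 + (real n)\<^sup>2)"
    proof (cases n)
      case 0
      then show ?thesis unfolding c by (simp add: card_low_Suc)
    next
      case (Suc m)
      show ?thesis unfolding c unfolding Suc card_low_Suc
        by (simp add: power2_eq_square power3_eq_cube algebra_simps)
    qed
    then show ?thesis by (simp add: field_simps add_pos_nonneg)
  qed
  finally have "(\<Sum>k\<in>low (Suc n) - low n. 1 / (1 + eigval k)) \<le> 26" .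
  then show ?case using Suc sum.subset_diff[OF sub finite_low, of "\<lambda>k. 1 / (1 + eigval k)"] by simp
qed simp

abbreviation h1_sum :: "(int^3 \<Rightarrow> real) \<Rightarrow> real" where
  "h1_sum a \<equiv> (\<Sum>\<^sub>\<infinity>k. (1 + eigval k) * (a k)\<^sup>2)"

lemma two_pi_cube: "(2*pi)^3 \<ge> 216"
proof -
  have "(6::real)^3 \<le> (2*pi)^3" by (rule power_mono) (use pi_gt3 in auto)
  then show ?thesis by simp
qed

text \<open>
  The Cauchy--Schwarz inequality with the weights \<open>1 + |k|\<^sup>2\<close>: the low frequencies of an \<open>H\<^sup>1\<close> function
  are bounded, at a rate that is exactly the scaling of \<open>L\<^sup>6\<close>. The constant 26 of the lattice sum is
  absorbed by the normalization of the eigenfunctions.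
\<close>

lemma fsum_low_bound:
  assumes s: "(\<lambda>k. (1 + eigval k) * (a k)\<^sup>2) summable_on UNIV" and H: "h1_sum a \<le> H"
  shows "(fsum a (low n) x)\<^sup>2 \<le> real n * H"
proof -
  let ?r = "\<lambda>k. sqrt (1 + eigval k)"
  have r: "?r k > 0" for k using eigval_nonneg[of k] by (simp add: add_pos_nonneg)
  have "(fsum a (low n) x)\<^sup>2 = (\<Sum>k\<in>low n. (?r k * a k) * (eigfun k x / ?r k))\<^sup>2"
  proof -
    have "a k * eigfun k x = (?r k * a k) * (eigfun k x / ?r k)" for k using r[of k] by simp
    then show ?thesis unfolding fsum_def by presburger
  qed
  also have "\<dots> \<le> (\<Sum>k\<in>low n. (?r k * a k)\<^sup>2) * (\<Sum>k\<in>low n. (eigfun k x / ?r k)\<^sup>2)"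
    by (rule Cauchy_Schwarz_ineq_sum)
  also have "\<dots> \<le> H * (26 * real n / 26)"
  proof (rule mult_mono)
    have "(\<Sum>k\<in>low n. (?r k * a k)\<^sup>2) = (\<Sum>k\<in>low n. (1 + eigval k) * (a k)\<^sup>2)"
      by (simp add: power_mult_distrib)
    also have "\<dots> \<le> h1_sum a" by (rule finite_sum_le_infsum[OF s]) auto
    finally show "(\<Sum>k\<in>low n. (?r k * a k)\<^sup>2) \<le> H" using H by simp
    have "(\<Sum>k\<in>low n. (eigfun k x / ?r k)\<^sup>2) \<le> (\<Sum>k\<in>low n. (1/26) * (1 / (1 + eigval k)))"
    proof (rule sum_mono)
      fix k
      have "(eigfun k x)\<^sup>2 \<le> 2 / (2*pi)^3"
        using power_mono[OF eigfun_bound[of k x], of 2] by simp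
      also have "\<dots> \<le> 2 / 216" using two_pi_cube by (intro divide_left_mono) auto
      finally have "(eigfun k x)\<^sup>2 \<le> 1/26" by simp
      then have "(eigfun k x)\<^sup>2 / (1 + eigval k) \<le> (1/26) / (1 + eigval k)"
        by (rule divide_right_mono) simp
      then show "(eigfun k x / ?r k)\<^sup>2 \<le> (1/26) * (1 / (1 + eigval k))" by (simp add: power_divide)
    qed
    also have "\<dots> \<le> (1/26) * (26 * real n)"
      unfolding sum_distrib_left[symmetric] using sum_low[of n] by simp
    finally show "(\<Sum>k\<in>low n. (eigfun k x / ?r k)\<^sup>2) \<le> 26 * real n / 26" by simp
    have "0 \<le> h1_sum a" by (rule infsum_nonneg) simp
    then show "0 \<le> H" using H by simp
  qed (auto intro: sum_nonneg)
  finally show ?thesis by (simp add: mult.commute)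
qed

text \<open>
  A discrete layer-cake formula for the third power, to be applied with \<open>z\<close> proportional to \<open>w\<^sup>2\<close>.
\<close>

lemma cube_le_level_sum:
  fixes z :: real assumes "0 \<le> z"
  shows "z^3 \<le> 1 + (\<Sum>n\<in>{1..nat \<lfloor>z\<rfloor>}. 3 * (real n + 1)\<^sup>2)"
proof -
  have "(real m + 1)^3 \<le> 1 + (\<Sum>n\<in>{1..m}. 3 * (real n + 1)\<^sup>2)" for m
  proof (induction m)
    case (Suc m)
    have "(real (Suc m) + 1)^3 \<le> (real m + 1)^3 + 3 * (real (Suc m) + 1)\<^sup>2"
      by (simp add: power2_eq_square power3_eq_cube algebra_simps)
    then show ?case using Suc by simp
  qed simp
  moreover have "z^3 \<le> (real (nat \<lfloor>z\<rfloor>) + 1)^3"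
    by (rule power_mono) (use assms in linarith)+
  ultimately show ?thesis by (rule order_trans[rotated])
qed

lemma parseval_high:
  assumes w: "L2_torus w" and F: "finite F"
  shows "((\<lambda>k. if k \<in> F then 0 else (coeff w k)\<^sup>2) has_sum
     L2_inner (\<lambda>x. w x - fsum (coeff w) F x) (\<lambda>x. w x - fsum (coeff w) F x)) UNIV"
proof -
  have "((\<lambda>k. (coeff (\<lambda>x. w x - fsum (coeff w) F x) k)\<^sup>2) has_sum
     L2_inner (\<lambda>x. w x - fsum (coeff w) F x) (\<lambda>x. w x - fsum (coeff w) F x)) UNIV"
    by (intro parseval L2_torus_diff w L2_fsum)
  moreover have "(coeff (\<lambda>x. w x - fsum (coeff w) F x) k)\<^sup>2 = (if k \<in> F then 0 else (coeff w k)\<^sup>2)" for k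
    by (simp add: coeff_diff[OF w L2_fsum] coeff_fsum[OF F])
  ultimately show ?thesis by simp
qed

definition sobolev_const :: real where "sobolev_const = 64 * (2*pi)^3 + 768"

lemma sobolev_const_pos: "0 < sobolev_const"
  unfolding sobolev_const_def by (intro add_nonneg_pos) auto

text \<open>
  Real-variable proof after Chemin and Xu. Where \<open>w\<^sup>2 \<ge> 4 H n\<close>, the frequencies of height below \<open>n\<close> account
  for at most half of \<open>w\<close>, so the remaining high-frequency part \<open>S n\<close> satisfies \<open>n H \<le> (S n)\<^sup>2\<close>. Inserting
  this in the layer-cake formula bounds \<open>w\<^sup>6\<close> by \<open>H\<^sup>2 \<Sum> n (S n)\<^sup>2\<close> up to constants, and by Parseval the
  integral of this sum is at most \<open>H\<^sup>2 \<Sum> |k|\<^sup>2 w\<^sub>k\<^sup>2\<close>.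
\<close>

theorem sobolev_L6:
  assumes w: "L2_torus w" and s: "(\<lambda>k. (1 + eigval k) * (coeff w k)\<^sup>2) summable_on UNIV"
    and H: "h1_sum (coeff w) \<le> H" "0 < H"
  shows "integrable torus (\<lambda>x. (w x)^6)" "(\<integral>x. (w x)^6 \<partial>torus) \<le> sobolev_const * H^3"
proof -
  define S where "S n x = w x - fsum (coeff w) (low n) x" for n x
  define R where "R n = L2_inner (S n) (S n)" for n
  have SL2: "L2_torus (S n)" for n unfolding S_def by (intro L2_torus_diff w L2_fsum)
  have Sm: "S n \<in> borel_measurable torus" for n using SL2 by (rule L2_torus_measurable)
  have R0: "0 \<le> R n" for n unfolding R_def by (rule L2_inner_nonneg)
  have level: "real n * H \<le> (S n x)\<^sup>2" if "4 * H * real n \<le> (w x)\<^sup>2" for n x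
  proof -
    let ?f = "fsum (coeff w) (low n) x"
    have "?f\<^sup>2 \<le> real n * H" by (rule fsum_low_bound[OF s H(1)])
    then have "(2 * ?f)\<^sup>2 \<le> (w x)\<^sup>2" using that by (simp add: power_mult_distrib mult_ac)
    then have "\<bar>2 * ?f\<bar> \<le> \<bar>w x\<bar>" by (simp only: abs_le_square_iff)
    then have "\<bar>w x\<bar> \<le> \<bar>2 * S n x\<bar>" unfolding S_def by (auto simp: abs_if split: if_splits)
    then have "(w x)\<^sup>2 \<le> (2 * S n x)\<^sup>2" by (simp only: abs_le_square_iff)
    then show ?thesis using that by (simp add: power_mult_distrib mult_ac)
  qed
  have pw: "(w x)^6 \<le> 64 * H^3 + (\<Sum>n\<in>{1..nat \<lfloor>(w x)\<^sup>2 / (4 * H)\<rfloor>}. 768 * H\<^sup>2 * (real n * (S n x)\<^sup>2))" for x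
  proof -
    define z where "z = (w x)\<^sup>2 / (4 * H)"
    have z0: "0 \<le> z" using H by (simp add: z_def)
    have w2: "(w x)\<^sup>2 = 4 * H * z" using H by (simp add: z_def)
    have "(w x)^6 = ((w x)\<^sup>2)^3" by simp
    also have "\<dots> = 64 * H^3 * z^3" unfolding w2 by (simp add: power_mult_distrib)
    also have "\<dots> \<le> 64 * H^3 * (1 + (\<Sum>n\<in>{1..nat \<lfloor>z\<rfloor>}. 3 * (real n + 1)\<^sup>2))"
      by (rule mult_left_mono[OF cube_le_level_sum[OF z0]]) (use H in simp)
    also have "\<dots> = 64 * H^3 + (\<Sum>n\<in>{1..nat \<lfloor>z\<rfloor>}. 64 * H^3 * (3 * (real n + 1)\<^sup>2))"
      by (simp add: distrib_left sum_distrib_left)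
    also have "\<dots> \<le> 64 * H^3 + (\<Sum>n\<in>{1..nat \<lfloor>z\<rfloor>}. 768 * H\<^sup>2 * (real n * (S n x)\<^sup>2))"
    proof (intro add_left_mono sum_mono)
      fix n assume n: "n \<in> {1..nat \<lfloor>z\<rfloor>}"
      then have n1: "1 \<le> real n" by simp
      have "real n \<le> z" using n z0 by (simp add: le_nat_floor) linarith
      then have "4 * H * real n \<le> (w x)\<^sup>2" unfolding w2 using H by simp
      then have lev: "real n * H \<le> (S n x)\<^sup>2" by (rule level)
      have "(real n + 1)\<^sup>2 \<le> (2 * real n)\<^sup>2" by (rule power_mono) (use n1 in auto)
      then have "64 * H^3 * (3 * (real n + 1)\<^sup>2) \<le> 64 * H^3 * (3 * (2 * real n)\<^sup>2)"
        using H by (intro mult_left_mono) auto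
      also have "\<dots> = 768 * H\<^sup>2 * (real n * (real n * H))"
        by (simp add: power2_eq_square power3_eq_cube)
      also have "\<dots> \<le> 768 * H\<^sup>2 * (real n * (S n x)\<^sup>2)"
        using lev by (intro mult_left_mono) auto
      finally show "64 * H^3 * (3 * (real n + 1)\<^sup>2) \<le> 768 * H\<^sup>2 * (real n * (S n x)\<^sup>2)" .
    qed
    finally show ?thesis by (simp add: z_def)
  qed
  have pw': "ennreal ((w x)^6) \<le> ennreal (64 * H^3) + (\<Sum>n. ennreal (768 * H\<^sup>2 * real n) * ennreal ((S n x)\<^sup>2))" for x
  proof -
    let ?A = "{1..nat \<lfloor>(w x)\<^sup>2 / (4 * H)\<rfloor>}"
    have "ennreal ((w x)^6) \<le> ennreal (64 * H^3 + (\<Sum>n\<in>?A. 768 * H\<^sup>2 * (real n * (S n x)\<^sup>2)))"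
      by (rule ennreal_leI[OF pw])
    also have "\<dots> = ennreal (64 * H^3) + (\<Sum>n\<in>?A. ennreal (768 * H\<^sup>2 * (real n * (S n x)\<^sup>2)))"
      using H by (subst ennreal_plus) (auto intro: sum_nonneg simp: sum_ennreal)
    also have "(\<Sum>n\<in>?A. ennreal (768 * H\<^sup>2 * (real n * (S n x)\<^sup>2))) = (\<Sum>n\<in>?A. ennreal (768 * H\<^sup>2 * real n) * ennreal ((S n x)\<^sup>2))"
      by (simp add: ennreal_mult[symmetric] mult.assoc)
    also have "\<dots> \<le> (\<Sum>n. ennreal (768 * H\<^sup>2 * real n) * ennreal ((S n x)\<^sup>2))"
      by (rule sum_le_suminf) auto
    finally show ?thesis by (simp add: add_left_mono)
  qed
  have Rhas: "((\<lambda>k. \<Sum>n<N. real n * (if k \<in> low n then 0 else (coeff w k)\<^sup>2)) has_sum (\<Sum>n<N. real n * R n)) UNIV" for N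
  proof (induction N)
    case (Suc N)
    have "((\<lambda>k. real N * (if k \<in> low N then 0 else (coeff w k)\<^sup>2)) has_sum real N * R N) UNIV"
      unfolding R_def S_def by (intro has_sum_cmult_right parseval_high w) simp
    from has_sum_add[OF Suc this] show ?case by simp
  qed simp
  have Rsum: "(\<Sum>n<N. real n * R n) \<le> H" for N
  proof -
    have "(\<Sum>n<N. real n * R n) \<le> h1_sum (coeff w)"
    proof (rule has_sum_mono[OF Rhas has_sum_infsum[OF s]])
      fix k
      have "(\<Sum>n<N. real n * (if k \<in> low n then 0 else (coeff w k)\<^sup>2)) = (\<Sum>n\<in>{..<N} \<inter> {1..height k}. real n * (coeff w k)\<^sup>2)"
        by (rule sum.mono_neutral_cong_right) (auto simp: low_def)
      also have "\<dots> \<le> (\<Sum>n\<in>{1..height k}. real n * (coeff w k)\<^sup>2)"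
        by (rule sum_mono2) auto
      also have "\<dots> \<le> (\<Sum>n\<in>{1..height k}. real (height k) * (coeff w k)\<^sup>2)"
        by (intro sum_mono mult_right_mono) auto
      also have "\<dots> = (real (height k))\<^sup>2 * (coeff w k)\<^sup>2" by (simp add: power2_eq_square)
      also have "\<dots> \<le> (1 + eigval k) * (coeff w k)\<^sup>2"
        using height_sq_le_eigval[of k] by (intro mult_right_mono) auto
      finally show "(\<Sum>n<N. real n * (if k \<in> low n then 0 else (coeff w k)\<^sup>2)) \<le> (1 + eigval k) * (coeff w k)\<^sup>2" .
    qed
    then show ?thesis using H by linarith
  qed
  have "(\<integral>\<^sup>+x. ennreal ((w x)^6) \<partial>torus) \<le> (\<integral>\<^sup>+x. ennreal (64 * H^3) + (\<Sum>n. ennreal (768 * H\<^sup>2 * real n) * ennreal ((S n x)\<^sup>2)) \<partial>torus)"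
    by (rule nn_integral_mono) (rule pw')
  also have "\<dots> = (\<integral>\<^sup>+x. ennreal (64 * H^3) \<partial>torus) + (\<integral>\<^sup>+x. (\<Sum>n. ennreal (768 * H\<^sup>2 * real n) * ennreal ((S n x)\<^sup>2)) \<partial>torus)"
    by (rule nn_integral_add) (use Sm in measurable)
  also have "(\<integral>\<^sup>+x. (\<Sum>n. ennreal (768 * H\<^sup>2 * real n) * ennreal ((S n x)\<^sup>2)) \<partial>torus) = (\<Sum>n. ennreal (768 * H\<^sup>2 * real n) * ennreal (R n))"
  proof -
    have "(\<integral>\<^sup>+x. (\<Sum>n. ennreal (768 * H\<^sup>2 * real n) * ennreal ((S n x)\<^sup>2)) \<partial>torus) = (\<Sum>n. \<integral>\<^sup>+x. ennreal (768 * H\<^sup>2 * real n) * ennreal ((S n x)\<^sup>2) \<partial>torus)"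
      by (rule nn_integral_suminf) (use Sm in measurable)
    moreover have "(\<integral>\<^sup>+x. ennreal (768 * H\<^sup>2 * real n) * ennreal ((S n x)\<^sup>2) \<partial>torus) = ennreal (768 * H\<^sup>2 * real n) * ennreal (R n)" for n
    proof -
      have "(\<integral>\<^sup>+x. ennreal (768 * H\<^sup>2 * real n) * ennreal ((S n x)\<^sup>2) \<partial>torus) = ennreal (768 * H\<^sup>2 * real n) * (\<integral>\<^sup>+x. ennreal ((S n x)\<^sup>2) \<partial>torus)"
        by (rule nn_integral_cmult) (use Sm in measurable)
      then show ?thesis by (simp add: nn_integral_L2[OF SL2] R_def)
    qed
    ultimately show ?thesis by simp
  qed
  also have "(\<Sum>n. ennreal (768 * H\<^sup>2 * real n) * ennreal (R n)) \<le> ennreal (768 * H^3)"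
    unfolding suminf_eq_SUP
  proof (rule SUP_least)
    fix N
    have "(\<Sum>n<N. ennreal (768 * H\<^sup>2 * real n) * ennreal (R n)) = (\<Sum>n<N. ennreal (768 * H\<^sup>2 * (real n * R n)))"
      by (simp add: ennreal_mult[symmetric] R0 mult.assoc)
    also have "\<dots> = ennreal (\<Sum>n<N. 768 * H\<^sup>2 * (real n * R n))"
      by (rule sum_ennreal) (simp add: R0)
    also have "\<dots> \<le> ennreal (768 * H\<^sup>2 * H)"
      unfolding sum_distrib_left[symmetric] using Rsum[of N] by (intro ennreal_leI mult_left_mono) auto
    finally show "(\<Sum>n<N. ennreal (768 * H\<^sup>2 * real n) * ennreal (R n)) \<le> ennreal (768 * H^3)"
      by (simp add: power2_eq_square power3_eq_cube mult.assoc)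
  qed
  also have "(\<integral>\<^sup>+x. ennreal (64 * H^3) \<partial>torus) = ennreal (64 * H^3 * (2*pi)^3)"
    using H by (simp add: emeasure_restrict_space emeasure_cell ennreal_mult[symmetric])
  also have "ennreal (64 * H^3 * (2*pi)^3) + ennreal (768 * H^3) = ennreal (sobolev_const * H^3)"
    using H by (subst ennreal_plus[symmetric]) (auto simp: sobolev_const_def algebra_simps)
  finally have le: "(\<integral>\<^sup>+x. ennreal ((w x)^6) \<partial>torus) \<le> ennreal (sobolev_const * H^3)"
    by (simp add: add_left_mono add_mono)
  have m: "(\<lambda>x. (w x)^6) \<in> borel_measurable torus"
    using L2_torus_measurable[OF w] by (rule borel_measurable_power)
  show i: "integrable torus (\<lambda>x. (w x)^6)"
    by (rule integrableI_nonneg[OF m]) (use le in \<open>auto simp: le_less_trans ennreal_less_top\<close>)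
  have "ennreal (\<integral>x. (w x)^6 \<partial>torus) \<le> ennreal (sobolev_const * H^3)"
    using nn_integral_eq_integral[OF i] le by simp
  then show "(\<integral>x. (w x)^6 \<partial>torus) \<le> sobolev_const * H^3"
    using H sobolev_const_pos by (simp add: ennreal_le_iff)
qed

section \<open>Fejer kernels and monotone nonlinearities\<close>

definition grid :: "nat \<Rightarrow> (int^3) set" where
  "grid N = {l. \<forall>i. l $ i \<in> {0..<int N}}"

lemma finite_grid [simp]: "finite (grid N)"
  unfolding grid_def by (rule finite_vec3) simp

lemma card_grid: "card (grid N) = N^3"
  unfolding grid_def by (subst card_vec3) (simp add: power3_eq_cube)

text \<open>
  The normalized number of ways to write \<open>k\<close> as a difference of two points of the grid, which is the
  Fourier multiplier of the product Fejer kernel.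
\<close>

definition fejer_mult :: "nat \<Rightarrow> int^3 \<Rightarrow> real" where
  "fejer_mult N k = real (card {l \<in> grid N. l + k \<in> grid N}) / real (N^3)"

definition fejer_kernel :: "nat \<Rightarrow> real^3 \<Rightarrow> real^3 \<Rightarrow> real" where
  "fejer_kernel N x y = (\<Sum>k\<in>low N. fejer_mult N k * (eigfun k x * eigfun k y))"

lemma grid_diff_low: "j \<in> grid N \<Longrightarrow> l \<in> grid N \<Longrightarrow> j - l \<in> low N"
proof -
  assume jl: "j \<in> grid N" "l \<in> grid N"
  have "nat \<bar>(j - l) $ i\<bar> < N" for i
  proof -
    have "0 \<le> j $ i" "j $ i < int N" "0 \<le> l $ i" "l $ i < int N" using jl by (auto simp: grid_def)
    then show ?thesis by simp
  qed
  then show ?thesis by (simp add: low_def height_less_iff)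
qed

lemma sum_grid_diff:
  "(\<Sum>j\<in>grid N. \<Sum>l\<in>grid N. c (j - l)) = (\<Sum>k\<in>low N. real (card {l \<in> grid N. l + k \<in> grid N}) * c k)" for c :: "int^3 \<Rightarrow> real"
proof -
  have "(\<Sum>j\<in>grid N. \<Sum>l\<in>grid N. c (j - l)) = (\<Sum>(j, l)\<in>grid N \<times> grid N. c (j - l))"
    by (rule sum.cartesian_product)
  also have "\<dots> = (\<Sum>k\<in>low N. \<Sum>z\<in>{z \<in> grid N \<times> grid N. fst z - snd z = k}. c (fst z - snd z))"
    unfolding case_prod_unfold by (rule sum.group[symmetric]) (auto intro: grid_diff_low)
  also have "\<dots> = (\<Sum>k\<in>low N. real (card {l \<in> grid N. l + k \<in> grid N}) * c k)"
  proof (rule sum.cong[OF refl])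
    fix k
    have "bij_betw (\<lambda>l. (l + k, l)) {l \<in> grid N. l + k \<in> grid N} {z \<in> grid N \<times> grid N. fst z - snd z = k}"
      by (rule bij_betwI[where g=snd]) auto
    then have "card {z \<in> grid N \<times> grid N. fst z - snd z = k} = card {l \<in> grid N. l + k \<in> grid N}"
      by (simp add: bij_betw_same_card)
    then show "(\<Sum>z\<in>{z \<in> grid N \<times> grid N. fst z - snd z = k}. c (fst z - snd z)) = real (card {l \<in> grid N. l + k \<in> grid N}) * c k"
      by simp
  qed
  finally show ?thesis .
qed

text \<open>
  The kernel is a positive multiple of \<open>|\<Sum> exp (i j \<bullet> (x - y))|\<^sup>2\<close>, the sum running over the grid.
\<close>

lemma fejer_kernel_nonneg: "0 \<le> fejer_kernel N x y"
proof -
  let ?a = "\<lambda>j. wave_vector j \<bullet> (x - y)"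
  let ?e = "\<lambda>k. eigfun k x * eigfun k y"
  have sym: "(\<Sum>j\<in>grid N. \<Sum>l\<in>grid N. ?e (- (j - l))) = (\<Sum>j\<in>grid N. \<Sum>l\<in>grid N. ?e (j - l))"
    by (subst sum.swap) simp
  have "0 \<le> (\<Sum>j\<in>grid N. cos (?a j))\<^sup>2 + (\<Sum>j\<in>grid N. sin (?a j))\<^sup>2" by simp
  also have "\<dots> = (\<Sum>j\<in>grid N. \<Sum>l\<in>grid N. cos (?a (j - l)))"
    by (simp add: wave_vector_diff inner_diff_left cos_diff power2_eq_square sum_product sum.distrib)
  also have "\<dots> = (\<Sum>j\<in>grid N. \<Sum>l\<in>grid N. (2*pi)^3 / 2 * (?e (j - l) + ?e (- (j - l))))"
  proof (intro sum.cong refl)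
    fix j l
    have "(2*pi)^3 \<noteq> 0" by simp
    then show "cos (?a (j - l)) = (2*pi)^3 / 2 * (?e (j - l) + ?e (- (j - l)))"
      unfolding eigfun_addition by (simp only: mult.commute times_divide_eq_left times_divide_eq_right) (simp del: power_mult_distrib)
  qed
  also have "\<dots> = (2*pi)^3 * (\<Sum>j\<in>grid N. \<Sum>l\<in>grid N. ?e (j - l))"
    unfolding sum_distrib_left[symmetric] sum.distrib sym by simp
  also have "(\<Sum>j\<in>grid N. \<Sum>l\<in>grid N. ?e (j - l)) = real (N^3) * fejer_kernel N x y"
    using sum_grid_diff[of ?e N]
    by (cases "N = 0") (simp_all add: fejer_kernel_def fejer_mult_def sum_distrib_left)
  finally have "0 \<le> (2*pi)^3 * (real (N^3) * fejer_kernel N x y)" .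
  then have *: "(2*pi)^3 * real (N^3) * 0 \<le> (2*pi)^3 * real (N^3) * fejer_kernel N x y"
    by (simp only: mult_zero_right mult.assoc)
  show ?thesis
  proof (cases "N = 0")
    case False
    then have "0 < (2*pi)^3 * real (N^3)" by simp
    then show ?thesis using * by (simp only: mult_le_cancel_left_pos)
  qed (simp add: fejer_kernel_def)
qed

lemma fejer_mult_0: "0 < N \<Longrightarrow> fejer_mult N 0 = 1"
  by (simp add: fejer_mult_def card_grid)

lemma integral_eigfun: "(\<integral>x. eigfun k x \<partial>torus) = (if k = 0 then sqrt ((2*pi)^3) else 0)"
proof -
  define q where "q = sqrt ((2*pi)^3)"
  have q: "q \<noteq> 0" by (simp add: q_def)
  have "inner_ee k 0 = (\<integral>x. eigfun k x \<partial>torus) / q"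
    by (simp add: L2_inner_def eigfun_0 q_def)
  then have "(\<integral>x. eigfun k x \<partial>torus) = (if k = 0 then q else 0)"
    using q eigfun_orthonormal[of k 0] by (auto simp: field_simps split: if_splits)
  then show ?thesis unfolding q_def .
qed

text \<open>
  Symmetrization: \<open>\<integral>\<integral> kernel (\<phi> x - \<phi> y) (u x - u y) \<ge> 0\<close>, and since the kernel is symmetric with mass 1, the
  left-hand side is twice the difference of the two sides of the claim. The kernel is a finite sum of
  products, so the iterated integral is computed term by term.
\<close>

lemma fejer_monotone:
  assumes N: "0 < N" and u: "L2_torus u" and p: "integrable torus \<phi>" "integrable torus (\<lambda>x. \<phi> x * u x)"
    and mono: "\<And>x y. 0 \<le> (\<phi> x - \<phi> y) * (u x - u y)"
  shows "(\<Sum>k\<in>low N. fejer_mult N k * (coeff \<phi> k * coeff u k)) \<le> (\<integral>x. \<phi> x * u x \<partial>torus)"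
proof -
  let ?p = "fejer_mult N" and ?q = "\<lambda>x. \<phi> x * u x"
  have bm: "integrable torus (\<lambda>y. g y * eigfun k y)" if "integrable torus g" for g k
  proof (rule Bochner_Integration.integrable_bound[OF integrable_mult_right[OF integrable_norm[OF that], of "sqrt (2 / (2*pi)^3)"]])
    show "(\<lambda>y. g y * eigfun k y) \<in> borel_measurable torus"
      using borel_measurable_integrable[OF that] by (rule borel_measurable_times) (rule measurable_eigfun)
    have "norm (g x * eigfun k x) \<le> norm (b * norm (g x))" if "\<bar>eigfun k x\<bar> \<le> b" for b x
      using mult_left_mono[OF order_trans[OF that abs_ge_self[of b]] abs_ge_zero[of "g x"]]
      by (simp add: abs_mult mult.commute)
    from this[OF eigfun_bound] show "AE x in torus. norm (g x * eigfun k x) \<le> norm (sqrt (2 / (2*pi)^3) * norm (g x))"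
      by (intro AE_I2)
  qed
  have ui: "integrable torus u"
    using L2_torus_mult[OF u L2_torus_continuous[of "\<lambda>x. 1"]] by simp
  have inner: "((\<integral>y. fejer_kernel N x y * ((\<phi> x - \<phi> y) * (u x - u y)) \<partial>torus) =
      ?q x - (\<Sum>k\<in>low N. ?p k * (\<phi> x * eigfun k x * coeff u k))
        - (\<Sum>k\<in>low N. ?p k * (u x * eigfun k x * coeff \<phi> k))
        + (\<Sum>k\<in>low N. ?p k * (eigfun k x * coeff ?q k)))" for x
  proof -
    have K: "(\<integral>y. fejer_kernel N x y * g y \<partial>torus) = (\<Sum>k\<in>low N. ?p k * (eigfun k x * coeff g k))"
      and Ki: "integrable torus (\<lambda>y. fejer_kernel N x y * g y)" if g: "integrable torus g" for g
    proof -
      have eq: "fejer_kernel N x y * g y = (\<Sum>k\<in>low N. ?p k * eigfun k x * (g y * eigfun k y))" for y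
        by (simp add: fejer_kernel_def sum_distrib_left sum_distrib_right mult_ac)
      show "integrable torus (\<lambda>y. fejer_kernel N x y * g y)" unfolding eq
        by (intro Bochner_Integration.integrable_sum integrable_mult_right bm g)
      show "(\<integral>y. fejer_kernel N x y * g y \<partial>torus) = (\<Sum>k\<in>low N. ?p k * (eigfun k x * coeff g k))"
        unfolding eq by (subst Bochner_Integration.integral_sum)
          (auto intro!: integrable_mult_right bm g simp: coeff_def L2_inner_def mult.assoc)
    qed
    have one: "(\<integral>y. fejer_kernel N x y * 1 \<partial>torus) = 1"
    proof -
      have "(\<integral>y. fejer_kernel N x y * 1 \<partial>torus) = (\<Sum>k\<in>low N. ?p k * (eigfun k x * (if k = 0 then sqrt ((2*pi)^3) else 0)))"
        by (subst K) (simp_all add: coeff_def L2_inner_def integral_eigfun)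
      also have "\<dots> = ?p 0 * (eigfun 0 x * sqrt ((2*pi)^3))"
      proof -
        have "0 \<in> low N" using N by (simp add: low_def height_less_iff)
        then show ?thesis by (subst sum.remove[of _ 0]) auto
      qed
      also have "\<dots> = 1" using fejer_mult_0[OF N] by (simp add: eigfun_0)
      finally show ?thesis .
    qed
    have e: "fejer_kernel N x y * ((\<phi> x - \<phi> y) * (u x - u y)) =
      ?q x * (fejer_kernel N x y * 1) - \<phi> x * (fejer_kernel N x y * u y) - u x * (fejer_kernel N x y * \<phi> y) + fejer_kernel N x y * ?q y" for y
      by (simp add: algebra_simps)
    have "(\<integral>y. fejer_kernel N x y * ((\<phi> x - \<phi> y) * (u x - u y)) \<partial>torus) =
      ?q x * (\<integral>y. fejer_kernel N x y * 1 \<partial>torus) - \<phi> x * (\<integral>y. fejer_kernel N x y * u y \<partial>torus)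
      - u x * (\<integral>y. fejer_kernel N x y * \<phi> y \<partial>torus) + (\<integral>y. fejer_kernel N x y * ?q y \<partial>torus)"
      unfolding e using Ki[of "\<lambda>y. 1"] Ki[OF ui] Ki[OF p(1)] Ki[OF p(2)] by simp
    then show ?thesis unfolding one K[OF ui] K[OF p(1)] K[OF p(2)]
      by (simp add: sum_distrib_left mult_ac)
  qed
  have i1: "integrable torus (\<lambda>x. ?p k * (\<phi> x * eigfun k x * c))"
    and i2: "integrable torus (\<lambda>x. ?p k * (u x * eigfun k x * c))"
    and i3: "integrable torus (\<lambda>x. ?p k * (eigfun k x * c))" for k c
    using bm[OF p(1), of k] bm[OF ui, of k] bm[of "\<lambda>x. 1" k] by simp_all
  have "0 \<le> (\<integral>x. (\<integral>y. fejer_kernel N x y * ((\<phi> x - \<phi> y) * (u x - u y)) \<partial>torus) \<partial>torus)"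
    by (intro integral_nonneg_AE AE_I2) (simp add: fejer_kernel_nonneg mono)
  also have "\<dots> = (\<integral>x. ?q x \<partial>torus) - (\<Sum>k\<in>low N. ?p k * (coeff \<phi> k * coeff u k))
        - (\<Sum>k\<in>low N. ?p k * (coeff u k * coeff \<phi> k))
        + (\<Sum>k\<in>low N. ?p k * ((\<integral>x. eigfun k x \<partial>torus) * coeff ?q k))"
    unfolding inner using p(2) i1 i2 i3
    by (simp add: coeff_def L2_inner_def Bochner_Integration.integral_sum)
  also have "(\<Sum>k\<in>low N. ?p k * ((\<integral>x. eigfun k x \<partial>torus) * coeff ?q k)) = (\<integral>x. ?q x \<partial>torus)"
  proof -
    have "0 \<in> low N" using N by (simp add: low_def height_less_iff)
    then have "(\<Sum>k\<in>low N. ?p k * ((\<integral>x. eigfun k x \<partial>torus) * coeff ?q k)) = sqrt ((2*pi)^3) * coeff ?q 0"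
      by (subst sum.remove[of _ 0]) (auto simp: integral_eigfun fejer_mult_0[OF N])
    also have "\<dots> = (\<integral>x. ?q x \<partial>torus)"
      by (simp add: coeff_def L2_inner_def eigfun_0)
    finally show ?thesis .
  qed
  finally show ?thesis by (simp add: mult.commute[of "coeff u _"])
qed

text \<open>
  The multiplier of the bounded operator \<open>N (1 - P\<^sub>N)\<close>, with \<open>P\<^sub>N\<close> the convolution with the Fejer kernel; it
  stands in for the square root of the negative Laplacian.
\<close>

definition fejer_defect :: "nat \<Rightarrow> int^3 \<Rightarrow> real" where
  "fejer_defect N k = real N * (1 - fejer_mult N k)"

lemma fejer_defect_card:
  assumes "0 < N"
  shows "fejer_defect N k = real (card {l \<in> grid N. l + k \<notin> grid N}) / real (N^2)"
proof -
  have "{l \<in> grid N. l + k \<notin> grid N} = grid N - {l \<in> grid N. l + k \<in> grid N}" by auto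
  then have "card {l \<in> grid N. l + k \<notin> grid N} = N^3 - card {l \<in> grid N. l + k \<in> grid N}"
    by (simp add: card_Diff_subset card_grid)
  moreover have "card {l \<in> grid N. l + k \<in> grid N} \<le> N^3"
    using card_mono[of "grid N" "{l \<in> grid N. l + k \<in> grid N}"] by (auto simp: card_grid)
  ultimately show ?thesis using assms
    by (simp add: fejer_defect_def fejer_mult_def of_nat_diff field_simps power2_eq_square power3_eq_cube)
qed

lemma card_slab:
  "card {l. \<forall>j. l $ j \<in> (if j = i then T else {0..<int N})} = card T * N^2" for i :: 3
proof -
  have "(\<Prod>j\<in>UNIV. card (if j = i then T else {0..<int N})) = card T * (\<Prod>j\<in>UNIV - {i}. N)"
    by (subst prod.remove[of UNIV i]) auto
  then show ?thesis by (subst card_vec3) simp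
qed

lemma card_shifted_out:
  "card {t \<in> {0..<int N}. t + a \<notin> {0..<int N}} \<le> nat \<bar>a\<bar>"
  "nat \<bar>a\<bar> \<le> N \<Longrightarrow> card {t \<in> {0..<int N}. t + a \<notin> {0..<int N}} = nat \<bar>a\<bar>"
proof -
  let ?T = "{t \<in> {0..<int N}. t + a \<notin> {0..<int N}}"
  let ?S = "if 0 \<le> a then {int N - a..<int N} else {0..<- a}"
  have S: "card ?S = nat \<bar>a\<bar>" by simp
  have "?T \<subseteq> ?S" by auto
  then have "card ?T \<le> card ?S" by (intro card_mono) auto
  then show "card ?T \<le> nat \<bar>a\<bar>" using S by simp
  show "card ?T = nat \<bar>a\<bar>" if "nat \<bar>a\<bar> \<le> N"
  proof -
    have "?T = ?S" using that by auto
    then show ?thesis using S by simp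
  qed
qed

text \<open>
  The defect counts the grid points that the shift by \<open>k\<close> pushes out of the grid. Such a point leaves
  through one of three slabs of thickness \<open>|k\<^sub>i|\<close> (upper bound), and one slab alone gives the lower bound.
  The last two estimates say that the multiplier is comparable to \<open>|k|\<close> on frequencies of height at
  most \<open>N\<close>, while the upper one holds for all frequencies.
\<close>

lemma fejer_defect_bounds:
  assumes N: "0 < N"
  shows "0 \<le> fejer_defect N k" "fejer_defect N k \<le> real N" "fejer_defect N k \<le> 3 * sqrt (eigval k)"
    "height k \<le> N \<Longrightarrow> real (height k) \<le> fejer_defect N k"
proof -
  let ?D = "{l \<in> grid N. l + k \<notin> grid N}"
  let ?T = "\<lambda>i. {t \<in> {0..<int N}. t + k $ i \<notin> {0..<int N}}"
  let ?S = "\<lambda>i. {l. \<forall>j. l $ j \<in> (if j = i then ?T i else {0..<int N})}"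
  note eq = fejer_defect_card[OF N, of k]
  have S_sub: "?S i \<subseteq> ?D" for i
  proof
    fix l assume l: "l \<in> ?S i"
    have "l $ j \<in> {0..<int N}" for j
    proof -
      have "l $ j \<in> (if j = i then ?T i else {0..<int N})" using l by blast
      then show ?thesis by (cases "j = i") auto
    qed
    moreover have "(l + k) $ i \<notin> {0..<int N}"
    proof -
      have "l $ i \<in> (if i = i then ?T i else {0..<int N})" using l by blast
      then show ?thesis by simp
    qed
    ultimately show "l \<in> ?D" unfolding grid_def by blast
  qed
  have D_sub: "?D \<subseteq> (\<Union>i. ?S i)"
    by (auto simp: grid_def)
  show "0 \<le> fejer_defect N k" unfolding eq by simp
  show "fejer_defect N k \<le> real N" by (simp add: fejer_defect_def fejer_mult_def mult_left_le)
  have finT: "finite (?T i)" for i by (rule finite_subset[of _ "{0..<int N}"]) auto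
  have finS: "finite (?S i)" for i
  proof (rule finite_vec3)
    show "finite (if j = i then ?T i else {0..<int N})" for j
      using finT[of i] by (cases "j = i") (simp_all only: if_True if_False simp_thms finite_atLeastLessThan_int)
  qed
  have "real (card ?D) \<le> real (card (\<Union>i. ?S i))"
    using D_sub finS by (intro of_nat_mono card_mono) auto
  also have "\<dots> \<le> (\<Sum>i\<in>UNIV. real (card (?S i)))"
    unfolding of_nat_sum[symmetric] by (intro of_nat_mono card_UN_le) simp
  also have "\<dots> \<le> (\<Sum>i\<in>(UNIV::3 set). sqrt (eigval k) * real (N^2))"
  proof (rule sum_mono)
    fix i :: 3
    have "real (nat \<bar>k $ i\<bar>) \<le> real (height k)" using abs_le_height by (rule of_nat_mono)
    also have "\<dots> \<le> sqrt (eigval k)" by (rule real_le_rsqrt) (rule height_sq_le_eigval)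
    finally have "real (nat \<bar>k $ i\<bar>) \<le> sqrt (eigval k)" .
    moreover have "real (card (?T i)) \<le> real (nat \<bar>k $ i\<bar>)" using card_shifted_out(1) by (rule of_nat_mono)
    ultimately show "real (card (?S i)) \<le> sqrt (eigval k) * real (N^2)"
      unfolding card_slab of_nat_mult by (intro mult_right_mono) auto
  qed
  finally have "real (card ?D) \<le> 3 * sqrt (eigval k) * real (N^2)" by simp
  then show "fejer_defect N k \<le> 3 * sqrt (eigval k)" unfolding eq using N by (simp add: divide_le_eq)
  show "real (height k) \<le> fejer_defect N k" if h: "height k \<le> N"
  proof -
    obtain i where i: "height k = nat \<bar>k $ i\<bar>" by (rule height_attained)
    have "height k * N^2 = card (?S i)"
      unfolding card_slab using card_shifted_out(2)[of "k $ i" N] h i by simp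
    also have "\<dots> \<le> card ?D" by (rule card_mono[OF _ S_sub]) auto
    finally have "real (height k * N^2) \<le> real (card ?D)" by (rule of_nat_mono)
    then show ?thesis unfolding eq using N by (simp add: le_divide_eq)
  qed
qed

lemma eigval_le_height: "eigval k \<le> 3 * (real (height k))\<^sup>2"
proof -
  have "eigval k \<le> (\<Sum>i\<in>(UNIV::3 set). (real (height k))\<^sup>2)" unfolding eigval_eq
  proof (rule sum_mono)
    fix i
    have "real (nat \<bar>k $ i\<bar>) \<le> real (height k)" using abs_le_height by (rule of_nat_mono)
    then have "\<bar>real_of_int (k $ i)\<bar> \<le> \<bar>real (height k)\<bar>" by simp
    then show "(real_of_int (k $ i))\<^sup>2 \<le> (real (height k))\<^sup>2" by (simp only: abs_le_square_iff)
  qed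
  then show ?thesis by simp
qed

section \<open>Pairing a quintic nonlinearity with H1 functions\<close>

lemma filterlim_low: "filterlim low (finite_subsets_at_top UNIV) sequentially"
  unfolding filterlim_finite_subsets_at_top
proof safe
  fix X :: "(int^3) set" assume X: "finite X"
  have "X \<subseteq> low n" if "n \<ge> Suc (Max (height ` X))" for n
    using X that by (auto simp: low_def less_eq_Suc_le intro: order_trans[OF _ that])
  then show "\<forall>\<^sub>F y in sequentially. finite (low y) \<and> X \<subseteq> low y \<and> low y \<subseteq> UNIV"
    unfolding eventually_sequentially by auto
qed

lemma has_sum_imp_low_limit: "(g has_sum S) UNIV \<Longrightarrow> (\<lambda>M. \<Sum>k\<in>low M. g k) \<longlonglongrightarrow> (S :: real)"
  unfolding has_sum_def by (rule filterlim_compose[OF _ filterlim_low])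

lemma has_sum_off_finite:
  fixes g :: "'k \<Rightarrow> real"
  assumes "(g has_sum S) UNIV" "finite F"
  shows "((\<lambda>k. if k \<in> F then 0 else g k) has_sum (S - sum g F)) UNIV"
proof -
  have "((\<lambda>k. if k \<in> F then g k else 0) has_sum sum g F) UNIV"
    by (rule has_sum_finite_neutralI[OF assms(2)]) auto
  from has_sum_add[OF assms(1) has_sum_uminusI[OF this]]
  have "((\<lambda>k. g k + - (if k \<in> F then g k else 0)) has_sum (S - sum g F)) UNIV" by simp
  moreover have "g k + - (if k \<in> F then g k else 0) = (if k \<in> F then 0 else g k)" for k by simp
  ultimately show ?thesis by simp
qed

lemma young_5_1:
  fixes a b \<delta> :: real
  assumes "0 \<le> a" "0 \<le> b" "0 < \<delta>"
  shows "a^5 * b \<le> \<delta> * a^6 + b^6 / \<delta>^5"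
proof (cases "b \<le> \<delta> * a")
  case True
  have "a^5 * b \<le> a^5 * (\<delta> * a)" using True assms by (intro mult_left_mono) auto
  also have "\<dots> = \<delta> * a^6" by (simp add: eval_nat_numeral)
  finally show ?thesis using assms by (simp add: add_increasing2)
next
  case False
  then have "a \<le> b / \<delta>" using assms by (simp add: field_simps)
  then have "a^5 * b \<le> (b / \<delta>)^5 * b" using assms by (intro mult_right_mono power_mono) auto
  also have "\<dots> = b^6 / \<delta>^5" by (simp add: eval_nat_numeral power_divide)
  finally show ?thesis using assms by (simp add: add_increasing)
qed

text \<open>
  Order five is the critical growth for pairings with \<open>H\<^sup>1\<close> functions in three dimensions; the last
  condition says that adding \<open>K s\<close> makes the nonlinearity nondecreasing.
\<close>

locale quintic_nonlinearity =
  fixes f :: "real \<Rightarrow> real" and A K :: real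
  assumes f_cont: "continuous_on UNIV f" and A_nonneg: "0 \<le> A" and K_nonneg: "0 \<le> K"
    and growth: "\<And>s. \<bar>f s\<bar> \<le> A * (1 + \<bar>s\<bar>^5)"
    and mono: "\<And>s t. 0 \<le> ((f s + K * s) - (f t + K * t)) * (s - t)"
begin

lemma measurable_f: "u \<in> borel_measurable M \<Longrightarrow> (\<lambda>x. f (u x)) \<in> borel_measurable M"
  using measurable_compose[OF _ borel_measurable_continuous_onI[OF f_cont]] .

lemma pairing_pointwise:
  assumes "0 < \<delta>"
  shows "\<bar>f s * r\<bar> \<le> A * (\<delta> * (1 + s^6) + 2 * r^6 / \<delta>^5)"
proof -
  have "\<bar>f s * r\<bar> \<le> A * (1 + \<bar>s\<bar>^5) * \<bar>r\<bar>" unfolding abs_mult by (rule mult_right_mono[OF growth]) simp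
  also have "\<dots> = A * (1^5 * \<bar>r\<bar> + \<bar>s\<bar>^5 * \<bar>r\<bar>)" by (simp add: algebra_simps)
  also have "\<dots> \<le> A * ((\<delta> * 1^6 + \<bar>r\<bar>^6 / \<delta>^5) + (\<delta> * \<bar>s\<bar>^6 + \<bar>r\<bar>^6 / \<delta>^5))"
    using assms A_nonneg by (intro mult_left_mono add_mono young_5_1) auto
  also have "\<dots> = A * (\<delta> * (1 + s^6) + 2 * r^6 / \<delta>^5)" by (simp add: algebra_simps power_even_abs)
  finally show ?thesis .
qed

text \<open>
  Young's inequality in place of a duality between Lebesgue spaces. The free parameter \<open>\<delta>\<close> makes the
  pairing small when only the sixth moment of \<open>w\<close> is small.
\<close>

lemma pairing:
  assumes m: "u \<in> borel_measurable torus" "w \<in> borel_measurable torus"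
    and i: "integrable torus (\<lambda>x. (u x)^6)" "integrable torus (\<lambda>x. (w x)^6)"
  shows "integrable torus (\<lambda>x. f (u x) * w x)"
    "0 < \<delta> \<Longrightarrow> \<bar>\<integral>x. f (u x) * w x \<partial>torus\<bar>
       \<le> A * (\<delta> * ((2*pi)^3 + (\<integral>x. (u x)^6 \<partial>torus)) + 2 * (\<integral>x. (w x)^6 \<partial>torus) / \<delta>^5)"
proof -
  have fm: "(\<lambda>x. f (u x) * w x) \<in> borel_measurable torus"
    using measurable_f[OF m(1)] m(2) by (rule borel_measurable_times)
  let ?B = "\<lambda>\<delta> x. A * (\<delta> * (1 + (u x)^6) + 2 * (w x)^6 / \<delta>^5)"
  have Bi: "integrable torus (?B \<delta>)" for \<delta> using i by simp
  show int: "integrable torus (\<lambda>x. f (u x) * w x)"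
  proof (rule Bochner_Integration.integrable_bound[OF Bi[of 1] fm], rule AE_I2)
    fix x show "norm (f (u x) * w x) \<le> norm (?B 1 x)"
      using pairing_pointwise[of 1 "u x" "w x"] by simp
  qed
  assume \<delta>: "0 < \<delta>"
  have "\<bar>\<integral>x. f (u x) * w x \<partial>torus\<bar> \<le> (\<integral>x. \<bar>f (u x) * w x\<bar> \<partial>torus)" by (rule integral_abs_bound)
  also have "\<dots> \<le> (\<integral>x. ?B \<delta> x \<partial>torus)"
    by (rule integral_mono[OF _ Bi]) (use int pairing_pointwise[OF \<delta>] in auto)
  also have "\<dots> = A * (\<delta> * ((2*pi)^3 + (\<integral>x. (u x)^6 \<partial>torus)) + 2 * (\<integral>x. (w x)^6 \<partial>torus) / \<delta>^5)"
    using i by (simp add: measure_torus)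
  finally show "\<bar>\<integral>x. f (u x) * w x \<partial>torus\<bar>
       \<le> A * (\<delta> * ((2*pi)^3 + (\<integral>x. (u x)^6 \<partial>torus)) + 2 * (\<integral>x. (w x)^6 \<partial>torus) / \<delta>^5)" .
qed

end

definition h1_bounded :: "real \<Rightarrow> (real^3 \<Rightarrow> real) \<Rightarrow> bool" where
  "h1_bounded H u \<longleftrightarrow> 0 < H \<and> L2_torus u \<and>
     (\<lambda>k. (1 + eigval k) * (coeff u k)\<^sup>2) summable_on UNIV \<and> h1_sum (coeff u) \<le> H"

lemma h1_bounded_L6:
  assumes "h1_bounded H u"
  shows "u \<in> borel_measurable torus" "integrable torus (\<lambda>x. (u x)^6)" "(\<integral>x. (u x)^6 \<partial>torus) \<le> sobolev_const * H^3"
  using assms sobolev_L6[of u H] by (auto simp: h1_bounded_def L2_torus_measurable)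

text \<open>
  Bounded multipliers preserve \<open>H\<^sup>1\<close> bounds uniformly in the number of modes, which provides the
  dominating function for the limit in \<open>height_weighted_bound\<close>.
\<close>

lemma h1_bounded_multiplier:
  assumes u: "h1_bounded H u" and F: "finite F" and m: "\<And>k. \<bar>m k\<bar> \<le> M"
  shows "h1_bounded ((M\<^sup>2 + 1) * H) (fsum (\<lambda>k. m k * coeff u k) F)"
proof -
  have H: "0 < H" and s: "(\<lambda>k. (1 + eigval k) * (coeff u k)\<^sup>2) summable_on UNIV" "h1_sum (coeff u) \<le> H"
    using u by (auto simp: h1_bounded_def)
  let ?g = "\<lambda>k. if k \<in> F then (1 + eigval k) * (m k * coeff u k)\<^sup>2 else 0"
  have h: "(?g has_sum (\<Sum>k\<in>F. (1 + eigval k) * (m k * coeff u k)\<^sup>2)) UNIV"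
    by (rule has_sum_finite_neutralI[OF F]) auto
  have e: "(1 + eigval k) * (coeff (fsum (\<lambda>k. m k * coeff u k) F) k)\<^sup>2 = ?g k" for k
    by (simp add: coeff_fsum[OF F])
  have "(\<Sum>k\<in>F. (1 + eigval k) * (m k * coeff u k)\<^sup>2) \<le> (\<Sum>k\<in>F. M\<^sup>2 * ((1 + eigval k) * (coeff u k)\<^sup>2))"
  proof (rule sum_mono)
    fix k
    have "(m k)\<^sup>2 \<le> M\<^sup>2" using power_mono[OF m[of k] abs_ge_zero, of 2] by simp
    then have "(m k)\<^sup>2 * ((1 + eigval k) * (coeff u k)\<^sup>2) \<le> M\<^sup>2 * ((1 + eigval k) * (coeff u k)\<^sup>2)"
      by (rule mult_right_mono) simp
    then show "(1 + eigval k) * (m k * coeff u k)\<^sup>2 \<le> M\<^sup>2 * ((1 + eigval k) * (coeff u k)\<^sup>2)"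
      by (simp add: power_mult_distrib mult_ac)
  qed
  also have "\<dots> \<le> M\<^sup>2 * H"
    unfolding sum_distrib_left[symmetric]
    by (rule mult_left_mono[OF order_trans[OF finite_sum_le_infsum[OF s(1) F] s(2)]]) auto
  also have "\<dots> \<le> (M\<^sup>2 + 1) * H" using H by (simp add: distrib_right)
  finally have "(\<Sum>k\<in>F. (1 + eigval k) * (m k * coeff u k)\<^sup>2) \<le> (M\<^sup>2 + 1) * H" .
  then show ?thesis
    unfolding h1_bounded_def e using h H has_sum_imp_summable[OF h] infsumI[OF h]
    by (auto intro!: L2_fsum mult_pos_pos add_nonneg_pos)
qed

lemma eigfun_L6: "(\<lambda>x. eigfun k x ^ 6) \<in> borel_measurable torus" "integrable torus (\<lambda>x. eigfun k x ^ 6)" "(\<integral>x. eigfun k x ^ 6 \<partial>torus) \<le> (2*pi)^3"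
proof -
  show "(\<lambda>x. eigfun k x ^ 6) \<in> borel_measurable torus" by (rule borel_measurable_power) (rule measurable_eigfun)
  show i: "integrable torus (\<lambda>x. eigfun k x ^ 6)"
    by (intro integrable_torus_continuous continuous_intros continuous_eigfun)
  have "\<bar>eigfun k x\<bar> \<le> 1" for x
  proof -
    have "2 / (2*pi)^3 \<le> 2 / 216" using two_pi_cube by (intro divide_left_mono) auto
    then have "sqrt (2 / (2*pi)^3) \<le> 1" by simp
    then show ?thesis using eigfun_bound[of k x] by linarith
  qed
  then have "eigfun k x ^ 6 \<le> 1" for x
    using power_mono[of "\<bar>eigfun k x\<bar>" 1 6] by (simp add: power_even_abs)
  then have "(\<integral>x. eigfun k x ^ 6 \<partial>torus) \<le> (\<integral>x. 1 \<partial>torus)" by (intro integral_mono i) auto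
  then show "(\<integral>x. eigfun k x ^ 6 \<partial>torus) \<le> (2*pi)^3" by (simp add: measure_torus)
qed

context quintic_nonlinearity
begin

lemma f_eigfun:
  assumes u: "h1_bounded H u"
  shows "integrable torus (\<lambda>x. f (u x) * eigfun k x)"
    "\<bar>coeff (\<lambda>x. f (u x)) k\<bar> \<le> A * (3 * (2*pi)^3 + sobolev_const * H^3)"
proof -
  note u' = h1_bounded_L6[OF u] and e = eigfun_L6[of k]
  show "integrable torus (\<lambda>x. f (u x) * eigfun k x)"
    by (rule pairing(1)[OF u'(1) measurable_eigfun(2) u'(2) e(2)])
  have "\<bar>coeff (\<lambda>x. f (u x)) k\<bar> \<le> A * (1 * ((2*pi)^3 + (\<integral>x. (u x)^6 \<partial>torus)) + 2 * (\<integral>x. (eigfun k x)^6 \<partial>torus) / 1^5)"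
    unfolding coeff_def L2_inner_def by (rule pairing(2)[OF u'(1) measurable_eigfun(2) u'(2) e(2)]) simp
  also have "\<dots> \<le> A * (3 * (2*pi)^3 + sobolev_const * H^3)"
    unfolding mult_1 power_one div_by_1 using u'(3) e(3) by (intro mult_left_mono A_nonneg) linarith
  finally show "\<bar>coeff (\<lambda>x. f (u x)) k\<bar> \<le> A * (3 * (2*pi)^3 + sobolev_const * H^3)" .
qed

lemma weighted_pairing_bound:
  assumes u: "h1_bounded H u" and F: "finite F" and m: "\<And>k. \<bar>m k\<bar> \<le> M"
  shows "\<bar>\<Sum>k\<in>F. m k * (coeff (\<lambda>x. f (u x)) k * coeff u k)\<bar>
    \<le> A * ((2*pi)^3 + sobolev_const * H^3 + 2 * (sobolev_const * ((M\<^sup>2 + 1) * H)^3))"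
proof -
  let ?w = "fsum (\<lambda>k. m k * coeff u k) F"
  have w: "h1_bounded ((M\<^sup>2 + 1) * H) ?w" by (rule h1_bounded_multiplier[OF u F m])
  note u' = h1_bounded_L6[OF u] and w' = h1_bounded_L6[OF w]
  have "(\<Sum>k\<in>F. m k * (coeff (\<lambda>x. f (u x)) k * coeff u k)) = L2_inner (\<lambda>x. f (u x)) ?w"
    by (subst L2_inner_fsum_integrable[OF f_eigfun(1)[OF u]]) (simp add: mult_ac)
  also have "\<bar>\<dots>\<bar> \<le> A * (1 * ((2*pi)^3 + (\<integral>x. (u x)^6 \<partial>torus)) + 2 * (\<integral>x. (?w x)^6 \<partial>torus) / 1^5)"
    unfolding L2_inner_def by (rule pairing(2)[OF u'(1) w'(1) u'(2) w'(2)]) simp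
  also have "\<dots> \<le> A * ((2*pi)^3 + sobolev_const * H^3 + 2 * (sobolev_const * ((M\<^sup>2 + 1) * H)^3))"
    unfolding mult_1 power_one div_by_1 using u'(3) w'(3) by (intro mult_left_mono A_nonneg) linarith
  finally show ?thesis .
qed

text \<open>
  The truncations of \<open>u\<close> converge to it in \<open>H\<^sup>1\<close>, hence in \<open>L\<^sup>6\<close>, and the pairing with \<open>f(u)\<close> is
  continuous there.
\<close>

lemma pairing_low_limit:
  assumes u: "h1_bounded H u"
  shows "(\<lambda>M. \<Sum>k\<in>low M. coeff (\<lambda>x. f (u x)) k * coeff u k) \<longlonglongrightarrow> (\<integral>x. f (u x) * u x \<partial>torus)"
proof (rule tendstoI)
  fix \<epsilon> :: real assume \<epsilon>: "0 < \<epsilon>"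
  note u' = h1_bounded_L6[OF u]
  have s: "(\<lambda>k. (1 + eigval k) * (coeff u k)\<^sup>2) summable_on UNIV" and uL2: "L2_torus u"
    using u by (auto simp: h1_bounded_def)
  define U where "U = (2*pi)^3 + (\<integral>x. (u x)^6 \<partial>torus)"
  have U: "0 < U" unfolding U_def by (intro add_pos_nonneg integral_nonneg_AE) auto
  (* half of the error budget goes to the sixth moment of u *)
  define \<delta> where "\<delta> = \<epsilon> / (2 * (A + 1) * U)"
  have \<delta>: "0 < \<delta>" using \<epsilon> U A_nonneg by (simp add: \<delta>_def add_nonneg_pos)
  have Ad: "A * (\<delta> * U) \<le> \<epsilon> / 2"
  proof -
    have "\<delta> * U = \<epsilon> / (2 * (A + 1))" using U by (simp add: \<delta>_def)
    then have "A * (\<delta> * U) = \<epsilon> / 2 * (A / (A + 1))" by simp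
    also have "\<dots> \<le> \<epsilon> / 2 * 1" using \<epsilon> A_nonneg by (intro mult_left_mono) auto
    finally show ?thesis by simp
  qed
  have "(\<lambda>\<eta>. A * (2 * (sobolev_const * \<eta>^3) / \<delta>^5)) \<midarrow>0\<rightarrow> A * (2 * (sobolev_const * 0^3) / \<delta>^5)"
    using \<delta> by (intro tendsto_intros) auto
  then have "((\<lambda>\<eta>. A * (2 * (sobolev_const * \<eta>^3) / \<delta>^5)) \<longlongrightarrow> 0) (at_right 0)"
    by (auto intro: filterlim_mono at_le)
  then have "\<forall>\<^sub>F \<eta> in at_right 0. A * (2 * (sobolev_const * \<eta>^3) / \<delta>^5) < \<epsilon> / 2"
    by (rule order_tendstoD) (use \<epsilon> in simp)
  then obtain \<eta> where \<eta>: "0 < \<eta>" "A * (2 * (sobolev_const * \<eta>^3) / \<delta>^5) < \<epsilon> / 2"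
    unfolding eventually_at_right_field by (metis dense)
  have "\<forall>\<^sub>F M in sequentially. h1_sum (coeff u) - \<eta> < (\<Sum>k\<in>low M. (1 + eigval k) * (coeff u k)\<^sup>2)"
    by (rule order_tendstoD(1)[OF has_sum_imp_low_limit[OF has_sum_infsum[OF s]]]) (use \<eta> in simp)
  then show "\<forall>\<^sub>F M in sequentially. dist (\<Sum>k\<in>low M. coeff (\<lambda>x. f (u x)) k * coeff u k) (\<integral>x. f (u x) * u x \<partial>torus) < \<epsilon>"
  proof eventually_elim
    case (elim M)
    let ?s = "fsum (coeff u) (low M)"
    let ?w = "\<lambda>x. u x - ?s x"
    have wL2: "L2_torus ?w" by (intro L2_torus_diff uL2 L2_fsum)
    have c: "(1 + eigval k) * (coeff ?w k)\<^sup>2 = (if k \<in> low M then 0 else (1 + eigval k) * (coeff u k)\<^sup>2)" for k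
      by (simp add: coeff_diff[OF uL2 L2_fsum] coeff_fsum)
    have h: "((\<lambda>k. (1 + eigval k) * (coeff ?w k)\<^sup>2) has_sum (h1_sum (coeff u) - (\<Sum>k\<in>low M. (1 + eigval k) * (coeff u k)\<^sup>2))) UNIV"
      unfolding c by (rule has_sum_off_finite[OF has_sum_infsum[OF s]]) simp
    have w: "h1_bounded \<eta> ?w"
      unfolding h1_bounded_def using elim \<eta>(1) wL2 has_sum_imp_summable[OF h] infsumI[OF h] by auto
    note w' = h1_bounded_L6[OF w]
    have si: "integrable torus (\<lambda>x. f (u x) * ?s x)"
      by (rule pairing(1)[OF u'(1) _ u'(2)]) (auto intro!: continuous_borel_torus integrable_torus_continuous continuous_intros continuous_fsum)
    have "(\<integral>x. f (u x) * u x \<partial>torus) - (\<Sum>k\<in>low M. coeff (\<lambda>x. f (u x)) k * coeff u k) = (\<integral>x. f (u x) * u x \<partial>torus) - (\<integral>x. f (u x) * ?s x \<partial>torus)"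
      using L2_inner_fsum_integrable[OF f_eigfun(1)[OF u], of "coeff u" "low M"] by (simp add: L2_inner_def mult.commute)
    also have "\<dots> = (\<integral>x. f (u x) * ?w x \<partial>torus)"
      using pairing(1)[OF u'(1) u'(1) u'(2) u'(2)] si by (simp add: right_diff_distrib)
    finally have "dist (\<Sum>k\<in>low M. coeff (\<lambda>x. f (u x)) k * coeff u k) (\<integral>x. f (u x) * u x \<partial>torus) = \<bar>\<integral>x. f (u x) * ?w x \<partial>torus\<bar>"
      by (simp add: dist_real_def abs_minus_commute)
    also have "\<dots> \<le> A * (\<delta> * U + 2 * (\<integral>x. (?w x)^6 \<partial>torus) / \<delta>^5)"
      unfolding U_def by (rule pairing(2)[OF u'(1) w'(1) u'(2) w'(2) \<delta>])
    also have "\<dots> \<le> A * (\<delta> * U) + A * (2 * (sobolev_const * \<eta>^3) / \<delta>^5)"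
      unfolding distrib_left using w'(3) \<delta> A_nonneg by (intro add_left_mono mult_left_mono divide_right_mono) auto
    also have "\<dots> < \<epsilon>" using Ad \<eta>(2) by linarith
    finally show ?case .
  qed
qed

text \<open>
  The Fejer form of the sign condition \<open>(f(u) + K u, N (1 - P\<^sub>N) u) \<ge> 0\<close>. As \<open>P\<^sub>N\<close> involves finitely many
  modes only, the sum differs from the truncations of \<open>(f(u) + K u, u)\<close> by a fixed amount.
\<close>

theorem fejer_dissipative:
  assumes u: "h1_bounded H u" and N: "0 < N"
  shows "\<exists>L\<ge>0. (\<lambda>M. \<Sum>k\<in>low M. fejer_defect N k * (coeff (\<lambda>x. f (u x)) k * coeff u k + K * (coeff u k)\<^sup>2)) \<longlonglongrightarrow> L"
proof -
  note u' = h1_bounded_L6[OF u]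
  have uL2: "L2_torus u" using u by (simp add: h1_bounded_def)
  have u1: "integrable torus u" "integrable torus (\<lambda>x. u x * u x)"
    using L2_torus_mult[OF uL2 L2_torus_continuous[of "\<lambda>x. 1"]] L2_torus_mult[OF uL2 uL2] by simp_all
  have f1: "integrable torus (\<lambda>x. f (u x))"
    using pairing(1)[OF u'(1) _ u'(2), of "\<lambda>x. 1"] by simp
  have fu: "integrable torus (\<lambda>x. f (u x) * u x)" by (rule pairing(1)[OF u'(1) u'(1) u'(2) u'(2)])
  define \<phi> where "\<phi> x = f (u x) + K * u x" for x
  define c where "c k = coeff (\<lambda>x. f (u x)) k * coeff u k + K * (coeff u k)\<^sup>2" for k
  have \<phi>1: "integrable torus \<phi>" unfolding \<phi>_def using f1 u1 by simp
  have e: "\<phi> x * u x = f (u x) * u x + K * (u x * u x)" for x by (simp add: \<phi>_def algebra_simps)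
  have \<phi>2: "integrable torus (\<lambda>x. \<phi> x * u x)" unfolding e using fu u1 by simp
  have \<phi>c: "coeff \<phi> k * coeff u k = c k" for k
  proof -
    have "coeff \<phi> k = coeff (\<lambda>x. f (u x)) k + K * coeff u k"
      using f_eigfun(1)[OF u, of k] L2_torus_mult[OF uL2 L2_eigfun[of k]]
      by (simp add: coeff_def L2_inner_def \<phi>_def distrib_right mult.assoc)
    then show ?thesis by (simp add: c_def power2_eq_square algebra_simps)
  qed
  have lim: "(\<lambda>M. \<Sum>k\<in>low M. c k) \<longlonglongrightarrow> (\<integral>x. \<phi> x * u x \<partial>torus)"
  proof -
    have "(\<lambda>M. (\<Sum>k\<in>low M. coeff (\<lambda>x. f (u x)) k * coeff u k) + K * (\<Sum>k\<in>low M. (coeff u k)\<^sup>2))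
      \<longlonglongrightarrow> (\<integral>x. f (u x) * u x \<partial>torus) + K * L2_inner u u"
      by (intro tendsto_intros pairing_low_limit[OF u] has_sum_imp_low_limit parseval uL2)
    then show ?thesis
      unfolding e c_def using fu u1 by (simp add: sum.distrib sum_distrib_left L2_inner_def)
  qed
  have out: "fejer_mult N k = 0" if "k \<notin> low N" for k
  proof -
    have "{l \<in> grid N. l + k \<in> grid N} = {}" using grid_diff_low[of "l + k" N l for l] that by auto
    then show ?thesis by (simp add: fejer_mult_def)
  qed
  let ?L = "real N * ((\<integral>x. \<phi> x * u x \<partial>torus) - (\<Sum>k\<in>low N. fejer_mult N k * c k))"
  have "(\<lambda>M. real N * ((\<Sum>k\<in>low M. c k) - (\<Sum>k\<in>low N. fejer_mult N k * c k))) \<longlonglongrightarrow> ?L"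
    by (intro tendsto_intros lim)
  moreover have "\<forall>\<^sub>F M in sequentially. real N * ((\<Sum>k\<in>low M. c k) - (\<Sum>k\<in>low N. fejer_mult N k * c k)) = (\<Sum>k\<in>low M. fejer_defect N k * c k)"
  proof -
    have "real N * ((\<Sum>k\<in>low M. c k) - (\<Sum>k\<in>low N. fejer_mult N k * c k)) = (\<Sum>k\<in>low M. fejer_defect N k * c k)" if "N \<le> M" for M
    proof -
      have "(\<Sum>k\<in>low N. fejer_mult N k * c k) = (\<Sum>k\<in>low M. fejer_mult N k * c k)"
        by (rule sum.mono_neutral_left[OF finite_low]) (use that out in \<open>auto simp: low_def\<close>)
      then show ?thesis
        by (simp add: sum_subtractf[symmetric] sum_distrib_left fejer_defect_def algebra_simps)
    qed
    then show ?thesis unfolding eventually_sequentially by blast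
  qed
  ultimately have "(\<lambda>M. \<Sum>k\<in>low M. fejer_defect N k * c k) \<longlonglongrightarrow> ?L"
    by (rule Lim_transform_eventually)
  moreover have "0 \<le> ?L"
  proof -
    have "(\<Sum>k\<in>low N. fejer_mult N k * (coeff \<phi> k * coeff u k)) \<le> (\<integral>x. \<phi> x * u x \<partial>torus)"
      by (rule fejer_monotone[OF N uL2 \<phi>1 \<phi>2]) (simp add: \<phi>_def mono)
    then show ?thesis by (simp add: \<phi>c)
  qed
  ultimately show ?thesis unfolding c_def by blast
qed

end

section \<open>The weak gradient in Fourier coefficients\<close>

lemma smooth_Ck: "smooth \<psi> \<Longrightarrow> Ck n \<psi>" by (simp add: smooth_def)

lemma smooth_partial:
  fixes \<psi> :: "real^3 \<Rightarrow> real"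
  assumes "smooth \<psi>"
  shows "continuous_on UNIV \<psi>" "continuous_on UNIV (\<lambda>x. grad \<psi> x $ i)"
    "((\<lambda>s. \<psi> (x + axis i s)) has_real_derivative grad \<psi> x $ i) (at 0)"
proof -
  have d: "\<psi> differentiable (at x)" for x using smooth_Ck[OF assms, of 1] by simp
  show "continuous_on UNIV \<psi>" using smooth_Ck[OF assms, of 0] by simp
  show "continuous_on UNIV (\<lambda>x. grad \<psi> x $ i)"
    using smooth_Ck[OF assms, of 1] by (simp add: grad_def Basis_real3)
  have "((\<lambda>s. \<psi> (x + s *\<^sub>R axis i 1)) has_derivative (\<lambda>s. frechet_derivative \<psi> (at x) (s *\<^sub>R axis i 1))) (at 0)"
  proof (rule has_derivative_compose[of "\<lambda>s. x + s *\<^sub>R axis i 1" _ 0 UNIV \<psi>])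
    show "((\<lambda>s. x + s *\<^sub>R axis i 1) has_derivative (\<lambda>s. s *\<^sub>R axis i 1)) (at 0)"
      by (auto intro!: derivative_eq_intros)
    show "(\<psi> has_derivative frechet_derivative \<psi> (at x)) (at (x + 0 *\<^sub>R axis i 1))"
      using d[of x] frechet_derivative_works[of \<psi> "at x"] by simp
  qed
  moreover have "frechet_derivative \<psi> (at x) (s *\<^sub>R axis i 1) = grad \<psi> x $ i * s" for s
    using linear_scale[OF linear_frechet_derivative[OF d[of x]], of s] by (simp add: grad_def)
  moreover have "s *\<^sub>R axis i 1 = (axis i s :: real^3)" for s :: real by (simp add: vec_eq_iff axis_def)
  ultimately show "((\<lambda>s. \<psi> (x + axis i s)) has_real_derivative grad \<psi> x $ i) (at 0)"
    by (simp add: has_field_derivative_def)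
qed

lemma coeff_partial:
  assumes s: "smooth \<psi>" and p: "periodic \<psi>"
  shows "coeff (\<lambda>x. grad \<psi> x $ i) k = - (of_int (k $ i) * coeff \<psi> (- k))"
proof -
  note sp = smooth_partial[OF s]
  let ?F = "\<lambda>x. grad \<psi> x $ i * eigfun k x + of_int (k $ i) * (\<psi> x * eigfun (- k) x)"
  have i1: "integrable torus (\<lambda>x. grad \<psi> x $ i * eigfun k x)" "integrable torus (\<lambda>x. \<psi> x * eigfun (- k) x)"
    by (intro integrable_torus_continuous continuous_intros continuous_eigfun continuous_on_subset[OF sp(2)] continuous_on_subset[OF sp(1)]; simp)+
  have "integral\<^sup>L torus ?F = 0"
  proof (rule integral_torus_partial_0[where G="\<lambda>x. \<psi> x * eigfun k x" and i=i])
    show "continuous_on UNIV ?F" by (intro continuous_intros continuous_eigfun sp)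
    show "\<psi> (x + axis i (2 * pi)) * eigfun k (x + axis i (2 * pi)) = \<psi> x * eigfun k x" for x
      using p by (simp add: eigfun_periodic periodic_def)
    fix x
    have a0: "axis i 0 = (0::real^3)" by (simp add: vec_eq_iff axis_def)
    show "((\<lambda>s. \<psi> (x + axis i s) * eigfun k (x + axis i s)) has_real_derivative ?F x) (at 0)"
      using DERIV_mult[OF sp(3)[of x i] eigfun_partial[of k x i]] by (simp add: a0 mult_ac)
  qed
  then show ?thesis using i1 by (simp add: coeff_def L2_inner_def)
qed

lemma bij_uminus_vec: "bij_betw (uminus :: int^3 \<Rightarrow> int^3) UNIV UNIV"
  by (rule bij_betwI[where g=uminus]) auto

lemma Hs1_iff: "Hs 1 u \<longleftrightarrow> L2_torus u \<and> (\<lambda>k. (1 + eigval k) * (coeff u k)\<^sup>2) summable_on UNIV"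
  by (simp add: Hs_def)

lemma of_int_sq_le_eigval: "(of_int (k $ i))\<^sup>2 \<le> eigval k"
  unfolding eigval_eq by (rule member_le_sum) auto

text \<open>
  The components of the gradient are built from their Fourier coefficients by the Riesz--Fischer theorem;
  Parseval and integration by parts identify them.
\<close>

theorem weak_grad_exists:
  assumes "Hs 1 u"
  shows "is_weak_grad u (weak_grad u)"
proof -
  have u: "L2_torus u" and s: "(\<lambda>k. (1 + eigval k) * (coeff u k)\<^sup>2) summable_on UNIV"
    using assms by (auto simp: Hs1_iff)
  have "\<exists>g. L2_torus g \<and> (\<forall>k. coeff g (- k) = of_int (k $ i) * coeff u k)" for i
  proof -
    let ?a = "\<lambda>k. of_int ((- k) $ i) * coeff u (- k)"
    have "(\<lambda>k. (of_int (k $ i) * coeff u k)\<^sup>2) summable_on UNIV"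
    proof (rule summable_on_comparison_test[OF s])
      fix k
      show "(of_int (k $ i) * coeff u k)\<^sup>2 \<le> (1 + eigval k) * (coeff u k)\<^sup>2"
        unfolding power_mult_distrib using of_int_sq_le_eigval[of k i] by (intro mult_right_mono) auto
    qed auto
    then have "(\<lambda>k. (?a k)\<^sup>2) summable_on UNIV"
      using summable_on_reindex_bij_betw[OF bij_uminus_vec, of "\<lambda>k. (of_int (k $ i) * coeff u k)\<^sup>2"] by simp
    then obtain g where "L2_torus g" "\<And>k. coeff g k = ?a k" "L2_inner g g \<le> (\<Sum>\<^sub>\<infinity>k. (?a k)\<^sup>2)"
      by (rule riesz_fischer[of ?a]) blast
    then show ?thesis by (intro exI[of _ g]) simp
  qed
  then obtain g where g: "\<And>i. L2_torus (g i)" "\<And>i k. coeff (g i) (- k) = of_int (k $ i) * coeff u k" by metis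
  define G :: "real^3 \<Rightarrow> real^3" where "G x = (\<chi> i. g i x)" for x
  have "is_weak_grad u G"
    unfolding is_weak_grad_def
  proof (intro conjI allI impI)
    show "L2_torus (\<lambda>x. G x $ i)" for i using g(1)[of i] by (simp add: G_def)
    fix \<psi> :: "real^3 \<Rightarrow> real" and i assume p: "smooth \<psi> \<and> periodic \<psi>"
    then have sm: "smooth \<psi>" by simp
    note sp = smooth_partial[OF sm]
    have d: "L2_torus (\<lambda>x. grad \<psi> x $ i)" and \<psi>: "L2_torus \<psi>"
      by (intro L2_torus_continuous continuous_on_subset[OF sp(2)] continuous_on_subset[OF sp(1)]; simp)+
    have 1: "((\<lambda>k. coeff u k * coeff (\<lambda>x. grad \<psi> x $ i) k) has_sum L2_inner u (\<lambda>x. grad \<psi> x $ i)) UNIV"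
      by (rule parseval_inner[OF u d])
    have "((\<lambda>k. coeff (g i) k * coeff \<psi> k) has_sum L2_inner (g i) \<psi>) UNIV"
      by (rule parseval_inner[OF g(1) \<psi>])
    then have "((\<lambda>k. coeff (g i) (- k) * coeff \<psi> (- k)) has_sum L2_inner (g i) \<psi>) UNIV"
      using has_sum_reindex_bij_betw[OF bij_uminus_vec, of "\<lambda>k. coeff (g i) k * coeff \<psi> k"] by simp
    then have "((\<lambda>k. - (coeff (g i) (- k) * coeff \<psi> (- k))) has_sum - L2_inner (g i) \<psi>) UNIV"
      by (rule has_sum_uminusI)
    moreover have "- (coeff (g i) (- k) * coeff \<psi> (- k)) = coeff u k * coeff (\<lambda>x. grad \<psi> x $ i) k" for k
      using p by (simp add: g(2) coeff_partial)
    ultimately have "L2_inner u (\<lambda>x. grad \<psi> x $ i) = - L2_inner (g i) \<psi>"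
      using has_sum_unique[OF 1] by simp
    then show "L2_inner u (\<lambda>x. grad \<psi> x $ i) = - L2_inner (\<lambda>x. G x $ i) \<psi>" by (simp add: G_def)
  qed
  then show ?thesis unfolding weak_grad_def by (rule someI[of "is_weak_grad u" G])
qed

section \<open>Test functions with a single spatial mode\<close>

text \<open>
  Differentiability of a fixed order, in a form that passes to products by induction.
\<close>

primrec smooth1 :: "nat \<Rightarrow> (real \<Rightarrow> real) \<Rightarrow> bool" where
  "smooth1 0 \<eta> \<longleftrightarrow> continuous_on UNIV \<eta>"
| "smooth1 (Suc n) \<eta> \<longleftrightarrow> (\<exists>\<eta>'. (\<forall>t. (\<eta> has_real_derivative \<eta>' t) (at t)) \<and> smooth1 n \<eta>')"

lemma smooth1_Suc_D: "smooth1 (Suc n) \<eta> \<Longrightarrow> smooth1 n \<eta>"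
proof (induction n arbitrary: \<eta>)
  case 0
  then have "isCont \<eta> t" for t using DERIV_isCont by auto
  then show ?case by (simp add: continuous_at_imp_continuous_on)
next
  case (Suc n)
  then obtain \<eta>' where "\<forall>t. (\<eta> has_real_derivative \<eta>' t) (at t)" "smooth1 (Suc n) \<eta>'" by auto
  with Suc.IH[of \<eta>'] show ?case by auto
qed

lemma smooth1_const: "smooth1 n (\<lambda>t. c)"
  by (induction n arbitrary: c) (auto intro!: exI[of _ "\<lambda>t. 0"] derivative_eq_intros)

lemma smooth1_add: "smooth1 n f \<Longrightarrow> smooth1 n g \<Longrightarrow> smooth1 n (\<lambda>t. f t + g t)"
proof (induction n arbitrary: f g)
  case (Suc n)
  then obtain f' g' where "\<forall>t. (f has_real_derivative f' t) (at t)" "smooth1 n f'"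
    "\<forall>t. (g has_real_derivative g' t) (at t)" "smooth1 n g'" by auto
  with Suc.IH show ?case by (auto intro!: exI[of _ "\<lambda>t. f' t + g' t"] derivative_eq_intros)
qed (auto intro: continuous_intros)

lemma smooth1_mult: "smooth1 n f \<Longrightarrow> smooth1 n g \<Longrightarrow> smooth1 n (\<lambda>t. f t * g t)"
proof (induction n arbitrary: f g)
  case (Suc n)
  then obtain f' g' where d: "\<forall>t. (f has_real_derivative f' t) (at t)" "smooth1 n f'"
    "\<forall>t. (g has_real_derivative g' t) (at t)" "smooth1 n g'" by auto
  have "smooth1 n (\<lambda>t. f' t * g t + f t * g' t)"
    by (intro smooth1_add Suc.IH d smooth1_Suc_D[OF Suc.prems(1)] smooth1_Suc_D[OF Suc.prems(2)])
  moreover have "((\<lambda>t. f t * g t) has_real_derivative f' t * g t + f t * g' t) (at t)" for t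
    using DERIV_mult[of f "f' t" t UNIV g "g' t"] d by (simp add: mult.commute)
  ultimately show ?case by (auto intro!: exI[of _ "\<lambda>t. f' t * g t + f t * g' t"])
qed (auto intro: continuous_intros)

lemma smooth1_affine: "smooth1 n f \<Longrightarrow> smooth1 n (\<lambda>t. f (m * t + c))"
proof (induction n arbitrary: f)
  case 0
  then show ?case by (auto intro!: continuous_on_compose2[where g=f and t=UNIV] continuous_intros)
next
  case (Suc n)
  then obtain f' where d: "\<forall>t. (f has_real_derivative f' t) (at t)" "smooth1 n f'" by auto
  have "((\<lambda>t. f (m * t + c)) has_real_derivative f' (m * t + c) * m) (at t)" for t
    by (rule DERIV_chain2[of f]) (use d in \<open>auto intro!: derivative_eq_intros\<close>)
  moreover have "smooth1 n (\<lambda>t. f' (m * t + c) * m)"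
    by (intro smooth1_mult smooth1_const Suc.IH d)
  ultimately show ?case by (auto intro!: exI[of _ "\<lambda>t. f' (m * t + c) * m"])
qed

text \<open>
  Functions that vanish to infinite order at 0; this family is closed under differentiation.
\<close>

definition flat :: "real poly \<Rightarrow> real \<Rightarrow> real" where
  "flat p t = (if t > 0 then poly p (1 / t) * exp (- 1 / t) else 0)"

lemma poly_exp_decay: "((\<lambda>x::real. poly p x * exp (- x)) \<longlongrightarrow> 0) at_top"
proof -
  have "((\<lambda>x::real. \<Sum>i\<le>degree p. poly.coeff p i * (x ^ i / exp x)) \<longlongrightarrow> (\<Sum>i\<le>degree p. poly.coeff p i * 0)) at_top"
    by (intro tendsto_intros tendsto_power_div_exp_0)
  then show ?thesis
    by (simp add: poly_altdef sum_distrib_right exp_minus divide_inverse mult.assoc)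
qed

lemma flat_deriv:
  "(flat p has_real_derivative flat ([:0,0,1:] * (p - pderiv p)) t) (at t)"
proof (cases t "0::real" rule: linorder_cases)
  case less
  have "((\<lambda>t. 0) has_real_derivative 0) (at t)" by simp
  moreover have "\<forall>\<^sub>F s in nhds t. flat p s = 0"
    using eventually_nhds_in_open[of "{..<0}" t] less by (auto elim!: eventually_mono simp: flat_def)
  ultimately have "(flat p has_real_derivative 0) (at t)"
    using DERIV_cong_ev[of t t "flat p" "\<lambda>_. 0" 0 0] by simp
  then show ?thesis using less by (simp add: flat_def)
next
  case greater
  let ?D = "(poly (pderiv p) (1 / t) * (- 1 / t^2)) * exp (- 1 / t) + poly p (1 / t) * (exp (- 1 / t) * (1 / t^2))"
  have "((\<lambda>t. poly p (1 / t) * exp (- 1 / t)) has_real_derivative ?D) (at t)"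
  proof -
    have i: "((\<lambda>t. 1 / t) has_real_derivative (- 1 / t^2)) (at t)"
      using greater by (auto intro!: derivative_eq_intros simp: power2_eq_square)
    have i': "((\<lambda>t. - 1 / t) has_real_derivative (1 / t^2)) (at t)"
      using greater by (auto intro!: derivative_eq_intros simp: power2_eq_square)
    have 1: "((\<lambda>t. poly p (1 / t)) has_real_derivative poly (pderiv p) (1 / t) * (- 1 / t^2)) (at t)"
      by (rule DERIV_chain2[OF poly_DERIV i])
    have 2: "((\<lambda>t. exp (- 1 / t)) has_real_derivative exp (- 1 / t) * (1 / t^2)) (at t)"
      by (rule DERIV_chain2[OF DERIV_exp i'])
    show ?thesis using DERIV_mult[OF 1 2] by (simp add: add.commute mult.commute)
  qed
  moreover have "\<forall>\<^sub>F s in nhds t. flat p s = poly p (1 / s) * exp (- 1 / s)"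
    using eventually_nhds_in_open[of "{0<..}" t] greater by (auto elim!: eventually_mono simp: flat_def)
  ultimately have "(flat p has_real_derivative ?D) (at t)"
    using DERIV_cong_ev[of t t "flat p" "\<lambda>s. poly p (1 / s) * exp (- 1 / s)" ?D ?D] by simp
  moreover have "?D = flat ([:0,0,1:] * (p - pderiv p)) t"
    using greater by (simp add: flat_def power2_eq_square algebra_simps)
  ultimately show ?thesis by simp
next
  case equal
  have "((\<lambda>h. flat p h / h) \<longlongrightarrow> 0) (at 0)"
    unfolding filterlim_at_split
  proof
    show "((\<lambda>h. flat p h / h) \<longlongrightarrow> 0) (at_left 0)"
      by (rule tendsto_eventually) (auto simp: flat_def eventually_at_left_field intro!: exI[of _ "-1"])
    have "((\<lambda>h::real. poly ([:0,1:] * p) (inverse h) * exp (- inverse h)) \<longlongrightarrow> 0) (at_right 0)"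
      by (rule filterlim_compose[OF poly_exp_decay filterlim_inverse_at_top_right])
    then show "((\<lambda>h. flat p h / h) \<longlongrightarrow> 0) (at_right 0)"
      by (rule Lim_transform_eventually)
        (auto simp: eventually_at_right_field flat_def divide_inverse intro!: exI[of _ 1])
  qed
  then show ?thesis using equal by (simp add: DERIV_def flat_def)
qed

lemma flat_smooth1: "smooth1 n (flat p)"
proof (induction n arbitrary: p)
  case 0
  then show ?case by (auto intro!: continuous_at_imp_continuous_on DERIV_isCont flat_deriv)
next
  case (Suc n)
  then show ?case using flat_deriv by auto
qed

text \<open>
  A smooth transition from 0 to 1, together with its derivative, a bump of mass 1.
\<close>

lemma smooth_step:
  obtains B \<beta> :: "real \<Rightarrow> real" where "\<And>n. smooth1 n B" "\<And>t. (B has_real_derivative \<beta> t) (at t)"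
    "continuous_on UNIV \<beta>" "\<And>t. 0 \<le> \<beta> t" "\<And>t. t \<le> 0 \<Longrightarrow> B t = 0" "\<And>t. 1 \<le> t \<Longrightarrow> B t = 1" 
    "\<And>t. t \<notin> {0..1} \<Longrightarrow> \<beta> t = 0" "\<And>t. \<bar>B t\<bar> \<le> 1"
proof -
  define b where "b t = flat 1 t * flat 1 (-1 * t + 1)" for t
  have sm: "smooth1 n b" for n unfolding b_def by (intro smooth1_mult smooth1_affine flat_smooth1)
  have cont: "continuous_on UNIV b" using sm[of 0] by simp
  have nn: "0 \<le> b t" for t by (simp add: b_def flat_def)
  have pos: "0 < b t" if "0 < t" "t < 1" for t using that by (simp add: b_def flat_def)
  have z: "b t = 0" if "t \<le> 0 \<or> 1 \<le> t" for t using that by (auto simp: b_def flat_def)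
  have "\<exists>F. \<forall>x::real. - \<infinity> < ereal x \<longrightarrow> ereal x < \<infinity> \<longrightarrow> (F has_vector_derivative b x) (at x)"
    by (rule einterval_antiderivative) (use cont in \<open>auto simp: continuous_on_eq_continuous_at\<close>)
  then obtain F where F: "\<And>t. (F has_real_derivative b t) (at t)"
    by (auto simp: has_real_derivative_iff_has_vector_derivative)
  have mono: "s \<le> t \<Longrightarrow> F s \<le> F t" for s t
    by (rule DERIV_nonneg_imp_nondecreasing) (use F nn in auto)
  have lo: "F t = F 0" if "t \<le> 0" for t
  proof (cases "t = 0")
    case False
    then have "t < 0" using that by simp
    then obtain z where "t < z" "z < 0" "F 0 - F t = (0 - t) * b z" using MVT2[of t 0 F b] F by blast
    then show ?thesis using z by simp
  qed simp
  have hi: "F t = F 1" if "1 \<le> t" for t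
  proof (cases "t = 1")
    case False
    then have "1 < t" using that by simp
    then obtain z where "1 < z" "z < t" "F t - F 1 = (t - 1) * b z" using MVT2[of 1 t F b] F by blast
    then show ?thesis using z by simp
  qed simp
  obtain z where "0 < z" "z < 1" "F 1 - F 0 = (1 - 0) * b z" using MVT2[of 0 1 F b] F by auto
  then have c: "0 < F 1 - F 0" using pos by simp
  define c where "c = 1 / (F 1 - F 0)"
  have c0: "0 < c" using c by (simp add: c_def)
  have F_smooth: "smooth1 n F" for n by (rule smooth1_Suc_D) (use F sm in auto)
  show ?thesis
  proof (rule that[of "\<lambda>t. c * (F t + - F 0)" "\<lambda>t. c * b t"])
    show "smooth1 n (\<lambda>t. c * (F t + - F 0))" for n by (intro smooth1_mult smooth1_add smooth1_const F_smooth)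
    show "((\<lambda>t. c * (F t + - F 0)) has_real_derivative c * b t) (at t)" for t
      using F[of t] by (auto intro!: derivative_eq_intros)
    show "\<bar>c * (F t + - F 0)\<bar> \<le> 1" for t
    proof -
      have "F 0 \<le> F t" using mono[of 0 t] lo[of t] by (cases "0 \<le> t") auto
      moreover have "F t \<le> F 1" using mono[of t 1] hi[of t] by (cases "t \<le> 1") auto
      ultimately have "0 \<le> c * (F t + - F 0)" "c * (F t + - F 0) \<le> c * (F 1 - F 0)" using c0 by auto
      moreover have "c * (F 1 - F 0) = 1" using c by (simp add: c_def)
      ultimately show ?thesis by linarith
    qed
    show "c * (F t + - F 0) = 1" if "1 \<le> t" for t using hi[OF that] c by (simp add: c_def)
    show "continuous_on UNIV (\<lambda>t. c * b t)" by (intro continuous_intros cont)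
    show "0 \<le> c * b t" for t using c0 nn[of t] by simp
    show "c * (F t + - F 0) = 0" if "t \<le> 0" for t using lo[OF that] by simp
    show "c * b t = 0" if "t \<notin> {0..1}" for t using z[of t] that by auto
  qed
qed

lemma Ck_wave: "Ck n (\<lambda>x::real^3. a * cos (w \<bullet> x) + b * sin (w \<bullet> x))"
proof (induction n arbitrary: a b)
  case 0
  show ?case by (auto intro!: continuous_intros)
next
  case (Suc n)
  have d: "((\<lambda>x. a * cos (w \<bullet> x) + b * sin (w \<bullet> x)) has_derivative
      (\<lambda>h. (w \<bullet> h) * (b * cos (w \<bullet> x) - a * sin (w \<bullet> x)))) (at x)" for x
    by (auto intro!: derivative_eq_intros simp: algebra_simps)
  have f: "frechet_derivative (\<lambda>x. a * cos (w \<bullet> x) + b * sin (w \<bullet> x)) (at x) =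
      (\<lambda>h. (w \<bullet> h) * (b * cos (w \<bullet> x) - a * sin (w \<bullet> x)))" for x
    using frechet_derivative_at[OF d] by simp
  have e: "(w \<bullet> h) * (b * cos (w \<bullet> x) - a * sin (w \<bullet> x)) = ((w \<bullet> h) * b) * cos (w \<bullet> x) + (- ((w \<bullet> h) * a)) * sin (w \<bullet> x)" for h x
    by (simp add: algebra_simps)
  show ?case
    unfolding Ck.simps f e using d by (intro conjI allI ballI Suc.IH) (auto simp: differentiable_def)
qed

lemma eigfun_wave: "\<exists>a b. eigfun k = (\<lambda>x. a * cos (wave_vector k \<bullet> x) + b * sin (wave_vector k \<bullet> x))"
proof (cases "k = 0")
  case True
  then show ?thesis by (intro exI[of _ "1 / sqrt ((2*pi)^3)"] exI[of _ 0]) (simp add: eigfun_0 fun_eq_iff)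
next
  case False
  show ?thesis
  proof (cases "lex_pos k")
    case True
    then show ?thesis using False
      by (intro exI[of _ "sqrt 2 / sqrt ((2*pi)^3)"] exI[of _ 0]) (simp add: eigfun_def fun_eq_iff)
  next
    case F: False
    then show ?thesis using False
      by (intro exI[of _ 0] exI[of _ "sqrt 2 / sqrt ((2*pi)^3)"]) (simp add: eigfun_def fun_eq_iff)
  qed
qed

lemma smooth_eigfun: "smooth (eigfun k)"
proof -
  obtain a b where "eigfun k = (\<lambda>x. a * cos (wave_vector k \<bullet> x) + b * sin (wave_vector k \<bullet> x))"
    using eigfun_wave by blast
  then show ?thesis by (simp add: smooth_def Ck_wave)
qed

lemma periodic_eigfun: "periodic (eigfun k)"
  by (simp add: periodic_def eigfun_periodic)

lemma grad_eigfun: "grad (eigfun k) x $ i = of_int (k $ i) * eigfun (- k) x"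
  using smooth_partial(3)[OF smooth_eigfun] eigfun_partial by (rule DERIV_unique)

text \<open>
  A partial derivative of such a product is again of this form: a time derivative acts on \<open>\<eta>\<close> only, a
  spatial one exchanges the amplitudes of cosine and sine.
\<close>

lemma Ck_time_wave:
  "smooth1 n \<eta> \<Longrightarrow> Ck n (\<lambda>z :: real \<times> (real^3). \<eta> (fst z) * (a * cos (w \<bullet> snd z) + b * sin (w \<bullet> snd z)))"
proof (induction n arbitrary: \<eta> a b)
  case 0
  then have "continuous_on UNIV (\<lambda>z::real \<times> (real^3). \<eta> (fst z))"
    by (auto intro!: continuous_on_compose2[where g=\<eta> and t=UNIV] continuous_intros)
  then show ?case by (auto intro!: continuous_intros)
next
  case (Suc n)
  then obtain \<eta>' where d1: "\<And>t. (\<eta> has_real_derivative \<eta>' t) (at t)" and s': "smooth1 n \<eta>'" by auto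
  have s: "smooth1 n \<eta>" using Suc.prems by (rule smooth1_Suc_D)
  let ?W = "\<lambda>x. a * cos (w \<bullet> x) + b * sin (w \<bullet> x)"
  let ?f = "\<lambda>z::real \<times> (real^3). \<eta> (fst z) * ?W (snd z)"
  let ?D = "\<lambda>z h. \<eta>' (fst z) * fst h * ?W (snd z) + \<eta> (fst z) * ((w \<bullet> snd h) * (b * cos (w \<bullet> snd z) - a * sin (w \<bullet> snd z)))"
  have d: "(?f has_derivative ?D z) (at z)" for z
  proof -
    have 1: "((\<lambda>z::real \<times> (real^3). \<eta> (fst z)) has_derivative (\<lambda>h. \<eta>' (fst z) * fst h)) (at z)"
    proof (rule has_derivative_compose[of fst fst z UNIV \<eta> "(*) (\<eta>' (fst z))"])
      show "(fst has_derivative fst) (at z)" by (auto intro!: derivative_eq_intros)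
      show "(\<eta> has_derivative (*) (\<eta>' (fst z))) (at (fst z))" using d1 by (simp add: has_field_derivative_def)
    qed
    have 2: "((\<lambda>z::real \<times> (real^3). ?W (snd z)) has_derivative (\<lambda>h. (w \<bullet> snd h) * (b * cos (w \<bullet> snd z) - a * sin (w \<bullet> snd z)))) (at z)"
      by (auto intro!: derivative_eq_intros simp: algebra_simps)
    show ?thesis using has_derivative_mult[OF 1 2] by (simp add: add.commute)
  qed
  have f: "frechet_derivative ?f (at z) = ?D z" for z
    using frechet_derivative_at[OF d] by simp
  have "Ck n (\<lambda>z. ?D z h)" if h: "h \<in> Basis" for h :: "real \<times> (real^3)"
  proof -
    from h consider "h = (1, 0)" | v where "h = (0, v)" by (auto simp: Basis_prod_def)
    then show ?thesis
    proof cases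
      case 1
      then show ?thesis using Suc.IH[OF s', of a b] by simp
    next
      case 2
      have "Ck n (\<lambda>z. \<eta> (fst z) * (((w \<bullet> v) * b) * cos (w \<bullet> snd z) + (- ((w \<bullet> v) * a)) * sin (w \<bullet> snd z)))"
        by (rule Suc.IH[OF s])
      moreover have "\<eta> (fst z) * (((w \<bullet> v) * b) * cos (w \<bullet> snd z) + (- ((w \<bullet> v) * a)) * sin (w \<bullet> snd z)) = ?D z h" for z
        using 2 by (simp add: algebra_simps)
      ultimately show ?thesis by simp
    qed
  qed
  moreover have "?f differentiable (at z)" for z using d unfolding differentiable_def by blast
  ultimately show ?case unfolding Ck.simps f by blast
qed

lemma test_function_eigfun:
  assumes s: "\<And>n. smooth1 n \<eta>" and supp: "0 < a" "b < T" "\<And>t. t \<notin> {a..b} \<Longrightarrow> \<eta> t = 0"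
  shows "test_function T (\<lambda>t x. \<eta> t * eigfun k x)"
proof -
  obtain A B where e: "eigfun k = (\<lambda>x. A * cos (wave_vector k \<bullet> x) + B * sin (wave_vector k \<bullet> x))"
    using eigfun_wave by blast
  have "smooth (\<lambda>(t, x). \<eta> t * eigfun k x)"
    unfolding smooth_def e case_prod_unfold using Ck_time_wave[OF s] by blast
  then show ?thesis
    unfolding test_function_def using supp by (auto simp: periodic_def eigfun_periodic)
qed

lemma frac_laplacian_eigfun: "frac_laplacian (1/2) (\<lambda>x. c * eigfun k x) = (\<lambda>x. c * (sqrt (eigval k) * eigfun k x))"
proof
  fix x
  have c: "coeff (\<lambda>x. c * eigfun k x) j = (if j = k then c else 0)" for j
    by (simp add: coeff_def L2_inner_cmult_left eigfun_orthonormal)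
  have "((\<lambda>j. eigval j powr (1/2) * coeff (\<lambda>x. c * eigfun k x) j * eigfun j x) has_sum
     (\<Sum>j\<in>{k}. eigval j powr (1/2) * coeff (\<lambda>x. c * eigfun k x) j * eigfun j x)) UNIV"
    by (rule has_sum_finite_neutralI[of "{k}"]) (auto simp: c)
  then show "frac_laplacian (1/2) (\<lambda>x. c * eigfun k x) x = c * (sqrt (eigval k) * eigfun k x)"
    unfolding frac_laplacian_def by (subst infsumI) (auto simp: c powr_half_sqrt mult_ac)
qed

lemma weak_grad_eigfun:
  assumes "Hs 1 u"
  shows "(\<integral>x. weak_grad u x \<bullet> grad (\<lambda>x. c * eigfun k x) x \<partial>torus) = c * (eigval k * coeff u k)"
proof -
  let ?G = "weak_grad u"
  have G: "\<And>i. L2_torus (\<lambda>x. ?G x $ i)"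
     "\<And>\<psi> i. smooth \<psi> \<Longrightarrow> periodic \<psi> \<Longrightarrow> L2_inner u (\<lambda>x. grad \<psi> x $ i) = - L2_inner (\<lambda>x. ?G x $ i) \<psi>"
    using weak_grad_exists[OF assms] unfolding is_weak_grad_def by blast+
  have g: "grad (\<lambda>x. c * eigfun k x) x $ i = c * (of_int (k $ i) * eigfun (- k) x)" for x i
  proof -
    have "((\<lambda>h. c * eigfun k h) has_derivative (\<lambda>h. c * frechet_derivative (eigfun k) (at x) h)) (at x)"
    proof (rule has_derivative_mult_right)
      have "eigfun k differentiable (at x)" using smooth_Ck[OF smooth_eigfun[of k], of 1] by simp
      then show "(eigfun k has_derivative frechet_derivative (eigfun k) (at x)) (at x)"
        using frechet_derivative_works[of "eigfun k" "at x"] by simp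
    qed
    then have "frechet_derivative (\<lambda>x. c * eigfun k x) (at x) = (\<lambda>h. c * frechet_derivative (eigfun k) (at x) h)"
      using frechet_derivative_at by metis
    then show ?thesis using grad_eigfun[of k x i] by (simp add: grad_def)
  qed
  have "(\<integral>x. ?G x \<bullet> grad (\<lambda>x. c * eigfun k x) x \<partial>torus) = (\<integral>x. (\<Sum>i\<in>UNIV. c * of_int (k $ i) * (?G x $ i * eigfun (- k) x)) \<partial>torus)"
    by (simp add: inner_vec_def g mult_ac)
  also have "\<dots> = (\<Sum>i\<in>UNIV. c * of_int (k $ i) * L2_inner (\<lambda>x. ?G x $ i) (eigfun (- k)))"
    by (subst Bochner_Integration.integral_sum)
      (auto intro!: integrable_mult_right L2_torus_mult G(1) L2_eigfun simp: L2_inner_def)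
  also have "\<dots> = (\<Sum>i\<in>UNIV. c * of_int (k $ i) * (of_int (k $ i) * coeff u k))"
  proof (rule sum.cong[OF refl])
    fix i
    have "L2_inner u (\<lambda>x. grad (eigfun (- k)) x $ i) = - L2_inner (\<lambda>x. ?G x $ i) (eigfun (- k))"
      by (rule G(2)[OF smooth_eigfun periodic_eigfun])
    moreover have "L2_inner u (\<lambda>x. grad (eigfun (- k)) x $ i) = - (of_int (k $ i) * coeff u k)"
      using L2_inner_cmult_right[of u "- of_int (k $ i)" "eigfun k"] by (simp add: grad_eigfun coeff_def)
    ultimately show "c * of_int (k $ i) * L2_inner (\<lambda>x. ?G x $ i) (eigfun (- k)) = c * of_int (k $ i) * (of_int (k $ i) * coeff u k)"
      by simp
  qed
  also have "\<dots> = c * (eigval k * coeff u k)"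
    by (simp add: eigval_eq sum_distrib_left sum_distrib_right power2_eq_square mult_ac)
  finally show ?thesis .
qed

section \<open>Weak and integrated ordinary differential equations\<close>

text \<open>
  The increments of \<open>X Y\<close> and of the integral on the right differ by a quantity of second order in the
  length of the interval, so the difference has derivative 0.
\<close>

lemma lipschitz_product_rule:
  fixes X Y x y :: "real \<Rightarrow> real"
  assumes ab: "a \<le> b"
    and xi: "x integrable_on {a..b}" and yi: "y integrable_on {a..b}"
    and zi: "(\<lambda>t. x t * Y t + X t * y t) integrable_on {a..b}"
    and bd: "\<And>t. t \<in> {a..b} \<Longrightarrow> \<bar>x t\<bar> \<le> M" "\<And>t. t \<in> {a..b} \<Longrightarrow> \<bar>y t\<bar> \<le> M"
    and X: "\<And>t. t \<in> {a..b} \<Longrightarrow> X t - X a = integral {a..t} x"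
    and Y: "\<And>t. t \<in> {a..b} \<Longrightarrow> Y t - Y a = integral {a..t} y"
  shows "X b * Y b - X a * Y a = integral {a..b} (\<lambda>t. x t * Y t + X t * y t)"
proof -
  let ?z = "\<lambda>t. x t * Y t + X t * y t"
  have M0: "0 \<le> M" using bd(1)[of a] ab by simp
  have sub: "g integrable_on {s..t}" if "g integrable_on {a..b}" "s \<in> {a..b}" "t \<in> {a..b}" for g :: "real \<Rightarrow> real" and s t
    by (rule integrable_on_subinterval[OF that(1)]) (use that in auto)
  have incr: "G t - G s = integral {s..t} g"
    if g: "g integrable_on {a..b}" and st: "s \<in> {a..b}" "t \<in> {a..b}" "s \<le> t"
      and G: "\<And>t. t \<in> {a..b} \<Longrightarrow> G t - G a = integral {a..t} g" for G g :: "real \<Rightarrow> real" and s t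
  proof -
    have "integral {a..s} g + integral {s..t} g = integral {a..t} g"
      by (rule Henstock_Kurzweil_Integration.integral_combine) (use st sub[OF g, of a t] in auto)
    then show ?thesis using G[OF st(1)] G[OF st(2)] by simp
  qed
  have lip: "\<bar>G t - G s\<bar> \<le> M * (t - s)"
    if g: "g integrable_on {a..b}" and st: "s \<in> {a..b}" "t \<in> {a..b}" "s \<le> t"
      and b: "\<And>t. t \<in> {a..b} \<Longrightarrow> \<bar>g t\<bar> \<le> M"
      and G: "\<And>t. t \<in> {a..b} \<Longrightarrow> G t - G a = integral {a..t} g" for G g :: "real \<Rightarrow> real" and s t
  proof -
    have "(g has_integral (G t - G s)) {s..t}"
      using incr[OF g st G] sub[OF g st(1,2)] by (simp add: has_integral_integral)
    from has_integral_bound_real[OF M0 finite.emptyI this] st b show ?thesis by (auto simp: real_norm_def)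
  qed
  define \<Phi> where "\<Phi> t = X t * Y t - integral {a..t} ?z" for t
  have quad: "\<bar>\<Phi> t - \<Phi> s\<bar> \<le> 2 * M\<^sup>2 * (t - s)\<^sup>2" if st: "s \<in> {a..b}" "t \<in> {a..b}" "s \<le> t" for s t
  proof -
    have z: "integral {a..t} ?z = integral {a..s} ?z + integral {s..t} ?z"
      using Henstock_Kurzweil_Integration.integral_combine[of a s t ?z] st sub[OF zi, of a t] by auto
    have hx: "((\<lambda>r. x r * Y t) has_integral (X t - X s) * Y t) {s..t}"
      using incr[OF xi st X] sub[OF xi st(1,2)] by (intro has_integral_mult_left) (simp add: has_integral_integral)
    have hy: "((\<lambda>r. X s * y r) has_integral X s * (Y t - Y s)) {s..t}"
      using incr[OF yi st Y] sub[OF yi st(1,2)] by (intro has_integral_mult_right) (simp add: has_integral_integral)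
    have hz: "(?z has_integral integral {s..t} ?z) {s..t}" using sub[OF zi st(1,2)] by (simp add: has_integral_integral)
    have "((\<lambda>r. (x r * Y t + X s * y r) - ?z r) has_integral ((X t - X s) * Y t + X s * (Y t - Y s)) - integral {s..t} ?z) {s..t}"
      by (intro has_integral_diff has_integral_add hx hy hz)
    then have "norm (((X t - X s) * Y t + X s * (Y t - Y s)) - integral {s..t} ?z) \<le> (2 * M\<^sup>2 * (t - s)) * (t - s)"
    proof (rule has_integral_bound_real[where S="{}" and B="2 * M\<^sup>2 * (t - s)", rotated 2, THEN order_trans])
      show "0 \<le> 2 * M\<^sup>2 * (t - s)" using st by simp
      fix r assume "r \<in> {s..t} - {}"
      then have r: "r \<in> {s..t}" by simp
      then have rab: "r \<in> {a..b}" using st by auto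
      have "norm ((x r * Y t + X s * y r) - ?z r) = \<bar>x r * (Y t - Y r) + (X s - X r) * y r\<bar>"
        by (simp add: algebra_simps)
      also have "\<dots> \<le> \<bar>x r\<bar> * \<bar>Y t - Y r\<bar> + \<bar>X s - X r\<bar> * \<bar>y r\<bar>"
        by (rule order_trans[OF abs_triangle_ineq]) (simp add: abs_mult)
      also have "\<dots> \<le> M * (M * (t - r)) + (M * (r - s)) * M"
      proof (intro add_mono mult_mono)
        show "\<bar>Y t - Y r\<bar> \<le> M * (t - r)" by (rule lip[OF yi rab st(2) _ bd(2) Y]) (use r in auto)
        show "\<bar>X s - X r\<bar> \<le> M * (r - s)"
          using lip[OF xi st(1) rab _ bd(1) X] r by (simp add: abs_minus_commute)
      qed (use bd[OF rab] M0 r in auto)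
      also have "\<dots> = M\<^sup>2 * (t - s)" by (simp add: power2_eq_square algebra_simps)
      also have "\<dots> \<le> 2 * M\<^sup>2 * (t - s)" using st by (simp add: mult_right_mono)
      finally show "norm ((x r * Y t + X s * y r) - ?z r) \<le> 2 * M\<^sup>2 * (t - s)" .
    qed (use st in auto)
    moreover have "\<Phi> t - \<Phi> s = ((X t - X s) * Y t + X s * (Y t - Y s)) - integral {s..t} ?z"
      unfolding \<Phi>_def z by (simp add: algebra_simps)
    ultimately show ?thesis by (simp add: power2_eq_square mult.assoc)
  qed
  have "\<exists>c. \<forall>t\<in>{a..b}. \<Phi> t = c"
  proof (rule has_field_derivative_zero_constant)
    fix t assume t: "t \<in> {a..b}"
    show "(\<Phi> has_real_derivative 0) (at t within {a..b})"
      unfolding has_field_derivative_iff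
    proof (rule Lim_null_comparison)
      show "((\<lambda>s. 2 * M\<^sup>2 * \<bar>s - t\<bar>) \<longlongrightarrow> 0) (at t within {a..b})"
        by (auto intro!: tendsto_eq_intros)
      show "\<forall>\<^sub>F s in at t within {a..b}. norm ((\<Phi> s - \<Phi> t) / (s - t)) \<le> 2 * M\<^sup>2 * \<bar>s - t\<bar>"
        unfolding eventually_at_filter
      proof (rule always_eventually, intro allI impI)
        fix s assume s: "s \<noteq> t" "s \<in> {a..b}"
        have "\<bar>\<Phi> s - \<Phi> t\<bar> \<le> 2 * M\<^sup>2 * (s - t)\<^sup>2"
          using quad[OF t s(2)] quad[OF s(2) t] by (cases "t \<le> s") (auto simp: abs_minus_commute power2_commute)
        also have "\<dots> = (2 * M\<^sup>2 * \<bar>s - t\<bar>) * \<bar>s - t\<bar>" by (simp add: power2_eq_square)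
        finally show "norm ((\<Phi> s - \<Phi> t) / (s - t)) \<le> 2 * M\<^sup>2 * \<bar>s - t\<bar>"
          using s by (simp add: divide_le_eq)
      qed
    qed
  qed simp
  then have "\<Phi> b = \<Phi> a" using ab by auto
  then show ?thesis by (simp add: \<Phi>_def)
qed

lemma interval_integrable_continuous:
  fixes g :: "real \<Rightarrow> real"
  assumes "continuous_on {a..b} g"
  shows "integrable (lebesgue_on {a<..<b}) g" "(\<integral>t. g t \<partial>lebesgue_on {a<..<b}) = integral {a..b} g"
proof -
  have "g absolutely_integrable_on {a..b}" by (rule absolutely_integrable_continuous_real[OF assms])
  then have "set_integrable lebesgue {a<..<b} g"
    by (rule set_integrable_subset) auto
  then show i: "integrable (lebesgue_on {a<..<b}) g"
    by (simp add: integrable_restrict_space set_integrable_def)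
  have "(\<integral>t. g t \<partial>lebesgue_on {a<..<b}) = integral {a<..<b} g"
    by (rule lebesgue_integral_eq_integral[OF i]) simp
  then show "(\<integral>t. g t \<partial>lebesgue_on {a<..<b}) = integral {a..b} g"
    by (simp add: integral_open_interval_real)
qed

text \<open>
  Test with smooth approximations of the indicator of the interval from \<open>a\<close> to \<open>b\<close>: the derivative of the
  test function concentrates at the two endpoints. The transitions take place on
  \<open>[a + \<epsilon>, a + 2 \<epsilon>]\<close> and \<open>[b + \<epsilon>, b + 2 \<epsilon>]\<close>, to the right of the endpoints, so that \<open>a = 0\<close> is admissible.
\<close>

lemma weak_ode:
  fixes W h :: "real \<Rightarrow> real"
  assumes W: "continuous_on {0..T} W" and h: "integrable (lebesgue_on {0<..<T}) h"
    and weak: "\<And>\<eta> \<eta>' a b. (\<And>n. smooth1 n \<eta>) \<Longrightarrow> (\<And>t. (\<eta> has_real_derivative \<eta>' t) (at t)) \<Longrightarrow>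
       continuous_on UNIV \<eta>' \<Longrightarrow> 0 < a \<Longrightarrow> b < T \<Longrightarrow> (\<And>t. t \<notin> {a..b} \<Longrightarrow> \<eta> t = 0) \<Longrightarrow>
       (\<integral>t. W t * \<eta>' t \<partial>lebesgue_on {0<..<T}) = - (\<integral>t. h t * \<eta> t \<partial>lebesgue_on {0<..<T})"
    and ab: "0 \<le> a" "a < b" "b < T"
  shows "W b - W a = integral {a..b} h"
proof -
  let ?I = "lebesgue_on {0<..<T}"
  obtain B \<beta> where B: "\<And>n. smooth1 n B" "\<And>t. (B has_real_derivative \<beta> t) (at t)"
    "continuous_on UNIV \<beta>" "\<And>t. 0 \<le> \<beta> t" "\<And>t. t \<le> 0 \<Longrightarrow> B t = 0" "\<And>t. 1 \<le> t \<Longrightarrow> B t = 1" 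
    "\<And>t. t \<notin> {0..1} \<Longrightarrow> \<beta> t = 0" "\<And>t. \<bar>B t\<bar> \<le> 1" by (rule smooth_step) blast
  define L where "L c \<epsilon> t = (1 / \<epsilon>) * t + (- c / \<epsilon> - 1)" for c \<epsilon> t :: real
  have L: "L c \<epsilon> t = (t - (c + \<epsilon>)) / \<epsilon>" if "0 < \<epsilon>" for c \<epsilon> t using that by (simp add: L_def field_simps)
  define \<rho> where "\<rho> c \<epsilon> t = \<beta> (L c \<epsilon> t) * (1 / \<epsilon>)" for c \<epsilon> t
  have aff: "continuous_on S (\<lambda>t. m * t + c)" for S and m c :: real by (intro continuous_intros)
  have Lc: "continuous_on S (L c \<epsilon>)" for S c \<epsilon> unfolding L_def by (rule aff)
  have \<rho>c: "continuous_on S (\<rho> c \<epsilon>)" for S c \<epsilon>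
    unfolding \<rho>_def
    by (rule continuous_on_mult[OF continuous_on_compose2[OF B(3) Lc] continuous_on_const]) simp
  have \<rho>0: "0 \<le> \<rho> c \<epsilon> t" if "0 < \<epsilon>" for c \<epsilon> t using that B(4) by (simp add: \<rho>_def)
  have affd: "((\<lambda>t. m * t + c) has_real_derivative m) (at t)" for m c t :: real
    by (auto intro!: derivative_eq_intros)
  have step_d: "((\<lambda>t. B (L c \<epsilon> t)) has_real_derivative \<rho> c \<epsilon> t) (at t)" for c \<epsilon> t
    unfolding \<rho>_def L_def
    by (rule DERIV_chain2[OF B(2) affd])
  have step0: "B (L c \<epsilon> t) = 0" if "0 < \<epsilon>" "t \<le> c + \<epsilon>" for c \<epsilon> t
    using that by (intro B(5)) (simp add: L divide_le_0_iff)
  have step1: "B (L c \<epsilon> t) = 1" if "0 < \<epsilon>" "c + 2 * \<epsilon> \<le> t" for c \<epsilon> t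
    using that by (intro B(6)) (simp add: L le_divide_eq)
  have \<rho>_supp: "\<rho> c \<epsilon> t = 0" if "0 < \<epsilon>" "t < c + \<epsilon> \<or> c + 2 * \<epsilon> < t" for c \<epsilon> t
  proof -
    have "L c \<epsilon> t \<notin> {0..1}" using that by (auto simp: L divide_le_eq le_divide_eq)
    then show ?thesis by (simp add: \<rho>_def B(7))
  qed
  (* small enough that the second transition ends before T *)
  define \<epsilon> where "\<epsilon> n = (T - b) / (real n + 3)" for n :: nat
  have \<epsilon>: "0 < \<epsilon> n" "2 * \<epsilon> n < T - b" for n
  proof -
    have p: "0 < T - b" using ab by simp
    then show "0 < \<epsilon> n" by (simp add: \<epsilon>_def)
    have "(T - b) * 2 < (T - b) * (real n + 3)" by (rule mult_strict_left_mono[OF _ p]) simp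
    then show "2 * \<epsilon> n < T - b" by (simp add: \<epsilon>_def pos_divide_less_eq mult.commute)
  qed
  have \<epsilon>_lim: "\<epsilon> \<longlonglongrightarrow> 0"
  proof -
    have "(\<lambda>n. (T - b) * inverse (real (n + 3))) \<longlonglongrightarrow> (T - b) * 0"
      by (intro tendsto_intros LIMSEQ_ignore_initial_segment[OF lim_inverse_n])
    then show ?thesis by (simp add: \<epsilon>_def[abs_def] divide_inverse add.commute)
  qed
  have mass: "(\<integral>t. \<rho> c (\<epsilon> n) t \<partial>?I) = 1" if c: "0 \<le> c" "c \<le> b" for c n
  proof -
    have "(\<integral>t. \<rho> c (\<epsilon> n) t \<partial>?I) = integral {0..T} (\<rho> c (\<epsilon> n))"
      by (rule interval_integrable_continuous(2)[OF \<rho>c])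
    also have "\<dots> = B (L c (\<epsilon> n) T) - B (L c (\<epsilon> n) 0)"
      by (rule integral_unique, rule fundamental_theorem_of_calculus)
        (use ab in \<open>auto simp flip: has_real_derivative_iff_has_vector_derivative intro: DERIV_subset[OF step_d]\<close>)
    also have "\<dots> = 1"
      using step0[OF \<epsilon>(1)[of n], of 0 c] step1[OF \<epsilon>(1)[of n], of c T] \<epsilon>[of n] c by simp
    finally show ?thesis .
  qed
  have Wint: "integrable ?I (\<lambda>t. W t * \<rho> c \<epsilon>' t)" for c \<epsilon>'
    by (intro interval_integrable_continuous(1) continuous_intros W \<rho>c)
  have delta: "(\<lambda>n. \<integral>t. W t * \<rho> c (\<epsilon> n) t \<partial>?I) \<longlonglongrightarrow> W c" if c: "0 \<le> c" "c \<le> b" for c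
  proof (rule tendstoI)
    fix \<delta> :: real assume \<delta>: "0 < \<delta>"
    have "c \<in> {0..T}" using c ab by auto
    then obtain d where d: "0 < d" "\<And>t. t \<in> {0..T} \<Longrightarrow> dist t c < d \<Longrightarrow> dist (W t) (W c) < \<delta> / 2"
      using W \<delta> unfolding continuous_on_iff by (metis half_gt_zero)
    have "\<forall>\<^sub>F n in sequentially. \<epsilon> n < d / 2"
      by (rule order_tendstoD(2)[OF \<epsilon>_lim]) (use d in simp)
    then show "\<forall>\<^sub>F n in sequentially. dist (\<integral>t. W t * \<rho> c (\<epsilon> n) t \<partial>?I) (W c) < \<delta>"
    proof eventually_elim
      case (elim n)
      have \<rho>i: "integrable ?I (\<rho> c (\<epsilon> n))" by (rule interval_integrable_continuous(1)[OF \<rho>c])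
      have "(\<integral>t. W t * \<rho> c (\<epsilon> n) t \<partial>?I) - W c = (\<integral>t. W t * \<rho> c (\<epsilon> n) t - W c * \<rho> c (\<epsilon> n) t \<partial>?I)"
        using mass[OF c, of n] Wint \<rho>i by simp
      also have "\<bar>\<dots>\<bar> \<le> (\<integral>t. \<bar>W t * \<rho> c (\<epsilon> n) t - W c * \<rho> c (\<epsilon> n) t\<bar> \<partial>?I)" by (rule integral_abs_bound)
      also have "\<dots> \<le> (\<integral>t. \<delta> / 2 * \<rho> c (\<epsilon> n) t \<partial>?I)"
      proof (rule integral_mono)
        show "integrable ?I (\<lambda>t. \<bar>W t * \<rho> c (\<epsilon> n) t - W c * \<rho> c (\<epsilon> n) t\<bar>)" using Wint \<rho>i by simp
        show "integrable ?I (\<lambda>t. \<delta> / 2 * \<rho> c (\<epsilon> n) t)" using \<rho>i by simp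
        fix t assume "t \<in> space ?I"
        then have t: "t \<in> {0..T}" by auto
        show "\<bar>W t * \<rho> c (\<epsilon> n) t - W c * \<rho> c (\<epsilon> n) t\<bar> \<le> \<delta> / 2 * \<rho> c (\<epsilon> n) t"
        proof (cases "\<rho> c (\<epsilon> n) t = 0")
          case False
          then have "c + \<epsilon> n \<le> t \<and> t \<le> c + 2 * \<epsilon> n" using \<rho>_supp[OF \<epsilon>(1)] by (meson not_less)
          then have "dist t c < d" using elim \<epsilon>(1)[of n] by (simp add: dist_real_def)
          then have "\<bar>W t - W c\<bar> \<le> \<delta> / 2" using d(2)[OF t] by (simp add: dist_real_def)
          then have "\<bar>W t - W c\<bar> * \<rho> c (\<epsilon> n) t \<le> \<delta> / 2 * \<rho> c (\<epsilon> n) t"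
            by (rule mult_right_mono[OF _ \<rho>0[OF \<epsilon>(1)]])
          then show ?thesis using \<rho>0[OF \<epsilon>(1), of c n t]
            by (simp add: abs_mult[symmetric] left_diff_distrib[symmetric] abs_mult)
        qed simp
      qed
      also have "\<dots> = \<delta> / 2" using mass[OF c, of n] by simp
      finally show ?case using \<delta> by (simp add: dist_real_def)
    qed
  qed
  define \<eta> where "\<eta> n t = B (L a (\<epsilon> n) t) + (- 1) * B (L b (\<epsilon> n) t)" for n t
  have wk: "(\<integral>t. W t * \<rho> a (\<epsilon> n) t \<partial>?I) - (\<integral>t. W t * \<rho> b (\<epsilon> n) t \<partial>?I) = - (\<integral>t. h t * \<eta> n t \<partial>?I)" for n
  proof -
    have "(\<integral>t. W t * (\<rho> a (\<epsilon> n) t + (- 1) * \<rho> b (\<epsilon> n) t) \<partial>?I) = - (\<integral>t. h t * \<eta> n t \<partial>?I)"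
    proof (rule weak)
      show "smooth1 m (\<eta> n)" for m unfolding \<eta>_def L_def by (intro smooth1_add smooth1_mult smooth1_const smooth1_affine B(1))
      show "(\<eta> n has_real_derivative \<rho> a (\<epsilon> n) t + (- 1) * \<rho> b (\<epsilon> n) t) (at t)" for t
        unfolding \<eta>_def by (intro DERIV_add DERIV_cmult step_d)
      show "continuous_on UNIV (\<lambda>t. \<rho> a (\<epsilon> n) t + (- 1) * \<rho> b (\<epsilon> n) t)" by (intro continuous_intros \<rho>c)
      show "0 < a + \<epsilon> n" "b + 2 * \<epsilon> n < T" using ab \<epsilon>[of n] by linarith+
      fix t assume "t \<notin> {a + \<epsilon> n..b + 2 * \<epsilon> n}"
      then consider "t < a + \<epsilon> n" | "b + 2 * \<epsilon> n < t" by force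
      then show "\<eta> n t = 0"
      proof cases
        case 1
        then show ?thesis using ab step0[OF \<epsilon>(1)[of n], of t a] step0[OF \<epsilon>(1)[of n], of t b] by (simp add: \<eta>_def)
      next
        case 2
        then show ?thesis using ab step1[OF \<epsilon>(1)[of n], of a t] step1[OF \<epsilon>(1)[of n], of b t] by (simp add: \<eta>_def)
      qed
    qed
    then show ?thesis using Wint by (simp add: distrib_left right_diff_distrib)
  qed
  have "(\<lambda>n. \<integral>t. h t * \<eta> n t \<partial>?I) \<longlonglongrightarrow> (\<integral>t. h t * indicator {a<..b} t \<partial>?I)"
  proof (rule integral_dominated_convergence[where w="\<lambda>t. 2 * \<bar>h t\<bar>"])
    have hm: "h \<in> borel_measurable ?I" using h by (rule borel_measurable_integrable)
    have "indicator {a<..b} \<in> borel_measurable ?I"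
      by (intro measurable_restrict_space1 measurable_completion) simp
    with hm show "(\<lambda>t. h t * indicator {a<..b} t) \<in> borel_measurable ?I" by (rule borel_measurable_times)
    have "continuous_on UNIV (\<eta> n)" for n
      unfolding \<eta>_def using B(1)[of 0] by (auto intro!: continuous_intros continuous_on_compose2[where g=B and t=UNIV, OF _ Lc])
    then have "\<eta> n \<in> borel_measurable ?I" for n
      by (intro measurable_restrict_space1 measurable_completion) (simp add: borel_measurable_continuous_onI)
    with hm show "(\<lambda>t. h t * \<eta> n t) \<in> borel_measurable ?I" for n by (rule borel_measurable_times)
    show "integrable ?I (\<lambda>t. 2 * \<bar>h t\<bar>)" using h by simp
    have step_lim: "(\<lambda>n. B (L c (\<epsilon> n) t)) \<longlonglongrightarrow> indicator {c<..} t" for c t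
    proof (cases "c < t")
      case True
      have "\<forall>\<^sub>F n in sequentially. \<epsilon> n < (t - c) / 2"
        by (rule order_tendstoD(2)[OF \<epsilon>_lim]) (use True in simp)
      then have "\<forall>\<^sub>F n in sequentially. B (L c (\<epsilon> n) t) = 1"
        by eventually_elim (use step1[OF \<epsilon>(1)] in simp)
      then show ?thesis using True by (simp add: tendsto_eventually)
    next
      case False
      then have "B (L c (\<epsilon> n) t) = 0" for n using step0[OF \<epsilon>(1)[of n], of t c] \<epsilon>(1)[of n] by simp
      then show ?thesis using False by simp
    qed
    show "AE t in ?I. (\<lambda>n. h t * \<eta> n t) \<longlonglongrightarrow> h t * indicator {a<..b} t"
    proof (rule AE_I2, rule tendsto_mult[OF tendsto_const])
      fix t
      have "(\<lambda>n. \<eta> n t) \<longlonglongrightarrow> indicator {a<..} t + (- 1) * indicator {b<..} t"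
        unfolding \<eta>_def by (intro tendsto_intros step_lim)
      also have "indicator {a<..} t + (- 1) * indicator {b<..} t = (indicator {a<..b} t :: real)"
        using ab by (auto simp: indicator_def)
      finally show "(\<lambda>n. \<eta> n t) \<longlonglongrightarrow> indicator {a<..b} t" .
    qed
    show "AE t in ?I. norm (h t * \<eta> n t) \<le> 2 * \<bar>h t\<bar>" for n
    proof (rule AE_I2)
      fix t
      have "\<bar>\<eta> n t\<bar> \<le> 2" using B(8)[of "L a (\<epsilon> n) t"] B(8)[of "L b (\<epsilon> n) t"] unfolding \<eta>_def by linarith
      then have "\<bar>h t\<bar> * \<bar>\<eta> n t\<bar> \<le> \<bar>h t\<bar> * 2" by (rule mult_left_mono) simp
      then show "norm (h t * \<eta> n t) \<le> 2 * \<bar>h t\<bar>" by (simp add: abs_mult)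
    qed
  qed
  then have "(\<lambda>n. - (\<integral>t. h t * \<eta> n t \<partial>?I)) \<longlonglongrightarrow> - (\<integral>t. h t * indicator {a<..b} t \<partial>?I)" by (rule tendsto_minus)
  moreover have "(\<lambda>n. - (\<integral>t. h t * \<eta> n t \<partial>?I)) \<longlonglongrightarrow> W a - W b"
    unfolding wk[symmetric] by (intro tendsto_diff delta) (use ab in auto)
  ultimately have eq: "W b - W a = (\<integral>t. h t * indicator {a<..b} t \<partial>?I)"
    using LIMSEQ_unique by fastforce
  also have "\<dots> = integral {0<..<T} (\<lambda>t. h t * indicator {a<..b} t)"
  proof (rule lebesgue_integral_eq_integral)
    have "integrable ?I (\<lambda>t. indicator {a<..b} t *\<^sub>R h t)"
      by (rule integrable_mult_indicator[OF _ h]) (use ab in \<open>auto simp: sets_restrict_space_iff\<close>)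
    then show "integrable ?I (\<lambda>t. h t * indicator {a<..b} t)" by (simp add: mult.commute)
  qed simp
  also have "\<dots> = integral {0<..<T} (\<lambda>t. if t \<in> {a<..b} then h t else 0)"
    by (rule integral_cong) (auto simp: indicator_def)
  also have "\<dots> = integral ({0<..<T} \<inter> {a<..b}) h" by (simp only: integral_restrict_Int Int_commute)
  also have "{0<..<T} \<inter> {a<..b} = {a<..b}" using ab by auto
  also have "integral {a<..b} h = integral {a..b} h"
    by (rule integral_spike_set; rule negligible_subset[of "{a}"]) auto
  finally show ?thesis .
qed

section \<open>Measurability and essential bounds in time\<close>

lemma integral_lebesgue_on_cong_AE:
  fixes f g :: "'a::euclidean_space \<Rightarrow> real"
  assumes S: "S \<in> sets lebesgue" and g: "g \<in> borel_measurable (lebesgue_on S)"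
    and ae: "AE x in lebesgue_on S. f x = g x"
  shows "integral\<^sup>L (lebesgue_on S) f = integral\<^sup>L (lebesgue_on S) g"
    "integrable (lebesgue_on S) g \<Longrightarrow> integrable (lebesgue_on S) f"
proof -
  have f: "f \<in> borel_measurable (lebesgue_on S)"
    by (rule borel_measurable_lebesgue_on_cong_AE[OF S g ae])
  show "integral\<^sup>L (lebesgue_on S) f = integral\<^sup>L (lebesgue_on S) g"
    by (rule integral_cong_AE[OF f g ae])
  show "integrable (lebesgue_on S) g \<Longrightarrow> integrable (lebesgue_on S) f"
    using integrable_cong_AE[OF f g ae] by simp
qed

text \<open>
  Bounds are known on open intervals starting at 0; on a closed subinterval only the null set \<open>{0}\<close> is
  added.
\<close>

lemma AE_interval_transfer:
  fixes a b T :: real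
  assumes ae: "AE t in lebesgue_on {0<..<T}. P t" and ab: "0 \<le> a" "b < T"
  shows "AE t in lebesgue_on {a..b}. P t"
proof -
  have "AE t in lborel. t \<noteq> (0::real)" by (rule AE_lborel_singleton)
  then have "AE t in lebesgue. t \<noteq> (0::real)" by (rule AE_completion)
  moreover have "AE t in lebesgue. t \<in> {0<..<T} \<longrightarrow> P t"
    using ae by (simp add: AE_restrict_space_iff)
  ultimately have "AE t in lebesgue. t \<in> {a..b} \<longrightarrow> P t"
    by eventually_elim (use ab in auto)
  then show ?thesis by (simp add: AE_restrict_space_iff)
qed

lemma measurable_interval_transfer:
  fixes a b T :: real and g :: "real \<Rightarrow> 'b::{topological_space, second_countable_topology, real_normed_vector}"
  assumes g: "g \<in> borel_measurable (lebesgue_on {0<..<T})" and ab: "0 \<le> a" "b < T"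
  shows "g \<in> borel_measurable (lebesgue_on {a..b})"
proof (rule borel_measurable_lebesgue_on_cong_AE)
  have "(\<lambda>t. indicator {0<..<T} t *\<^sub>R g t) \<in> borel_measurable lebesgue"
    using g by (simp add: borel_measurable_restrict_space_iff)
  then show "(\<lambda>t. indicator {0<..<T} t *\<^sub>R g t) \<in> borel_measurable (lebesgue_on {a..b})"
    by (rule measurable_restrict_space1)
  show "AE t in lebesgue_on {a..b}. g t = indicator {0<..<T} t *\<^sub>R g t"
    by (rule AE_interval_transfer[OF _ ab]) (auto intro!: AE_I2)
qed simp

lemma integrable_interval_transfer:
  fixes a b T :: real and g :: "real \<Rightarrow> real"
  assumes g: "integrable (lebesgue_on {0<..<T}) g" and ab: "0 \<le> a" "b < T"
  shows "integrable (lebesgue_on {a..b}) g"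
proof -
  have "integrable lebesgue (\<lambda>t. indicator {0<..<T} t *\<^sub>R g t)"
    using g by (simp add: integrable_restrict_space)
  then have "integrable lebesgue (\<lambda>t. indicator {a..b} t *\<^sub>R (indicator {0<..<T} t *\<^sub>R g t))"
    by (rule integrable_mult_indicator[rotated]) simp
  then have i: "integrable (lebesgue_on {a..b}) (\<lambda>t. indicator {0<..<T} t *\<^sub>R g t)"
    by (simp add: integrable_restrict_space)
  show ?thesis
  proof (rule integral_lebesgue_on_cong_AE(2)[OF _ borel_measurable_integrable[OF i] _ i])
    show "AE t in lebesgue_on {a..b}. g t = indicator {0<..<T} t *\<^sub>R g t"
      by (rule AE_interval_transfer[OF _ ab]) (auto intro!: AE_I2)
  qed simp
qed

text \<open>
  Upgrades the essential bound on the energy to a bound at every time for the continuous Fourier modes.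
\<close>

lemma continuous_le_if_AE_le:
  fixes \<phi> :: "real \<Rightarrow> real"
  assumes c: "continuous_on {a..b} \<phi>" and ab: "a < b"
    and ae: "AE t in lebesgue_on {a..b}. \<phi> t \<le> C" and t: "t \<in> {a..b}"
  shows "\<phi> t \<le> C"
proof (rule ccontr)
  assume "\<not> \<phi> t \<le> C"
  then have "0 < \<phi> t - C" by simp
  then obtain d where d: "0 < d" "\<And>s. s \<in> {a..b} \<Longrightarrow> dist s t < d \<Longrightarrow> dist (\<phi> s) (\<phi> t) < \<phi> t - C"
    using c t unfolding continuous_on_iff by blast
  define p q where "p = max a (t - d/2)" and "q = min b (t + d/2)"
  have pq: "p < q" using t ab d(1) by (auto simp: p_def q_def)
  have big: "\<not> \<phi> s \<le> C" if "s \<in> {p..q}" for s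
  proof -
    have "s \<in> {a..b}" "dist s t < d" using that d(1) by (auto simp: p_def q_def dist_real_def)
    from d(2)[OF this] show ?thesis by (simp add: dist_real_def)
  qed
  have "AE s in lebesgue. s \<in> {a..b} \<longrightarrow> \<phi> s \<le> C" using ae by (simp add: AE_restrict_space_iff)
  then have "AE s in lebesgue. s \<notin> {p..q}"
    by eventually_elim (use big in \<open>auto simp: p_def q_def\<close>)
  then have "{p..q} \<in> null_sets lebesgue" by (subst AE_iff_null_sets) auto
  then show False using pq by (simp add: null_sets_def)
qed

text \<open>
  Lebesgue measurable functions on the product are not sectionwise measurable, so \<open>u\<close> is first replaced by
  a Borel function, to which Fubini's theorem applies.
\<close>

lemma slice_coeff_measurable:
  fixes u :: "real \<Rightarrow> real^3 \<Rightarrow> real" and f :: "real \<Rightarrow> real"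
  assumes u: "jointly_measurable I u" and I: "I \<in> sets borel" and f: "continuous_on UNIV f"
  shows "(\<lambda>t. coeff (\<lambda>x. f (u t x)) k) \<in> borel_measurable (lebesgue_on I)"
proof -
  let ?S = "I \<times> cell"
  have S: "?S \<in> sets borel" "?S \<in> sets lebesgue"
    using I borel_Times[OF I cell_sets(2)] by auto
  have fm: "f \<in> borel_measurable borel" by (rule borel_measurable_continuous_onI[OF f])
  have "(\<lambda>z. indicator ?S z *\<^sub>R (case z of (t, x) \<Rightarrow> u t x)) \<in> borel_measurable lebesgue"
    using u S by (simp add: jointly_measurable_def borel_measurable_restrict_space_iff)
  from completion_ex_borel_measurable_real[OF this] obtain w where
    w: "w \<in> borel_measurable lborel" "AE z in lborel. indicator ?S z *\<^sub>R (case z of (t, x) \<Rightarrow> u t x) = w z" by blast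
  have wp: "w \<in> borel_measurable (lborel \<Otimes>\<^sub>M lborel)" using w(1) by (simp add: lborel_prod)
  have "AE t in lborel. AE x in lborel. indicator ?S (t, x) *\<^sub>R (case (t, x) of (t, x) \<Rightarrow> u t x) = w (t, x)"
    using w(2) unfolding lborel_prod[symmetric] by (rule pair_sigma_finite.AE_pair[OF pair_sigma_finite.intro[OF sigma_finite_lborel sigma_finite_lborel]])
  then have ae: "AE t in lborel. t \<in> I \<longrightarrow> (AE x in torus. u t x = w (t, x))"
  proof eventually_elim
    case (elim t)
    show ?case
    proof
      assume "t \<in> I"
      then show "AE x in torus. u t x = w (t, x)" unfolding AE_torus_iff
        using elim by (auto elim!: eventually_mono)
    qed
  qed
  define c where "c t = (\<integral>x. indicator cell x * (f (w (t, x)) * eigfun k x) \<partial>lborel)" for t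
  have cm: "c \<in> borel_measurable lborel" unfolding c_def
  proof (rule lborel.borel_measurable_lebesgue_integral)
    have 1: "(\<lambda>z. f (w z)) \<in> borel_measurable (lborel \<Otimes>\<^sub>M lborel)" using measurable_compose[OF wp fm] .
    have 2: "(\<lambda>z. eigfun k (snd z)) \<in> borel_measurable (lborel \<Otimes>\<^sub>M lborel)"
      by (rule measurable_compose[OF measurable_snd]) simp
    have 3: "(\<lambda>z. indicator cell (snd z) :: real) \<in> borel_measurable (lborel \<Otimes>\<^sub>M lborel)"
      by (rule measurable_compose[OF measurable_snd]) simp
    show "(\<lambda>(t, x). indicator cell x * (f (w (t, x)) * eigfun k x)) \<in> borel_measurable (lborel \<Otimes>\<^sub>M lborel)"
      unfolding case_prod_unfold prod.collapse by (intro borel_measurable_times 1 2 3)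
  qed
  have eq: "coeff (\<lambda>x. f (u t x)) k = c t" if t: "AE x in torus. u t x = w (t, x)" for t
  proof -
    have wt: "(\<lambda>x. w (t, x)) \<in> borel_measurable borel"
      using measurable_compose[OF measurable_Pair1' wp, of t] by simp
    then have fb: "(\<lambda>x. f (w (t, x)) * eigfun k x) \<in> borel_measurable borel"
      by (intro borel_measurable_times measurable_compose[OF _ fm]) auto
    have "coeff (\<lambda>x. f (u t x)) k = (\<integral>x. f (w (t, x)) * eigfun k x \<partial>torus)"
      unfolding coeff_def L2_inner_def
    proof (rule integral_lebesgue_on_cong_AE(1))
      show "(\<lambda>x. f (w (t, x)) * eigfun k x) \<in> borel_measurable torus" by (rule borel_measurable_torus[OF fb])
      from t show "AE x in torus. f (u t x) * eigfun k x = f (w (t, x)) * eigfun k x" by eventually_elim simp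
    qed simp
    also have "\<dots> = c t" unfolding c_def by (rule torus_eq_lborel(1)[OF fb])
    finally show ?thesis .
  qed
  show ?thesis
  proof (rule borel_measurable_lebesgue_on_cong_AE)
    show "I \<in> sets lebesgue" using I by simp
    show "c \<in> borel_measurable (lebesgue_on I)"
      using cm by (intro measurable_restrict_space1 measurable_completion)
    have "AE t in lebesgue. t \<in> I \<longrightarrow> coeff (\<lambda>x. f (u t x)) k = c t"
      using AE_completion[OF ae] by eventually_elim (use eq in blast)
    then show "AE t in lebesgue_on I. coeff (\<lambda>x. f (u t x)) k = c t"
      using I by (simp add: AE_restrict_space_iff)
  qed
qed

lemma energy_norm_nonneg: "0 \<le> energy_norm u v"
  by (simp add: energy_norm_def)

text \<open>
  An essential supremum is attained as an almost everywhere bound; finiteness on a larger interval makes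
  the real-valued norm meaningful.
\<close>

lemma energy_esssup_bound:
  assumes fin: "energy_esssup {0<..<T} u v < \<infinity>" and ab: "0 \<le> a" "a < b" "b < T"
  shows "AE t in lebesgue_on {a..b}. energy_norm (u t) (v t) \<le> Linf_energy_norm {a..b} u v"
    "0 \<le> Linf_energy_norm {a..b} u v"
proof -
  let ?e = "\<lambda>t. energy_norm (u t) (v t)"
  have m0: "(\<lambda>t. ereal (?e t)) \<in> borel_measurable (lebesgue_on {0<..<T})"
    using fin esssup_non_measurable[of "\<lambda>t. ereal (?e t)" "lebesgue_on {0<..<T}"]
    by (auto simp: energy_esssup_def top_ereal_def)
  then have "(\<lambda>t. real_of_ereal (ereal (?e t))) \<in> borel_measurable (lebesgue_on {0<..<T})"
    by (rule borel_measurable_real_of_ereal)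
  then have e0: "?e \<in> borel_measurable (lebesgue_on {0<..<T})" by (simp only: real_of_ereal.simps)
  have "?e \<in> borel_measurable (lebesgue_on {a..b})"
    by (rule measurable_interval_transfer[OF e0 ab(1,3)])
  then have m: "(\<lambda>t. ereal (?e t)) \<in> borel_measurable (lebesgue_on {a..b})"
    by (rule borel_measurable_ereal)
  let ?E = "energy_esssup {a..b} u v"
  have "AE t in lebesgue_on {0<..<T}. ereal (?e t) \<le> energy_esssup {0<..<T} u v"
    unfolding energy_esssup_def by (rule esssup_AE)
  then have "AE t in lebesgue_on {a..b}. ereal (?e t) \<le> energy_esssup {0<..<T} u v"
    by (rule AE_interval_transfer) (use ab in auto)
  then have "?E \<le> energy_esssup {0<..<T} u v"
    unfolding energy_esssup_def[of "{a..b}"] using m by (rule esssup_I[rotated])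
  then have top: "?E < \<infinity>" using fin by (rule le_less_trans)
  have aeE: "AE t in lebesgue_on {a..b}. ereal (?e t) \<le> ?E"
    unfolding energy_esssup_def by (rule esssup_AE)
  have nn: "0 \<le> ?E"
  proof (rule ccontr)
    assume n: "\<not> 0 \<le> ?E"
    from aeE have "AE t in lebesgue_on {a..b}. False"
    proof eventually_elim
      case (elim t)
      have "0 \<le> ereal (?e t)" by (simp add: energy_norm_nonneg)
      then have "0 \<le> ?E" using elim by (rule order_trans)
      then show ?case using n by simp
    qed
    then have "emeasure (lebesgue_on {a..b}) {a..b} = 0"
      by (subst (asm) AE_iff_measurable[where N="{a..b}"]) (auto simp: sets_restrict_space_iff)
    then show False using ab by (simp add: emeasure_restrict_space)
  qed
  have re: "ereal (Linf_energy_norm {a..b} u v) = ?E"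
    using top nn by (cases ?E) (auto simp: Linf_energy_norm_def)
  from aeE show "AE t in lebesgue_on {a..b}. ?e t \<le> Linf_energy_norm {a..b} u v"
    by eventually_elim (simp flip: re)
  show "0 \<le> Linf_energy_norm {a..b} u v" using nn by (simp flip: re)
qed

section \<open>The equations for the Fourier modes of a solution\<close>

lemma coeff_eigfun: "coeff (eigfun k) j = (if j = k then 1 else 0)"
  by (simp add: coeff_def eigfun_orthonormal)

lemma coeff_zero: "coeff (\<lambda>x. 0) j = 0"
  by (simp add: coeff_def L2_inner_def)

lemma Hs_zero: "Hs s (\<lambda>x. 0)"
  by (simp add: Hs_def coeff_zero L2_torus_continuous)

lemma Hs_eigfun: "Hs s (eigfun k)"
proof -
  have "((\<lambda>j. (1 + eigval j) powr s * (coeff (eigfun k) j)\<^sup>2) has_sum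
     (\<Sum>j\<in>{k}. (1 + eigval j) powr s * (coeff (eigfun k) j)\<^sup>2)) UNIV"
    by (rule has_sum_finite_neutralI[of "{k}"]) (auto simp: coeff_eigfun)
  then show ?thesis by (auto simp: Hs_def L2_eigfun intro: has_sum_imp_summable)
qed

lemma Hs_inner_eigfun: "Hs_inner 1 u (eigfun k) = (1 + eigval k) * coeff u k"
proof -
  have "((\<lambda>j. (1 + eigval j) powr 1 * (coeff u j * coeff (eigfun k) j)) has_sum
     (\<Sum>j\<in>{k}. (1 + eigval j) powr 1 * (coeff u j * coeff (eigfun k) j))) UNIV"
    by (rule has_sum_finite_neutralI[of "{k}"]) (auto simp: coeff_eigfun)
  then show ?thesis unfolding Hs_inner_def by (subst infsumI) (auto simp: coeff_eigfun)
qed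

text \<open>
  Weak continuity is tested with the pairs \<open>(e\<^sub>k, 0)\<close> and \<open>(0, e\<^sub>k)\<close>.
\<close>

lemma weakly_continuous_coeff:
  assumes "weakly_continuous_energy U V"
  shows "0 \<le> t \<Longrightarrow> Hs 1 (U t)" "0 \<le> t \<Longrightarrow> L2_torus (V t)"
    "continuous_on {0..} (\<lambda>t. coeff (U t) k)" "continuous_on {0..} (\<lambda>t. coeff (V t) k)"
proof -
  show "0 \<le> t \<Longrightarrow> Hs 1 (U t)" "0 \<le> t \<Longrightarrow> L2_torus (V t)"
    using assms by (auto simp: weakly_continuous_energy_def energy_space_def)
  have c: "continuous_on {0..} (\<lambda>t. Hs_inner 1 (U t) w + L2_inner (V t) z)" if "energy_space w z" for w z
    using assms that by (auto simp: weakly_continuous_energy_def)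
  have "continuous_on {0..} (\<lambda>t. Hs_inner 1 (U t) (eigfun k) + L2_inner (V t) (\<lambda>x. 0))"
    by (rule c) (simp only: energy_space_def Hs_eigfun L2_torus_continuous[OF continuous_on_const] simp_thms)
  then have "continuous_on {0..} (\<lambda>t. ((1 + eigval k) * coeff (U t) k) * (1 / (1 + eigval k)))"
    by (intro continuous_on_mult_right) (simp add: Hs_inner_eigfun L2_inner_def)
  moreover have "((1 + eigval k) * coeff (U t) k) * (1 / (1 + eigval k)) = coeff (U t) k" for t
    using eigval_nonneg[of k] by (simp add: add_nonneg_eq_0_iff)
  ultimately show "continuous_on {0..} (\<lambda>t. coeff (U t) k)" by simp
  have "continuous_on {0..} (\<lambda>t. Hs_inner 1 (U t) (\<lambda>x. 0) + L2_inner (V t) (eigfun k))"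
    by (rule c) (use Hs_zero L2_eigfun in \<open>auto simp: energy_space_def\<close>)
  then show "continuous_on {0..} (\<lambda>t. coeff (V t) k)"
    by (simp add: Hs_inner_def coeff_zero coeff_def[of "V _"])
qed

lemma Hs_cong_AE:
  assumes u: "L2_torus u" and ae: "AE x in torus. w x = u x"
  shows "Hs s w \<longleftrightarrow> Hs s u" "Hs_norm s w = Hs_norm s u"
  using L2_torus_cong_AE[OF u ae] u coeff_cong_AE[OF u ae] by (simp_all add: Hs_def Hs_norm_def)

lemma Hs_norm_sq: "(Hs_norm s u)\<^sup>2 = (\<Sum>\<^sub>\<infinity>k. (1 + eigval k) powr s * (coeff u k)\<^sup>2)"
  unfolding Hs_norm_def by (rule real_sqrt_pow2) (rule infsum_nonneg, simp)

lemma L2_norm_sq: "(L2_norm u)\<^sup>2 = L2_inner u u"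
  unfolding L2_norm_def by (rule real_sqrt_pow2) (rule L2_inner_nonneg)

lemma finite_measure_interval: "finite_measure (lebesgue_on {a<..<b::real})" "finite_measure (lebesgue_on {a..b})"
  by (cases "a \<le> b"; auto intro!: finite_measureI simp: emeasure_restrict_space)+

lemma AE_lebesgue_on_subset:
  assumes "AE x in lebesgue_on S. P x" "T \<subseteq> S" "S \<in> sets lebesgue" "T \<in> sets lebesgue"
  shows "AE x in lebesgue_on T. P x"
proof -
  have "AE x in lebesgue. x \<in> S \<longrightarrow> P x" using assms by (simp add: AE_restrict_space_iff)
  then have "AE x in lebesgue. x \<in> T \<longrightarrow> P x" by eventually_elim (use assms in auto)
  then show ?thesis using assms by (simp add: AE_restrict_space_iff)
qed

lemma bounded_integrable_interval:
  fixes g :: "real \<Rightarrow> real"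
  assumes "g \<in> borel_measurable (lebesgue_on I)" "\<And>t. t \<in> I \<Longrightarrow> \<bar>g t\<bar> \<le> B"
    and "I = {a<..<b} \<or> I = {a..b}"
  shows "integrable (lebesgue_on I) g"
  using assms finite_measure_interval
  by (auto intro!: finite_measure.integrable_const_bound[where B=B])

text \<open>
  A weak solution \<open>(u, v)\<close> together with its weakly continuous representative \<open>(U, V)\<close>. The Fourier modes are
  taken from the representative, so that they are continuous in time and bounded at every time.
\<close>

locale solution_modes = quintic_nonlinearity f A K for f A K +
  fixes \<alpha> \<gamma> :: real and g :: "real^3 \<Rightarrow> real" and u v U V :: "real \<Rightarrow> real^3 \<Rightarrow> real"
  assumes \<alpha>: "0 \<le> \<alpha>" and \<gamma>: "0 \<le> \<gamma>" and g: "L2_torus g"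
    and wc: "weakly_continuous_energy U V"
    and rep: "AE t in lebesgue_on {0<..}. (AE x in torus. U t x = u t x) \<and> (AE x in torus. V t x = v t x)"
    and lin: "\<And>T. 0 < T \<Longrightarrow> Linf_energy {0<..<T} u v"
    and wtd: "\<And>T. 0 < T \<Longrightarrow> has_weak_time_deriv T u v"
    and vHs: "\<And>T. 0 < T \<Longrightarrow> L2_Hs {0<..<T} (1/2) v"
    and eqn: "\<And>T \<phi>. 0 < T \<Longrightarrow> test_function T \<phi> \<Longrightarrow>
           - (\<integral>t. L2_inner (v t) (time_deriv \<phi> t) \<partial>lebesgue_on {0<..<T})
           + (\<integral>t. (\<integral>x. weak_grad (u t) x \<bullet> grad (\<phi> t) x \<partial>torus) \<partial>lebesgue_on {0<..<T})
           + \<alpha> * (\<integral>t. L2_inner (v t) (\<phi> t) \<partial>lebesgue_on {0<..<T})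
           + \<gamma> * (\<integral>t. L2_inner (v t) (frac_laplacian (1/2) (\<phi> t)) \<partial>lebesgue_on {0<..<T})
           + (\<integral>t. L2_inner (\<lambda>x. f (u t x)) (\<phi> t) \<partial>lebesgue_on {0<..<T})
           = (\<integral>t. L2_inner g (\<phi> t) \<partial>lebesgue_on {0<..<T})"
begin

definition uk :: "int^3 \<Rightarrow> real \<Rightarrow> real" where "uk k t = coeff (U t) k"
definition vk :: "int^3 \<Rightarrow> real \<Rightarrow> real" where "vk k t = coeff (V t) k"
definition fk :: "int^3 \<Rightarrow> real \<Rightarrow> real" where "fk k t = coeff (\<lambda>x. f (U t x)) k"

text \<open>
  The right-hand side of the scalar equation of the mode \<open>k\<close>, solved for the time derivative of \<open>vk k\<close>.
\<close>

definition hk :: "int^3 \<Rightarrow> real \<Rightarrow> real" where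
  "hk k t = coeff g k - eigval k * uk k t - (\<alpha> + \<gamma> * sqrt (eigval k)) * vk k t - fk k t"

lemma U_Hs: "0 \<le> t \<Longrightarrow> Hs 1 (U t)" and U_L2: "0 \<le> t \<Longrightarrow> L2_torus (U t)" and V_L2: "0 \<le> t \<Longrightarrow> L2_torus (V t)"
  using weakly_continuous_coeff(1,2)[OF wc] by (auto simp: Hs_def)

lemma uk_cont: "S \<subseteq> {0..} \<Longrightarrow> continuous_on S (uk k)" and vk_cont: "S \<subseteq> {0..} \<Longrightarrow> continuous_on S (vk k)"
  unfolding uk_def vk_def using weakly_continuous_coeff(3,4)[OF wc] continuous_on_subset by blast+

lemma AE_modes:
  "AE t in lebesgue_on {0<..<T}. 0 < t \<and> Hs 1 (u t) \<and> L2_torus (v t) \<and> (AE x in torus. u t x = U t x) \<and> (AE x in torus. v t x = V t x) \<and>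
    (\<forall>k. coeff (u t) k = uk k t) \<and> (\<forall>k. coeff (v t) k = vk k t) \<and> (\<forall>k. coeff (\<lambda>x. f (u t x)) k = fk k t)"
proof -
  have "AE t in lebesgue_on {0<..<T}. (AE x in torus. U t x = u t x) \<and> (AE x in torus. V t x = v t x)"
    by (rule AE_lebesgue_on_subset[OF rep]) auto
  then have "AE t in lebesgue_on {0<..<T}. (AE x in torus. u t x = U t x) \<and> (AE x in torus. v t x = V t x)"
    by (rule eventually_mono) (auto simp: eq_commute)
  moreover have "AE t in lebesgue_on {0<..<T}. 0 < t" by (auto intro!: AE_I2)
  ultimately show ?thesis
  proof eventually_elim
    case (elim t)
    then have t: "0 \<le> t" by simp
    have "coeff (\<lambda>x. f (u t x)) k = fk k t" for k
      unfolding fk_def coeff_def L2_inner_def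
    proof (rule integral_lebesgue_on_cong_AE(1))
      have "(\<lambda>x. f (U t x)) \<in> borel_measurable torus"
        by (rule measurable_f[OF L2_torus_measurable[OF U_L2[OF t]]])
      then show "(\<lambda>x. f (U t x) * eigfun k x) \<in> borel_measurable torus"
        by (rule borel_measurable_times) (rule measurable_eigfun)
      from elim show "AE x in torus. f (u t x) * eigfun k x = f (U t x) * eigfun k x"
        by (auto elim: eventually_mono)
    qed simp
    then show ?case
      using elim Hs_cong_AE(1)[OF U_L2[OF t], of "u t" 1] U_Hs[OF t] L2_torus_cong_AE[OF V_L2[OF t], of "v t"]
        coeff_cong_AE[OF U_L2[OF t], of "u t"] coeff_cong_AE[OF V_L2[OF t], of "v t"]
      by (auto simp: uk_def vk_def)
  qed
qed

lemma mode_energy_bound: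
  assumes ab: "0 \<le> a" "a < b" and E: "AE t in lebesgue_on {a..b}. energy_norm (u t) (v t) \<le> E" "0 \<le> E"
    and t: "t \<in> {a..b}" and F: "finite F"
  shows "(\<Sum>k\<in>F. (1 + eigval k) * (uk k t)\<^sup>2) + (\<Sum>k\<in>F. (vk k t)\<^sup>2) \<le> E\<^sup>2"
proof (rule continuous_le_if_AE_le[OF _ ab(2) _ t])
  show "continuous_on {a..b} (\<lambda>t. (\<Sum>k\<in>F. (1 + eigval k) * (uk k t)\<^sup>2) + (\<Sum>k\<in>F. (vk k t)\<^sup>2))"
    using ab by (intro continuous_intros uk_cont vk_cont) auto
  have "AE t in lebesgue_on {a..b}. Hs 1 (u t) \<and> L2_torus (v t) \<and>
    (\<forall>k. coeff (u t) k = uk k t) \<and> (\<forall>k. coeff (v t) k = vk k t)"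
    by (rule AE_interval_transfer[where T="b + 1"], rule eventually_mono[OF AE_modes]) (use ab in auto)
  with E(1) show "AE t in lebesgue_on {a..b}. (\<Sum>k\<in>F. (1 + eigval k) * (uk k t)\<^sup>2) + (\<Sum>k\<in>F. (vk k t)\<^sup>2) \<le> E\<^sup>2"
  proof eventually_elim
    case (elim t)
    have s: "(\<lambda>k. (1 + eigval k) * (coeff (u t) k)\<^sup>2) summable_on UNIV" using elim unfolding Hs1_iff by blast
    have "(\<Sum>k\<in>F. (1 + eigval k) * (coeff (u t) k)\<^sup>2) \<le> (Hs_norm 1 (u t))\<^sup>2"
      unfolding Hs_norm_sq using finite_sum_le_infsum[OF s F] by simp
    moreover have "(\<Sum>k\<in>F. (coeff (v t) k)\<^sup>2) \<le> (L2_norm (v t))\<^sup>2"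
      unfolding L2_norm_sq using elim by (intro bessel F) auto
    moreover have "(Hs_norm 1 (u t))\<^sup>2 + (L2_norm (v t))\<^sup>2 = (energy_norm (u t) (v t))\<^sup>2"
      by (simp add: energy_norm_def)
    moreover have "(energy_norm (u t) (v t))\<^sup>2 \<le> E\<^sup>2" using elim energy_norm_nonneg by (intro power_mono) auto
    ultimately show ?case using elim by simp
  qed
qed

lemma h1_bounded_U:
  assumes ab: "0 \<le> a" "a < b" and E: "AE t in lebesgue_on {a..b}. energy_norm (u t) (v t) \<le> E" "0 \<le> E"
    and t: "t \<in> {a..b}"
  shows "h1_bounded (E\<^sup>2 + 1) (U t)"
proof -
  have le: "(\<Sum>k\<in>F. (1 + eigval k) * (coeff (U t) k)\<^sup>2) \<le> E\<^sup>2" if "finite F" for F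
  proof -
    have "0 \<le> (\<Sum>k\<in>F. (vk k t)\<^sup>2)" by (rule sum_nonneg) simp
    then show ?thesis using mode_energy_bound[OF ab E t that] unfolding uk_def by linarith
  qed
  have s: "(\<lambda>k. (1 + eigval k) * (coeff (U t) k)\<^sup>2) summable_on UNIV"
    using U_Hs[of t] t ab by (simp add: Hs1_iff)
  have "h1_sum (coeff (U t)) \<le> E\<^sup>2" by (rule infsum_le_finite_sums[OF s]) (use le in auto)
  then show ?thesis using s U_L2[of t] t ab by (auto simp: h1_bounded_def add_nonneg_pos)
qed

lemma energy_bound_exists:
  assumes "0 < b"
  obtains E where "AE t in lebesgue_on {0..b}. energy_norm (u t) (v t) \<le> E" "0 \<le> E"
proof -
  have "energy_esssup {0<..<b + 1} u v < \<infinity>" using lin[of "b + 1"] assms by (simp add: Linf_energy_def)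
  from energy_esssup_bound[OF this, of 0 b] show ?thesis using that assms by auto
qed

lemma fk_bounded:
  assumes "0 < b" obtains B where "\<And>t k. t \<in> {0..b} \<Longrightarrow> \<bar>fk k t\<bar> \<le> B"
proof -
  obtain E where E: "AE t in lebesgue_on {0..b}. energy_norm (u t) (v t) \<le> E" "0 \<le> E"
    using energy_bound_exists[OF assms] by blast
  have "\<bar>fk k t\<bar> \<le> A * (3 * (2*pi)^3 + sobolev_const * (E\<^sup>2 + 1)^3)" if "t \<in> {0..b}" for t k
    unfolding fk_def by (rule f_eigfun(2)[OF h1_bounded_U[OF _ assms E that]]) simp
  then show ?thesis using that by blast
qed

lemma fk_measurable: "0 < T \<Longrightarrow> fk k \<in> borel_measurable (lebesgue_on {0<..<T})"
proof (rule borel_measurable_lebesgue_on_cong_AE)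
  assume T: "0 < T"
  show "(\<lambda>t. coeff (\<lambda>x. f (u t x)) k) \<in> borel_measurable (lebesgue_on {0<..<T})"
    using lin[OF T] by (intro slice_coeff_measurable f_cont) (auto simp: Linf_energy_def)
  show "AE t in lebesgue_on {0<..<T}. fk k t = coeff (\<lambda>x. f (u t x)) k"
    using AE_modes by eventually_elim simp
qed simp

lemma cont_measurable: "continuous_on {a..b} c \<Longrightarrow> c \<in> borel_measurable (lebesgue_on {a..b})" for c :: "real \<Rightarrow> real"
  by (rule continuous_imp_measurable_on_sets_lebesgue) auto

text \<open>
  The weak formulation is tested with \<open>\<eta>(t) e\<^sub>k(x)\<close>.
\<close>

lemma mode_odes:
  assumes ab: "0 \<le> a" "a < b"
  shows "uk k b - uk k a = integral {a..b} (vk k)" "vk k b - vk k a = integral {a..b} (hk k)"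
proof -
  define T where "T = b + 1"
  have T: "0 < T" "b < T" using ab by (auto simp: T_def)
  let ?I = "lebesgue_on {0<..<T}"
  have uc: "continuous_on {0..T} (uk k)" and vc: "continuous_on {0..T} (vk k)" by (auto intro!: uk_cont vk_cont)
  obtain B where B: "\<And>t k. t \<in> {0..T} \<Longrightarrow> \<bar>fk k t\<bar> \<le> B" using fk_bounded[OF T(1)] by blast
  have fm: "fk k \<in> borel_measurable ?I" by (rule fk_measurable[OF T(1)])
  have fi: "integrable ?I (\<lambda>t. \<eta> t * fk k t)" if c: "continuous_on {0..T} \<eta>" for \<eta>
  proof -
    obtain M where "\<forall>y\<in>\<eta> ` {0..T}. norm y \<le> M"
      using compact_imp_bounded[OF compact_continuous_image[OF c compact_Icc]] unfolding bounded_iff by blast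
    then have M: "\<And>t. t \<in> {0..T} \<Longrightarrow> \<bar>\<eta> t\<bar> \<le> M" by simp
    have "\<eta> \<in> borel_measurable ?I" using interval_integrable_continuous(1)[OF c] by (rule borel_measurable_integrable)
    then have m: "(\<lambda>t. \<eta> t * fk k t) \<in> borel_measurable ?I" using fm by (rule borel_measurable_times)
    show ?thesis
    proof (rule bounded_integrable_interval[OF m, where B="M * B"])
      fix t assume "t \<in> {0<..<T}"
      then have "t \<in> {0..T}" by auto
      from mult_mono[OF M[OF this] B[OF this, of k]] M[OF this]
      show "\<bar>\<eta> t * fk k t\<bar> \<le> M * B" by (simp add: abs_mult)
    qed (rule disjI1, rule refl)
  qed
  have hi: "integrable ?I (hk k)"
    unfolding hk_def using fi[of "\<lambda>t. 1"] interval_integrable_continuous(1)[OF uc] interval_integrable_continuous(1)[OF vc]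
      interval_integrable_continuous(1)[of 0 T "\<lambda>t. coeff g k"] by simp
  note ae = AE_modes[of T]
  have td: "time_deriv (\<lambda>t x. \<eta> t * eigfun k x) t = (\<lambda>x. \<eta>' t * eigfun k x)"
    if "\<And>t. (\<eta> has_real_derivative \<eta>' t) (at t)" for \<eta> \<eta>' t
    unfolding time_deriv_def by (rule ext, rule DERIV_imp_deriv, rule DERIV_cmult_right, rule that)
  have mon: "(\<lambda>t. \<eta> t * c t) \<in> borel_measurable ?I" "integrable ?I (\<lambda>t. \<eta> t * c t)"
    if "continuous_on UNIV \<eta>" "continuous_on {0..T} c" for \<eta> c :: "real \<Rightarrow> real"
  proof -
    show "integrable ?I (\<lambda>t. \<eta> t * c t)"
      by (intro interval_integrable_continuous(1) continuous_intros that(2) continuous_on_subset[OF that(1)]) simp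
    then show "(\<lambda>t. \<eta> t * c t) \<in> borel_measurable ?I" by (rule borel_measurable_integrable)
  qed
  show "uk k b - uk k a = integral {a..b} (vk k)"
  proof (rule weak_ode[OF uc interval_integrable_continuous(1)[OF vc] _ ab T(2)])
    fix \<eta> \<eta>' :: "real \<Rightarrow> real" and p q :: real
    assume s: "\<And>n. smooth1 n \<eta>" and d: "\<And>t. (\<eta> has_real_derivative \<eta>' t) (at t)" and c': "continuous_on UNIV \<eta>'"
      and pq: "0 < p" "q < T" "\<And>t. t \<notin> {p..q} \<Longrightarrow> \<eta> t = 0"
    let ?\<phi> = "\<lambda>t x. \<eta> t * eigfun k x"
    have c: "continuous_on UNIV \<eta>" using s[of 0] by simp
    have "test_function T ?\<phi>" by (rule test_function_eigfun[OF s pq])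
    then have "(\<integral>t. L2_inner (u t) (time_deriv ?\<phi> t) \<partial>?I) = - (\<integral>t. L2_inner (v t) (?\<phi> t) \<partial>?I)"
      using wtd[OF T(1)] by (simp add: has_weak_time_deriv_def)
    moreover have "(\<integral>t. L2_inner (u t) (time_deriv ?\<phi> t) \<partial>?I) = (\<integral>t. \<eta>' t * uk k t \<partial>?I)"
      by (rule integral_lebesgue_on_cong_AE(1)[OF _ mon(1)[OF c' uc]], simp)
        (use ae in eventually_elim, simp add: td[OF d] L2_inner_cmult_right coeff_def[symmetric])
    moreover have "(\<integral>t. L2_inner (v t) (?\<phi> t) \<partial>?I) = (\<integral>t. \<eta> t * vk k t \<partial>?I)"
      by (rule integral_lebesgue_on_cong_AE(1)[OF _ mon(1)[OF c vc]], simp)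
        (use ae in eventually_elim, simp add: L2_inner_cmult_right coeff_def[symmetric])
    ultimately show "(\<integral>t. uk k t * \<eta>' t \<partial>?I) = - (\<integral>t. vk k t * \<eta> t \<partial>?I)" by (simp add: mult.commute)
  qed
  show "vk k b - vk k a = integral {a..b} (hk k)"
  proof (rule weak_ode[OF vc hi _ ab T(2)])
    fix \<eta> \<eta>' :: "real \<Rightarrow> real" and p q :: real
    assume s: "\<And>n. smooth1 n \<eta>" and d: "\<And>t. (\<eta> has_real_derivative \<eta>' t) (at t)" and c': "continuous_on UNIV \<eta>'"
      and pq: "0 < p" "q < T" "\<And>t. t \<notin> {p..q} \<Longrightarrow> \<eta> t = 0"
    let ?\<phi> = "\<lambda>t x. \<eta> t * eigfun k x"
    have c: "continuous_on UNIV \<eta>" using s[of 0] by simp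
    have tf: "test_function T ?\<phi>" by (rule test_function_eigfun[OF s pq])
    have 1: "(\<integral>t. L2_inner (v t) (time_deriv ?\<phi> t) \<partial>?I) = (\<integral>t. \<eta>' t * vk k t \<partial>?I)"
      by (rule integral_lebesgue_on_cong_AE(1)[OF _ mon(1)[OF c' vc]], simp)
        (use ae in eventually_elim, simp add: td[OF d] L2_inner_cmult_right coeff_def[symmetric])
    have 2: "(\<integral>t. (\<integral>x. weak_grad (u t) x \<bullet> grad (?\<phi> t) x \<partial>torus) \<partial>?I) = (\<integral>t. \<eta> t * (eigval k * uk k t) \<partial>?I)"
      by (rule integral_lebesgue_on_cong_AE(1)[OF _ mon(1)[OF c]], simp, intro continuous_intros uc)
        (use ae in eventually_elim, simp add: weak_grad_eigfun)
    have 3: "(\<integral>t. L2_inner (v t) (?\<phi> t) \<partial>?I) = (\<integral>t. \<eta> t * vk k t \<partial>?I)"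
      by (rule integral_lebesgue_on_cong_AE(1)[OF _ mon(1)[OF c vc]], simp)
        (use ae in eventually_elim, simp add: L2_inner_cmult_right coeff_def[symmetric])
    have 4: "(\<integral>t. L2_inner (v t) (frac_laplacian (1/2) (?\<phi> t)) \<partial>?I) = (\<integral>t. \<eta> t * (sqrt (eigval k) * vk k t) \<partial>?I)"
      by (rule integral_lebesgue_on_cong_AE(1)[OF _ mon(1)[OF c]], simp, intro continuous_intros vc)
        (use ae in eventually_elim, simp only: frac_laplacian_eigfun L2_inner_cmult_right coeff_def[symmetric])
    have 5: "(\<integral>t. L2_inner (\<lambda>x. f (u t x)) (?\<phi> t) \<partial>?I) = (\<integral>t. \<eta> t * fk k t \<partial>?I)"
      by (rule integral_lebesgue_on_cong_AE(1)[OF _ borel_measurable_integrable[OF fi]], simp, rule continuous_on_subset[OF c], simp)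
        (use ae in eventually_elim, simp only: L2_inner_cmult_right coeff_def[symmetric])
    have 6: "(\<integral>t. L2_inner g (?\<phi> t) \<partial>?I) = (\<integral>t. \<eta> t * coeff g k \<partial>?I)"
      by (simp only: L2_inner_cmult_right coeff_def[symmetric])
    have i: "integrable ?I (\<lambda>t. \<eta> t * vk k t)" "integrable ?I (\<lambda>t. \<eta> t * uk k t)" "integrable ?I (\<lambda>t. \<eta> t * fk k t)" "integrable ?I (\<lambda>t. \<eta> t * 1)"
      by (intro mon(2)[OF c] uc vc fi continuous_on_const continuous_on_subset[OF c]; simp)+
    have e: "hk k t * \<eta> t = coeff g k * (\<eta> t * 1) - eigval k * (\<eta> t * uk k t) - (\<alpha> + \<gamma> * sqrt (eigval k)) * (\<eta> t * vk k t) - \<eta> t * fk k t" for t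
      by (simp add: hk_def algebra_simps)
    have "(\<integral>t. hk k t * \<eta> t \<partial>?I) = coeff g k * (\<integral>t. \<eta> t * 1 \<partial>?I) - eigval k * (\<integral>t. \<eta> t * uk k t \<partial>?I)
        - (\<alpha> + \<gamma> * sqrt (eigval k)) * (\<integral>t. \<eta> t * vk k t \<partial>?I) - (\<integral>t. \<eta> t * fk k t \<partial>?I)"
      unfolding e using i by simp
    moreover have "(\<integral>t. \<eta> t * (eigval k * uk k t) \<partial>?I) = eigval k * (\<integral>t. \<eta> t * uk k t \<partial>?I)"
      "(\<integral>t. \<eta> t * (sqrt (eigval k) * vk k t) \<partial>?I) = sqrt (eigval k) * (\<integral>t. \<eta> t * vk k t \<partial>?I)"
      "(\<integral>t. \<eta> t * coeff g k \<partial>?I) = coeff g k * (\<integral>t. \<eta> t * 1 \<partial>?I)"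
      unfolding integral_mult_right_zero[symmetric] by (simp_all add: mult_ac)
    ultimately have "(\<integral>t. \<eta>' t * vk k t \<partial>?I) = - (\<integral>t. hk k t * \<eta> t \<partial>?I)"
      using eqn[OF T(1) tf] unfolding 1 2 3 4 5 6 by (simp add: algebra_simps)
    then show "(\<integral>t. vk k t * \<eta>' t \<partial>?I) = - (\<integral>t. hk k t * \<eta> t \<partial>?I)" by (simp add: mult.commute)
  qed
qed

end

section \<open>The weighted energy identity\<close>

lemma continuous_integrable_interval:
  fixes c :: "real \<Rightarrow> real"
  shows "continuous_on {a..b} c \<Longrightarrow> integrable (lebesgue_on {a..b}) c"
  using absolutely_integrable_continuous_real[of a b c] by (simp add: integrable_restrict_space set_integrable_def)

lemma continuous_bounded_interval:
  fixes c :: "real \<Rightarrow> real"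
  assumes "continuous_on {a..b} c"
  obtains M where "\<And>t. t \<in> {a..b} \<Longrightarrow> \<bar>c t\<bar> \<le> M"
proof -
  obtain M where "\<forall>y\<in>c ` {a..b}. norm y \<le> M"
    using compact_imp_bounded[OF compact_continuous_image[OF assms compact_Icc]] unfolding bounded_iff by blast
  then show ?thesis by (intro that[of M]) auto
qed

context solution_modes
begin

lemma fk_mult_integrable:
  assumes ab: "0 \<le> a" "a < b" and c: "continuous_on {a..b} c"
  shows "integrable (lebesgue_on {a..b}) (\<lambda>t. c t * fk k t)"
proof -
  have b: "0 < b" using ab by simp
  obtain B where B: "\<And>t k. t \<in> {0..b} \<Longrightarrow> \<bar>fk k t\<bar> \<le> B" using fk_bounded[OF b] by blast
  obtain M where M: "\<And>t. t \<in> {a..b} \<Longrightarrow> \<bar>c t\<bar> \<le> M"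
    using continuous_bounded_interval[OF c] by blast
  have "fk k \<in> borel_measurable (lebesgue_on {a..b})"
    by (rule measurable_interval_transfer[OF fk_measurable[of "b + 1"]]) (use ab in auto)
  with cont_measurable[OF c] have m: "(\<lambda>t. c t * fk k t) \<in> borel_measurable (lebesgue_on {a..b})"
    by (rule borel_measurable_times)
  show ?thesis
  proof (rule bounded_integrable_interval[OF m, where B="M * B"])
    fix t assume t: "t \<in> {a..b}"
    then have t0: "t \<in> {0..b}" using ab by auto
    from mult_mono[OF M[OF t] B[OF t0, of k]] M[OF t]
    show "\<bar>c t * fk k t\<bar> \<le> M * B" by (simp add: abs_mult)
  qed (rule disjI2, rule refl)
qed

text \<open>
  The equation of the mode \<open>k\<close> multiplied by \<open>uk k\<close> and integrated over the time interval.
\<close>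

lemma mode_identity:
  assumes ab: "0 \<le> a" "a < b"
  shows "eigval k * (\<integral>t. (uk k t)\<^sup>2 \<partial>lebesgue_on {a..b}) =
     (\<integral>t. (vk k t)\<^sup>2 \<partial>lebesgue_on {a..b}) - (\<integral>t. uk k t * fk k t \<partial>lebesgue_on {a..b})
     + coeff g k * (\<integral>t. uk k t \<partial>lebesgue_on {a..b})
     - (uk k b * vk k b - uk k a * vk k a)
     - (\<alpha> + \<gamma> * sqrt (eigval k)) / 2 * ((uk k b)\<^sup>2 - (uk k a)\<^sup>2)"
proof -
  let ?J = "lebesgue_on {a..b}"
  have sub: "{a..b} \<subseteq> {0..}" using ab by auto
  have uc: "continuous_on {a..b} (uk k)" and vc: "continuous_on {a..b} (vk k)"
    by (rule uk_cont[OF sub], rule vk_cont[OF sub])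
  have i: "integrable ?J (\<lambda>t. uk k t)" "integrable ?J (\<lambda>t. vk k t)" "integrable ?J (\<lambda>t. (uk k t)\<^sup>2)" "integrable ?J (\<lambda>t. (vk k t)\<^sup>2)"
    "integrable ?J (\<lambda>t. uk k t * vk k t)"
    by (intro continuous_integrable_interval continuous_intros uc vc)+
  have fi: "integrable ?J (\<lambda>t. uk k t * fk k t)" "integrable ?J (fk k)"
    using fk_mult_integrable[OF ab uc] fk_mult_integrable[OF ab, of "\<lambda>t. 1"] by simp_all
  have hi: "integrable ?J (hk k)"
    unfolding hk_def using i fi continuous_integrable_interval[of a b "\<lambda>t. coeff g k"] by simp
  have e: "vk k t * vk k t + uk k t * hk k t = (vk k t)\<^sup>2 + coeff g k * uk k t - eigval k * (uk k t)\<^sup>2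
      - (\<alpha> + \<gamma> * sqrt (eigval k)) * (uk k t * vk k t) - uk k t * fk k t" for t
    by (simp add: hk_def power2_eq_square algebra_simps)
  have zi: "integrable ?J (\<lambda>t. vk k t * vk k t + uk k t * hk k t)" unfolding e using i fi by simp
  have eqI: "integral {a..b} z = (\<integral>t. z t \<partial>?J)" "z integrable_on {a..b}" if "integrable ?J z" for z :: "real \<Rightarrow> real"
    using lebesgue_integral_eq_integral[OF that] integrable_on_lebesgue_on[OF that] by auto
  have ode: "uk k t - uk k a = integral {a..t} (vk k)" "vk k t - vk k a = integral {a..t} (hk k)" if "t \<in> {a..b}" for t
    using mode_odes[of a t k] ab that by (cases "t = a"; auto)+
  obtain M1 where M1: "\<And>t. t \<in> {a..b} \<Longrightarrow> \<bar>vk k t\<bar> \<le> M1"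
    using continuous_bounded_interval[OF vc] by blast
  let ?c = "\<lambda>t. coeff g k - eigval k * uk k t - (\<alpha> + \<gamma> * sqrt (eigval k)) * vk k t"
  have cc: "continuous_on {a..b} ?c" by (intro continuous_intros uc vc)
  obtain M2 where M2: "\<And>t. t \<in> {a..b} \<Longrightarrow> \<bar>?c t\<bar> \<le> M2"
    using continuous_bounded_interval[OF cc] by blast
  have b: "0 < b" using ab by simp
  obtain B where B: "\<And>t k. t \<in> {0..b} \<Longrightarrow> \<bar>fk k t\<bar> \<le> B" using fk_bounded[OF b] by blast
  have hb: "\<bar>hk k t\<bar> \<le> M2 + B" if "t \<in> {a..b}" for t
    using M2[OF that] B[of t k] that ab unfolding hk_def by auto
  define M where "M = max M1 (M2 + B)"
  have Mv: "\<bar>vk k t\<bar> \<le> M" "\<bar>hk k t\<bar> \<le> M" if "t \<in> {a..b}" for t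
    using M1[OF that] hb[OF that] by (auto simp: M_def)
  have "uk k b * vk k b - uk k a * vk k a = integral {a..b} (\<lambda>t. vk k t * vk k t + uk k t * hk k t)"
    by (rule lipschitz_product_rule[OF _ eqI(2)[OF i(2)] eqI(2)[OF hi] eqI(2)[OF zi] Mv ode]) (use ab in auto)
  also have "\<dots> = (\<integral>t. vk k t * vk k t + uk k t * hk k t \<partial>?J)" by (rule eqI(1)[OF zi])
  also have "\<dots> = (\<integral>t. (vk k t)\<^sup>2 \<partial>?J) + coeff g k * (\<integral>t. uk k t \<partial>?J) - eigval k * (\<integral>t. (uk k t)\<^sup>2 \<partial>?J)
      - (\<alpha> + \<gamma> * sqrt (eigval k)) * (\<integral>t. uk k t * vk k t \<partial>?J) - (\<integral>t. uk k t * fk k t \<partial>?J)"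
    unfolding e using i fi by simp
  finally have 1: "uk k b * vk k b - uk k a * vk k a = \<dots>" .
  have wi: "integrable ?J (\<lambda>t. vk k t * uk k t + uk k t * vk k t)" using i by (simp add: mult.commute)
  have "uk k b * uk k b - uk k a * uk k a = integral {a..b} (\<lambda>t. vk k t * uk k t + uk k t * vk k t)"
    by (rule lipschitz_product_rule[OF _ eqI(2)[OF i(2)] eqI(2)[OF i(2)] eqI(2)[OF wi] Mv(1) Mv(1) ode(1) ode(1)]) (use ab in auto)
  also have "\<dots> = 2 * (\<integral>t. uk k t * vk k t \<partial>?J)" unfolding eqI(1)[OF wi] using i by (simp add: mult.commute)
  finally have 2: "(\<integral>t. uk k t * vk k t \<partial>?J) = ((uk k b)\<^sup>2 - (uk k a)\<^sup>2) / 2" by (simp add: power2_eq_square)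
  have 3: "w * (d / 2) = w / 2 * d" for w d :: real by simp
  show ?thesis using 1 unfolding 2 3 by linarith
qed

text \<open>
  One summand for each term of the weighted energy identity: the velocity, the defect of monotonicity of
  \<open>f\<close>, the force, and the boundary terms of the product \<open>u v\<close> and of the damping.
\<close>

definition smoothing_bound :: "real \<Rightarrow> real \<Rightarrow> real \<Rightarrow> real" where
  "smoothing_bound E D L = 3 * D + 3 * K * (E\<^sup>2 * L) + 3/2 * ((E\<^sup>2 + L2_inner g g) * L) + 3 * E\<^sup>2 + 3/2 * (\<alpha> + \<gamma>) * E\<^sup>2"

text \<open>
  Since the weight is at most \<open>3 |k|\<close>, half a derivative can be put on each factor of a product.
\<close>

lemma defect_young:
  assumes N: "0 < N"
  shows "\<bar>fejer_defect N k * (x * y)\<bar> \<le> 3/2 * ((1 + eigval k) * x\<^sup>2 + y\<^sup>2)"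
    "fejer_defect N k \<le> 3 * (1 + eigval k)" "fejer_defect N k \<le> 3 * (1 + eigval k) powr (1/2)"
    "fejer_defect N k * ((\<alpha> + \<gamma> * sqrt (eigval k)) / 2) \<le> 3/2 * (\<alpha> + \<gamma>) * (1 + eigval k)"
proof -
  define s where "s = sqrt (eigval k)"
  have s: "0 \<le> s" "eigval k = s\<^sup>2" by (simp_all add: s_def)
  have m: "0 \<le> fejer_defect N k" "fejer_defect N k \<le> 3 * s"
    using fejer_defect_bounds(1,3)[OF N, of k] by (simp_all add: s_def)
  have s1: "s \<le> 1 + s\<^sup>2"
    using sum_squares_bound[of 1 s] s(1) by simp
  have "\<bar>fejer_defect N k * (x * y)\<bar> = fejer_defect N k * (\<bar>x\<bar> * \<bar>y\<bar>)" using m by (simp add: abs_mult)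
  also have "\<dots> \<le> 3 * s * (\<bar>x\<bar> * \<bar>y\<bar>)" using m by (intro mult_right_mono) auto
  also have "\<dots> = 3/2 * (2 * (s * \<bar>x\<bar>) * \<bar>y\<bar>)" by simp
  also have "\<dots> \<le> 3/2 * ((s * \<bar>x\<bar>)\<^sup>2 + \<bar>y\<bar>\<^sup>2)" using sum_squares_bound[of "s * \<bar>x\<bar>" "\<bar>y\<bar>"] by (intro mult_left_mono) auto
  also have "\<dots> \<le> 3/2 * ((1 + eigval k) * x\<^sup>2 + y\<^sup>2)" using s by (simp add: power_mult_distrib distrib_right)
  finally show "\<bar>fejer_defect N k * (x * y)\<bar> \<le> 3/2 * ((1 + eigval k) * x\<^sup>2 + y\<^sup>2)" .
  show "fejer_defect N k \<le> 3 * (1 + eigval k)" using m s s1 by simp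
  have "s \<le> sqrt (1 + eigval k)" by (simp add: s_def)
  then have "fejer_defect N k \<le> 3 * sqrt (1 + eigval k)" using m by linarith
  then show "fejer_defect N k \<le> 3 * (1 + eigval k) powr (1/2)" by (simp add: powr_half_sqrt)
  have "fejer_defect N k * ((\<alpha> + \<gamma> * s) / 2) \<le> 3 * s * ((\<alpha> + \<gamma> * s) / 2)"
    using m s \<alpha> \<gamma> by (intro mult_right_mono) auto
  also have "\<dots> = 3/2 * (\<alpha> * s + \<gamma> * s\<^sup>2)" by (simp add: power2_eq_square algebra_simps)
  also have "\<dots> \<le> 3/2 * (\<alpha> * (1 + s\<^sup>2) + \<gamma> * (1 + s\<^sup>2))"
    using s1 \<alpha> \<gamma> by (intro mult_left_mono add_mono) auto
  also have "\<dots> = 3/2 * (\<alpha> + \<gamma>) * (1 + eigval k)" using s by (simp add: algebra_simps)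
  finally show "fejer_defect N k * ((\<alpha> + \<gamma> * sqrt (eigval k)) / 2) \<le> 3/2 * (\<alpha> + \<gamma>) * (1 + eigval k)"
    by (simp add: s_def)
qed

text \<open>
  The mode identities are multiplied by the weights \<open>fejer_defect N k\<close> and added. Everything but the
  nonlinear term is bounded by energy norms; the latter is completed by \<open>K u\<^sup>2\<close> and kept on the right,
  where its sign becomes visible in the limit of all modes.
\<close>

lemma weighted_modes_bound:
  assumes ab: "0 \<le> a" "a < b" and E: "AE t in lebesgue_on {a..b}. energy_norm (u t) (v t) \<le> E" "0 \<le> E"
    and D: "\<And>F. finite F \<Longrightarrow> (\<Sum>k\<in>F. (1 + eigval k) powr (1/2) * (\<integral>t. (vk k t)\<^sup>2 \<partial>lebesgue_on {a..b})) \<le> D"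
    and N: "0 < N" and F: "finite F"
  shows "(\<Sum>k\<in>F. fejer_defect N k * (eigval k * (\<integral>t. (uk k t)\<^sup>2 \<partial>lebesgue_on {a..b})))
     \<le> smoothing_bound E D (b - a)
       - (\<integral>t. (\<Sum>k\<in>F. fejer_defect N k * (fk k t * uk k t + K * (uk k t)\<^sup>2)) \<partial>lebesgue_on {a..b})"
    "(\<Sum>k\<in>F. (1 + eigval k) * (\<integral>t. (uk k t)\<^sup>2 \<partial>lebesgue_on {a..b})) \<le> E\<^sup>2 * (b - a)"
proof -
  let ?J = "lebesgue_on {a..b}" and ?m = "fejer_defect N"
  let ?I = "\<lambda>c. \<integral>t. c t \<partial>?J"
  have sub: "{a..b} \<subseteq> {0..}" using ab by auto
  have uc: "continuous_on {a..b} (uk k)" and vc: "continuous_on {a..b} (vk k)" for k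
    by (rule uk_cont[OF sub], rule vk_cont[OF sub])
  have i: "integrable ?J (\<lambda>t. uk k t)" "integrable ?J (\<lambda>t. (uk k t)\<^sup>2)" "integrable ?J (\<lambda>t. (vk k t)\<^sup>2)" for k
    by (intro continuous_integrable_interval continuous_intros uc vc)+
  have fi: "integrable ?J (\<lambda>t. uk k t * fk k t)" for k by (rule fk_mult_integrable[OF ab uc])
  have one: "integrable ?J (\<lambda>t. c)" "?I (\<lambda>t. c) = c * (b - a)" for c :: real
    using ab by (auto intro!: continuous_integrable_interval simp: measure_restrict_space)
  have m0: "0 \<le> ?m k" for k by (rule fejer_defect_bounds(1)[OF N])
  have en: "(\<Sum>k\<in>F. (1 + eigval k) * (uk k t)\<^sup>2) + (\<Sum>k\<in>F. (vk k t)\<^sup>2) \<le> E\<^sup>2" if "t \<in> {a..b}" for t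
    by (rule mode_energy_bound[OF ab E that F])
  have en_u: "(\<Sum>k\<in>F. (1 + eigval k) * (uk k t)\<^sup>2) \<le> E\<^sup>2" if "t \<in> {a..b}" for t
    using en[OF that] sum_nonneg[of F "\<lambda>k. (vk k t)\<^sup>2"] by simp
  show X: "(\<Sum>k\<in>F. (1 + eigval k) * ?I (\<lambda>t. (uk k t)\<^sup>2)) \<le> E\<^sup>2 * (b - a)"
  proof -
    have "(\<Sum>k\<in>F. (1 + eigval k) * ?I (\<lambda>t. (uk k t)\<^sup>2)) = ?I (\<lambda>t. \<Sum>k\<in>F. (1 + eigval k) * (uk k t)\<^sup>2)"
      by (subst Bochner_Integration.integral_sum) (auto intro!: integrable_mult_right i)
    also have "\<dots> \<le> ?I (\<lambda>t. E\<^sup>2)"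
      by (rule integral_mono) (auto intro!: Bochner_Integration.integrable_sum integrable_mult_right i one en_u)
    finally show ?thesis unfolding one(2) .
  qed
  have I0: "0 \<le> ?I (\<lambda>t. (c t)\<^sup>2)" for c :: "real \<Rightarrow> real" by (rule integral_nonneg_AE) simp
  have t1: "(\<Sum>k\<in>F. ?m k * ?I (\<lambda>t. (vk k t)\<^sup>2)) \<le> 3 * D"
  proof -
    have "(\<Sum>k\<in>F. ?m k * ?I (\<lambda>t. (vk k t)\<^sup>2)) \<le> (\<Sum>k\<in>F. 3 * (1 + eigval k) powr (1/2) * ?I (\<lambda>t. (vk k t)\<^sup>2))"
      by (intro sum_mono mult_right_mono defect_young(3)[OF N] I0)
    also have "\<dots> = 3 * (\<Sum>k\<in>F. (1 + eigval k) powr (1/2) * ?I (\<lambda>t. (vk k t)\<^sup>2))" by (simp add: sum_distrib_left mult.assoc)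
    finally show ?thesis using D[OF F] by simp
  qed
  have t2: "K * (\<Sum>k\<in>F. ?m k * ?I (\<lambda>t. (uk k t)\<^sup>2)) \<le> 3 * K * (E\<^sup>2 * (b - a))"
  proof -
    have "(\<Sum>k\<in>F. ?m k * ?I (\<lambda>t. (uk k t)\<^sup>2)) \<le> (\<Sum>k\<in>F. 3 * (1 + eigval k) * ?I (\<lambda>t. (uk k t)\<^sup>2))"
      by (intro sum_mono mult_right_mono defect_young(2)[OF N] I0)
    also have "\<dots> = 3 * (\<Sum>k\<in>F. (1 + eigval k) * ?I (\<lambda>t. (uk k t)\<^sup>2))" by (simp only: sum_distrib_left mult.assoc)
    also have "\<dots> \<le> 3 * (E\<^sup>2 * (b - a))" using X by simp
    finally have "K * (\<Sum>k\<in>F. ?m k * ?I (\<lambda>t. (uk k t)\<^sup>2)) \<le> K * (3 * (E\<^sup>2 * (b - a)))"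
      by (rule mult_left_mono) (rule K_nonneg)
    then show ?thesis by (simp add: mult_ac)
  qed
  have t3: "(\<Sum>k\<in>F. ?m k * (coeff g k * ?I (uk k))) \<le> 3/2 * ((E\<^sup>2 + L2_inner g g) * (b - a))"
  proof -
    have "?m k * (coeff g k * ?I (uk k)) \<le> 3/2 * ((1 + eigval k) * ?I (\<lambda>t. (uk k t)\<^sup>2) + (coeff g k)\<^sup>2 * (b - a))" for k
    proof -
      have "?m k * (coeff g k * ?I (uk k)) = ?I (\<lambda>t. ?m k * (uk k t * coeff g k))" using i by simp
      also have "\<dots> \<le> ?I (\<lambda>t. 3/2 * ((1 + eigval k) * (uk k t)\<^sup>2 + (coeff g k)\<^sup>2))"
      proof (rule integral_mono)
        show "?m k * (uk k t * coeff g k) \<le> 3/2 * ((1 + eigval k) * (uk k t)\<^sup>2 + (coeff g k)\<^sup>2)" for t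
          using defect_young(1)[OF N, of k "uk k t" "coeff g k"] by linarith
      qed (use i one in auto)
      also have "\<dots> = 3/2 * ((1 + eigval k) * ?I (\<lambda>t. (uk k t)\<^sup>2) + (coeff g k)\<^sup>2 * (b - a))"
        using i(2)[of k] one[of "(coeff g k)\<^sup>2"] by simp
      finally show ?thesis .
    qed
    then have "(\<Sum>k\<in>F. ?m k * (coeff g k * ?I (uk k))) \<le> (\<Sum>k\<in>F. 3/2 * ((1 + eigval k) * ?I (\<lambda>t. (uk k t)\<^sup>2) + (coeff g k)\<^sup>2 * (b - a)))"
      by (intro sum_mono)
    also have "\<dots> = 3/2 * ((\<Sum>k\<in>F. (1 + eigval k) * ?I (\<lambda>t. (uk k t)\<^sup>2)) + (\<Sum>k\<in>F. (coeff g k)\<^sup>2) * (b - a))"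
      by (simp only: sum_distrib_left[symmetric] sum_distrib_right sum.distrib)
    also have "\<dots> \<le> 3/2 * (E\<^sup>2 * (b - a) + L2_inner g g * (b - a))"
      using X bessel[OF g F] ab by (intro mult_left_mono add_mono mult_right_mono) auto
    finally show ?thesis by (simp add: distrib_right)
  qed
  have t4: "(\<Sum>k\<in>F. \<bar>?m k * (uk k t * vk k t)\<bar>) \<le> 3/2 * E\<^sup>2" if t: "t \<in> {a..b}" for t
  proof -
    have "(\<Sum>k\<in>F. \<bar>?m k * (uk k t * vk k t)\<bar>) \<le> (\<Sum>k\<in>F. 3/2 * ((1 + eigval k) * (uk k t)\<^sup>2 + (vk k t)\<^sup>2))"
      by (intro sum_mono defect_young(1)[OF N])
    also have "\<dots> = 3/2 * ((\<Sum>k\<in>F. (1 + eigval k) * (uk k t)\<^sup>2) + (\<Sum>k\<in>F. (vk k t)\<^sup>2))"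
      by (simp only: sum_distrib_left[symmetric] sum.distrib)
    finally show ?thesis using en[OF t] by simp
  qed
  have t5: "(\<Sum>k\<in>F. ?m k * ((\<alpha> + \<gamma> * sqrt (eigval k)) / 2) * (uk k a)\<^sup>2) \<le> 3/2 * (\<alpha> + \<gamma>) * E\<^sup>2"
  proof -
    have "(\<Sum>k\<in>F. ?m k * ((\<alpha> + \<gamma> * sqrt (eigval k)) / 2) * (uk k a)\<^sup>2) \<le> (\<Sum>k\<in>F. 3/2 * (\<alpha> + \<gamma>) * (1 + eigval k) * (uk k a)\<^sup>2)"
      by (intro sum_mono mult_right_mono defect_young(4)[OF N]) simp
    also have "\<dots> = 3/2 * (\<alpha> + \<gamma>) * (\<Sum>k\<in>F. (1 + eigval k) * (uk k a)\<^sup>2)" by (simp add: sum_distrib_left mult.assoc)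
    also have "\<dots> \<le> 3/2 * (\<alpha> + \<gamma>) * E\<^sup>2" using en_u[of a] ab \<alpha> \<gamma> by (intro mult_left_mono) auto
    finally show ?thesis .
  qed
  have id: "?m k * (eigval k * ?I (\<lambda>t. (uk k t)\<^sup>2)) \<le> ?m k * ?I (\<lambda>t. (vk k t)\<^sup>2)
      - ?m k * (?I (\<lambda>t. uk k t * fk k t) + K * ?I (\<lambda>t. (uk k t)\<^sup>2)) + K * (?m k * ?I (\<lambda>t. (uk k t)\<^sup>2))
      + ?m k * (coeff g k * ?I (uk k)) + \<bar>?m k * (uk k b * vk k b)\<bar> + \<bar>?m k * (uk k a * vk k a)\<bar>
      + ?m k * ((\<alpha> + \<gamma> * sqrt (eigval k)) / 2) * (uk k a)\<^sup>2" for k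
  proof -
    have "0 \<le> ?m k * ((\<alpha> + \<gamma> * sqrt (eigval k)) / 2) * (uk k b)\<^sup>2"
      using m0[of k] \<alpha> \<gamma> by (intro mult_nonneg_nonneg) auto
    moreover have "?m k * (eigval k * ?I (\<lambda>t. (uk k t)\<^sup>2)) = ?m k * ?I (\<lambda>t. (vk k t)\<^sup>2)
      - ?m k * (?I (\<lambda>t. uk k t * fk k t) + K * ?I (\<lambda>t. (uk k t)\<^sup>2)) + K * (?m k * ?I (\<lambda>t. (uk k t)\<^sup>2))
      + ?m k * (coeff g k * ?I (uk k)) - ?m k * (uk k b * vk k b) + ?m k * (uk k a * vk k a)
      - ?m k * ((\<alpha> + \<gamma> * sqrt (eigval k)) / 2) * (uk k b)\<^sup>2 + ?m k * ((\<alpha> + \<gamma> * sqrt (eigval k)) / 2) * (uk k a)\<^sup>2"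
      unfolding mode_identity[OF ab] by (simp add: algebra_simps)
    ultimately show ?thesis by linarith
  qed
  have P: "?I (\<lambda>t. \<Sum>k\<in>F. ?m k * (fk k t * uk k t + K * (uk k t)\<^sup>2)) = (\<Sum>k\<in>F. ?m k * (?I (\<lambda>t. uk k t * fk k t) + K * ?I (\<lambda>t. (uk k t)\<^sup>2)))"
    using i(2) fi by (subst Bochner_Integration.integral_sum) (auto simp: mult.commute[of "fk _ _"])
  have "(\<Sum>k\<in>F. ?m k * (eigval k * ?I (\<lambda>t. (uk k t)\<^sup>2))) \<le> (\<Sum>k\<in>F. ?m k * ?I (\<lambda>t. (vk k t)\<^sup>2)
      - ?m k * (?I (\<lambda>t. uk k t * fk k t) + K * ?I (\<lambda>t. (uk k t)\<^sup>2)) + K * (?m k * ?I (\<lambda>t. (uk k t)\<^sup>2))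
      + ?m k * (coeff g k * ?I (uk k)) + \<bar>?m k * (uk k b * vk k b)\<bar> + \<bar>?m k * (uk k a * vk k a)\<bar>
      + ?m k * ((\<alpha> + \<gamma> * sqrt (eigval k)) / 2) * (uk k a)\<^sup>2)"
    by (rule sum_mono) (rule id)
  also have "\<dots> = (\<Sum>k\<in>F. ?m k * ?I (\<lambda>t. (vk k t)\<^sup>2))
      - (\<Sum>k\<in>F. ?m k * (?I (\<lambda>t. uk k t * fk k t) + K * ?I (\<lambda>t. (uk k t)\<^sup>2))) + K * (\<Sum>k\<in>F. ?m k * ?I (\<lambda>t. (uk k t)\<^sup>2))
      + (\<Sum>k\<in>F. ?m k * (coeff g k * ?I (uk k))) + (\<Sum>k\<in>F. \<bar>?m k * (uk k b * vk k b)\<bar>) + (\<Sum>k\<in>F. \<bar>?m k * (uk k a * vk k a)\<bar>)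
      + (\<Sum>k\<in>F. ?m k * ((\<alpha> + \<gamma> * sqrt (eigval k)) / 2) * (uk k a)\<^sup>2)"
    by (simp only: sum.distrib sum_subtractf sum_distrib_left)
  finally show "(\<Sum>k\<in>F. ?m k * (eigval k * ?I (\<lambda>t. (uk k t)\<^sup>2)))
     \<le> smoothing_bound E D (b - a) - ?I (\<lambda>t. \<Sum>k\<in>F. ?m k * (fk k t * uk k t + K * (uk k t)\<^sup>2))"
    unfolding P smoothing_bound_def using t1 t2 t3 t4[of a] t4[of b] t5 ab by simp
qed

text \<open>
  First let the number of modes tend to infinity for a fixed Fejer parameter \<open>N\<close>: by dominated convergence
  the nonlinear term tends to a nonnegative limit and can be dropped. On the given finite set of
  frequencies the weights dominate the height, because \<open>N\<close> is chosen larger than all heights there.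
\<close>

lemma height_weighted_bound:
  assumes ab: "0 \<le> a" "a < b" and E: "AE t in lebesgue_on {a..b}. energy_norm (u t) (v t) \<le> E" "0 \<le> E"
    and D: "\<And>F. finite F \<Longrightarrow> (\<Sum>k\<in>F. (1 + eigval k) powr (1/2) * (\<integral>t. (vk k t)\<^sup>2 \<partial>lebesgue_on {a..b})) \<le> D"
    and F: "finite F"
  shows "(\<Sum>k\<in>F. real (height k) * (eigval k * (\<integral>t. (uk k t)\<^sup>2 \<partial>lebesgue_on {a..b}))) \<le> smoothing_bound E D (b - a)"
proof -
  let ?J = "lebesgue_on {a..b}"
  let ?I = "\<lambda>k. \<integral>t. (uk k t)\<^sup>2 \<partial>?J"
  (* any positive number above the heights in F will do *)
  define N where "N = Suc (\<Sum>k\<in>F. height k)"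
  have N: "0 < N" by (simp add: N_def)
  have hN: "height k \<le> N" if "k \<in> F" for k
    using member_le_sum[of k F height] that F by (simp add: N_def)
  let ?m = "fejer_defect N"
  have sub: "{a..b} \<subseteq> {0..}" using ab by auto
  have uc: "continuous_on {a..b} (uk k)" for k by (rule uk_cont[OF sub])
  have I0: "0 \<le> eigval k * ?I k" for k by (intro mult_nonneg_nonneg integral_nonneg_AE) auto
  define P where "P M t = (\<Sum>k\<in>low M. ?m k * (fk k t * uk k t + K * (uk k t)\<^sup>2))" for M t
  define L where "L t = lim (\<lambda>M. P M t)" for t
  have Lt: "0 \<le> L t" "(\<lambda>M. P M t) \<longlonglongrightarrow> L t" if t: "t \<in> {a..b}" for t
  proof -
    obtain l where l: "0 \<le> l" "(\<lambda>M. P M t) \<longlonglongrightarrow> l"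
      using fejer_dissipative[OF h1_bounded_U[OF ab E t] N] unfolding P_def fk_def uk_def by blast
    then have "L t = l" unfolding L_def by (intro limI)
    then show "0 \<le> L t" "(\<lambda>M. P M t) \<longlonglongrightarrow> L t" using l by simp_all
  qed
  define H where "H = E\<^sup>2 + 1"
  define Bd where "Bd = A * ((2*pi)^3 + sobolev_const * H^3 + 2 * (sobolev_const * (((real N)\<^sup>2 + 1) * H)^3)) + K * (real N * H)"
  have PB: "\<bar>P M t\<bar> \<le> Bd" if t: "t \<in> {a..b}" for M t
  proof -
    have hb: "h1_bounded H (U t)" unfolding H_def by (rule h1_bounded_U[OF ab E t])
    have m: "\<bar>?m k\<bar> \<le> real N" for k using fejer_defect_bounds(1,2)[OF N, of k] by simp
    have 1: "\<bar>\<Sum>k\<in>low M. ?m k * (fk k t * uk k t)\<bar> \<le> A * ((2*pi)^3 + sobolev_const * H^3 + 2 * (sobolev_const * (((real N)\<^sup>2 + 1) * H)^3))"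
      unfolding fk_def uk_def by (rule weighted_pairing_bound[OF hb _ m]) simp
    have "(\<Sum>k\<in>low M. ?m k * (uk k t)\<^sup>2) \<le> (\<Sum>k\<in>low M. real N * ((1 + eigval k) * (uk k t)\<^sup>2))"
    proof (rule sum_mono)
      fix k
      have "?m k * (uk k t)\<^sup>2 \<le> real N * (uk k t)\<^sup>2" using m[of k] by (intro mult_right_mono) auto
      also have "\<dots> \<le> real N * ((1 + eigval k) * (uk k t)\<^sup>2)"
        by (intro mult_left_mono) (simp_all add: distrib_right)
      finally show "?m k * (uk k t)\<^sup>2 \<le> real N * ((1 + eigval k) * (uk k t)\<^sup>2)" .
    qed
    also have "\<dots> \<le> real N * H"
    proof -
      have "(\<Sum>k\<in>low M. (1 + eigval k) * (uk k t)\<^sup>2) \<le> h1_sum (coeff (U t))"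
        unfolding uk_def by (rule finite_sum_le_infsum) (use hb in \<open>auto simp: h1_bounded_def\<close>)
      also have "\<dots> \<le> H" using hb by (simp add: h1_bounded_def)
      finally show ?thesis unfolding sum_distrib_left[symmetric] by (intro mult_left_mono) auto
    qed
    finally have 2: "(\<Sum>k\<in>low M. ?m k * (uk k t)\<^sup>2) \<le> real N * H" .
    have 3: "0 \<le> (\<Sum>k\<in>low M. ?m k * (uk k t)\<^sup>2)"
      using fejer_defect_bounds(1)[OF N] by (intro sum_nonneg) simp
    have 4: "K * (\<Sum>k\<in>low M. ?m k * (uk k t)\<^sup>2) \<le> K * (real N * H)" "0 \<le> K * (\<Sum>k\<in>low M. ?m k * (uk k t)\<^sup>2)"
      using 2 3 K_nonneg by (auto intro: mult_left_mono)
    have "P M t = (\<Sum>k\<in>low M. ?m k * (fk k t * uk k t)) + K * (\<Sum>k\<in>low M. ?m k * (uk k t)\<^sup>2)"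
      unfolding P_def sum_distrib_left sum.distrib[symmetric] by (simp add: algebra_simps)
    then show ?thesis using 1 4 unfolding Bd_def by linarith
  qed
  have Pi: "integrable ?J (P M)" for M
  proof -
    have "integrable ?J (\<lambda>t. fk k t * uk k t)" "integrable ?J (\<lambda>t. (uk k t)\<^sup>2)" for k
      using fk_mult_integrable[OF ab uc, of k k] continuous_integrable_interval[OF continuous_on_power[OF uc]]
      by (simp_all add: mult.commute)
    then show ?thesis unfolding P_def
      by (intro Bochner_Integration.integrable_sum integrable_mult_right Bochner_Integration.integrable_add)
  qed
  have Lm: "L \<in> borel_measurable ?J" unfolding L_def
    by (rule borel_measurable_lim_metric) (rule borel_measurable_integrable[OF Pi])
  have lim: "(\<lambda>M. \<integral>t. P M t \<partial>?J) \<longlonglongrightarrow> (\<integral>t. L t \<partial>?J)"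
  proof (rule integral_dominated_convergence[where w="\<lambda>t. Bd", OF Lm borel_measurable_integrable[OF Pi]])
    show "integrable ?J (\<lambda>t. Bd)" by (rule continuous_integrable_interval) simp
    show "AE t in ?J. (\<lambda>M. P M t) \<longlonglongrightarrow> L t" by (rule AE_I2) (use Lt in simp)
    show "AE t in ?J. norm (P M t) \<le> Bd" for M by (rule AE_I2) (use PB in simp)
  qed
  have L0: "0 \<le> (\<integral>t. L t \<partial>?J)" by (intro integral_nonneg_AE AE_I2) (use Lt in simp)
  have "\<forall>\<^sub>F M in sequentially. (\<Sum>k\<in>F. real (height k) * (eigval k * ?I k)) \<le> smoothing_bound E D (b - a) - (\<integral>t. P M t \<partial>?J)"
  proof -
    have "\<forall>\<^sub>F M in sequentially. F \<subseteq> low M"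
      using filterlim_low F unfolding filterlim_finite_subsets_at_top by (auto elim: eventually_mono)
    then show ?thesis
    proof eventually_elim
      case (elim M)
      have "(\<Sum>k\<in>F. real (height k) * (eigval k * ?I k)) \<le> (\<Sum>k\<in>F. ?m k * (eigval k * ?I k))"
        by (intro sum_mono mult_right_mono fejer_defect_bounds(4)[OF N] hN I0)
      also have "\<dots> \<le> (\<Sum>k\<in>low M. ?m k * (eigval k * ?I k))"
        by (rule sum_mono2[OF finite_low elim]) (use fejer_defect_bounds(1)[OF N] I0 in auto)
      also have "\<dots> \<le> smoothing_bound E D (b - a) - (\<integral>t. P M t \<partial>?J)"
        unfolding P_def by (rule weighted_modes_bound(1)[OF ab E D N finite_low])
      finally show ?case .
    qed
  qed
  then have "(\<Sum>k\<in>F. real (height k) * (eigval k * ?I k)) \<le> smoothing_bound E D (b - a) - (\<integral>t. L t \<partial>?J)"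
    by (rule tendsto_lowerbound[OF tendsto_diff[OF tendsto_const lim]]) simp
  then show ?thesis using L0 by linarith
qed

section \<open>The smoothing estimate\<close>

lemma weight_32: "(1 + eigval k) powr (3/2) \<le> 2 * (1 + eigval k) + 2 * (real (height k) * eigval k)"
proof -
  define s where "s = sqrt (eigval k)"
  have s: "0 \<le> s" "eigval k = s\<^sup>2" by (simp_all add: s_def)
  have "s\<^sup>2 \<le> (2 * real (height k))\<^sup>2" 
  proof -
    have "(2 * real (height k))\<^sup>2 = 4 * (real (height k))\<^sup>2" by (simp add: power_mult_distrib)
    moreover have "0 \<le> (real (height k))\<^sup>2" by simp
    ultimately show ?thesis using eigval_le_height[of k] s by linarith
  qed
  then have sh: "s \<le> 2 * real (height k)" by (rule power2_le_imp_le) simp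
  have s1: "s \<le> 1 + s\<^sup>2" using sum_squares_bound[of 1 s] s(1) by simp
  have "(1 + eigval k) powr (3/2) = (1 + eigval k) powr (1 + 1/2)" by simp
  also have "\<dots> = (1 + eigval k) * sqrt (1 + eigval k)"
    by (subst powr_add) (simp add: powr_half_sqrt)
  also have "\<dots> \<le> (1 + eigval k) * (1 + s)"
    using sqrt_add_le_add_sqrt[of 1 "eigval k"] by (intro mult_left_mono) (auto simp: s_def)
  also have "\<dots> = (1 + eigval k) + s + eigval k * s" by (simp add: algebra_simps)
  also have "\<dots> \<le> (1 + eigval k) + (1 + eigval k) + eigval k * (2 * real (height k))"
    using s1 s sh by (intro add_mono mult_left_mono) auto
  finally show ?thesis by (simp add: mult_ac)
qed

text \<open>
  Monotone convergence over the frequencies turns the bounds for finite sums of modes into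
  \<open>H\<^sup>3\<^sup>/\<^sup>2\<close> regularity at almost every time.
\<close>

theorem H32_smoothing:
  assumes ab: "0 \<le> a" "a < b" and E: "AE t in lebesgue_on {a..b}. energy_norm (u t) (v t) \<le> E" "0 \<le> E"
    and D: "(\<integral>t. (Hs_norm (1/2) (v t))\<^sup>2 \<partial>lebesgue_on {a..b}) \<le> D"
  shows "AE t in lebesgue_on {a..b}. Hs (3/2) (u t)"
    "integrable (lebesgue_on {a..b}) (\<lambda>t. (Hs_norm (3/2) (u t))\<^sup>2)"
    "(\<integral>t. (Hs_norm (3/2) (u t))\<^sup>2 \<partial>lebesgue_on {a..b}) \<le> 2 * (E\<^sup>2 * (b - a)) + 2 * smoothing_bound E D (b - a)"
proof -
  let ?J = "lebesgue_on {a..b}"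
  let ?I = "\<lambda>c. \<integral>t. c t \<partial>?J"
  have b1: "0 < b + 1" using ab by simp
  have sub: "{a..b} \<subseteq> {0..}" using ab by auto
  have uc: "continuous_on {a..b} (uk k)" and vc: "continuous_on {a..b} (vk k)" for k
    by (rule uk_cont[OF sub], rule vk_cont[OF sub])
  have i: "integrable ?J (\<lambda>t. (uk k t)\<^sup>2)" "integrable ?J (\<lambda>t. (vk k t)\<^sup>2)" for k
    by (intro continuous_integrable_interval continuous_intros uc vc)+
  note ae = AE_interval_transfer[OF AE_modes[of "b + 1"] ab(1) less_add_one]
  have D': "(\<Sum>k\<in>F. (1 + eigval k) powr (1/2) * ?I (\<lambda>t. (vk k t)\<^sup>2)) \<le> D" if F: "finite F" for F
  proof -
    have "(\<Sum>k\<in>F. (1 + eigval k) powr (1/2) * ?I (\<lambda>t. (vk k t)\<^sup>2)) = ?I (\<lambda>t. \<Sum>k\<in>F. (1 + eigval k) powr (1/2) * (vk k t)\<^sup>2)"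
      by (subst Bochner_Integration.integral_sum) (auto intro!: integrable_mult_right i)
    also have "\<dots> \<le> ?I (\<lambda>t. (Hs_norm (1/2) (v t))\<^sup>2)"
    proof (rule integral_mono_AE)
      show "integrable ?J (\<lambda>t. \<Sum>k\<in>F. (1 + eigval k) powr (1/2) * (vk k t)\<^sup>2)"
        by (intro Bochner_Integration.integrable_sum integrable_mult_right i)
      show "integrable ?J (\<lambda>t. (Hs_norm (1/2) (v t))\<^sup>2)"
        by (rule integrable_interval_transfer[where T="b + 1"]) (use vHs[OF b1] ab in \<open>auto simp: L2_Hs_def\<close>)
      have "AE t in ?J. Hs (1/2) (v t)"
        by (rule AE_interval_transfer[where T="b + 1"]) (use vHs[OF b1] ab in \<open>auto simp: L2_Hs_def\<close>)
      with ae show "AE t in ?J. (\<Sum>k\<in>F. (1 + eigval k) powr (1/2) * (vk k t)\<^sup>2) \<le> (Hs_norm (1/2) (v t))\<^sup>2"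
      proof eventually_elim
        case (elim t)
        then have s: "(\<lambda>k. (1 + eigval k) powr (1/2) * (coeff (v t) k)\<^sup>2) summable_on UNIV" unfolding Hs_def by blast
        have "(\<Sum>k\<in>F. (1 + eigval k) powr (1/2) * (coeff (v t) k)\<^sup>2) \<le> (Hs_norm (1/2) (v t))\<^sup>2"
          unfolding Hs_norm_sq by (rule finite_sum_le_infsum[OF s F]) auto
        then show ?case using elim by simp
      qed
    qed
    finally show ?thesis using D by linarith
  qed
  define R where "R = 2 * (E\<^sup>2 * (b - a)) + 2 * smoothing_bound E D (b - a)"
  define S where "S M t = (\<Sum>k\<in>low M. (1 + eigval k) powr (3/2) * (uk k t)\<^sup>2)" for M t
  have I0: "0 \<le> ?I (\<lambda>t. (uk k t)\<^sup>2)" for k by (intro integral_nonneg_AE) auto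
  have Si: "integrable ?J (S M)" for M unfolding S_def
    by (intro Bochner_Integration.integrable_sum integrable_mult_right i)
  have S0: "0 \<le> S M t" for M t unfolding S_def by (rule sum_nonneg) simp
  have SR: "?I (S M) \<le> R" for M
  proof -
    have "?I (S M) = (\<Sum>k\<in>low M. (1 + eigval k) powr (3/2) * ?I (\<lambda>t. (uk k t)\<^sup>2))"
      unfolding S_def by (subst Bochner_Integration.integral_sum) (auto intro!: integrable_mult_right i)
    also have "\<dots> \<le> (\<Sum>k\<in>low M. (2 * (1 + eigval k) + 2 * (real (height k) * eigval k)) * ?I (\<lambda>t. (uk k t)\<^sup>2))"
      by (intro sum_mono mult_right_mono weight_32 I0)
    also have "\<dots> = 2 * (\<Sum>k\<in>low M. (1 + eigval k) * ?I (\<lambda>t. (uk k t)\<^sup>2)) + 2 * (\<Sum>k\<in>low M. real (height k) * (eigval k * ?I (\<lambda>t. (uk k t)\<^sup>2)))"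
      unfolding sum_distrib_left sum.distrib[symmetric] by (simp add: algebra_simps)
    also have "\<dots> \<le> R"
      using weighted_modes_bound(2)[OF ab E D' _ finite_low, of 1 M] height_weighted_bound[OF ab E D' finite_low, of M]
      unfolding R_def by simp
    finally show ?thesis .
  qed
  have R0: "0 \<le> R" using SR[of 0] by (simp add: S_def)
  have S_mono: "M \<le> M' \<Longrightarrow> S M t \<le> S M' t" for M M' t
    unfolding S_def by (rule sum_mono2[OF finite_low]) (auto simp: low_def)
  have nn: "(\<integral>\<^sup>+t. (SUP M. ennreal (S M t)) \<partial>?J) \<le> ennreal R"
  proof -
    have "(\<integral>\<^sup>+t. (SUP M. ennreal (S M t)) \<partial>?J) = (SUP M. \<integral>\<^sup>+t. ennreal (S M t) \<partial>?J)"
      by (rule nn_integral_monotone_convergence_SUP)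
        (use borel_measurable_integrable[OF Si] S_mono in \<open>auto simp: incseq_def le_fun_def intro!: ennreal_leI measurable_compose[OF _ measurable_ennreal]\<close>)
    also have "\<dots> \<le> ennreal R"
      by (rule SUP_least) (simp add: nn_integral_eq_integral Si S0 SR ennreal_leI)
    finally show ?thesis .
  qed
  have aeS: "AE t in ?J. (SUP M. ennreal (S M t)) \<noteq> \<infinity>"
    by (rule nn_integral_PInf_AE)
      (use borel_measurable_integrable[OF Si] nn in \<open>auto simp: top_unique intro!: measurable_compose[OF _ measurable_ennreal] borel_measurable_SUP\<close>)
  define Z where "Z t = lim (\<lambda>M. S M t)" for t
  have Zm: "Z \<in> borel_measurable ?J" unfolding Z_def
    by (rule borel_measurable_lim_metric) (rule borel_measurable_integrable[OF Si])
  have main: "AE t in ?J. Hs (3/2) (u t) \<and> (Hs_norm (3/2) (u t))\<^sup>2 = Z t \<and> ennreal (Z t) \<le> (SUP M. ennreal (S M t))"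
    using aeS ae
  proof eventually_elim
    case (elim t)
    obtain B where B: "(SUP M. ennreal (S M t)) = ennreal B" "0 \<le> B"
      using elim by (cases "SUP M. ennreal (S M t)") auto
    have SB: "S M t \<le> B" for M
    proof -
      have "ennreal (S M t) \<le> ennreal B" unfolding B(1)[symmetric] by (rule SUP_upper) simp
      then show ?thesis using B(2) by (simp add: ennreal_le_iff)
    qed
    have s: "(\<lambda>k. (1 + eigval k) powr (3/2) * (uk k t)\<^sup>2) summable_on UNIV"
    proof (rule nonneg_bdd_above_summable_on)
      show "bdd_above (sum (\<lambda>k. (1 + eigval k) powr (3/2) * (uk k t)\<^sup>2) ` {F. F \<subseteq> UNIV \<and> finite F})"
      proof (rule bdd_aboveI2[where M=B])
        fix F :: "(int^3) set" assume "F \<in> {F. F \<subseteq> UNIV \<and> finite F}"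
        then have F: "finite F" by simp
        have "\<forall>\<^sub>F M in sequentially. F \<subseteq> low M"
          using filterlim_low F unfolding filterlim_finite_subsets_at_top by (auto elim: eventually_mono)
        then obtain M where "F \<subseteq> low M" unfolding eventually_sequentially by blast
        then have "(\<Sum>k\<in>F. (1 + eigval k) powr (3/2) * (uk k t)\<^sup>2) \<le> S M t" unfolding S_def
          by (intro sum_mono2) auto
        then show "(\<Sum>k\<in>F. (1 + eigval k) powr (3/2) * (uk k t)\<^sup>2) \<le> B" using SB[of M] by linarith
      qed
    qed simp
    have lim: "(\<lambda>M. S M t) \<longlonglongrightarrow> (\<Sum>\<^sub>\<infinity>k. (1 + eigval k) powr (3/2) * (uk k t)\<^sup>2)"
      unfolding S_def by (rule has_sum_imp_low_limit[OF has_sum_infsum[OF s]])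
    then have Z: "Z t = (\<Sum>\<^sub>\<infinity>k. (1 + eigval k) powr (3/2) * (uk k t)\<^sup>2)" unfolding Z_def by (rule limI)
    have "Z t \<le> B" unfolding Z by (rule LIMSEQ_le_const2[OF lim]) (use SB in auto)
    then have "ennreal (Z t) \<le> (SUP M. ennreal (S M t))" unfolding B(1) by (rule ennreal_leI)
    moreover have "L2_torus (u t)" using elim by (auto simp: Hs_def)
    ultimately show ?case using s Z elim by (simp add: Hs_def Hs_norm_sq)
  qed
  then show "AE t in ?J. Hs (3/2) (u t)" by eventually_elim simp
  from main have Z0: "AE t in ?J. 0 \<le> Z t"
    by eventually_elim (metis zero_le_power2)
  have "(\<integral>\<^sup>+t. ennreal (Z t) \<partial>?J) \<le> (\<integral>\<^sup>+t. (SUP M. ennreal (S M t)) \<partial>?J)"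
    by (rule nn_integral_mono_AE) (use main in eventually_elim, simp)
  then have nnZ: "(\<integral>\<^sup>+t. ennreal (Z t) \<partial>?J) \<le> ennreal R" using nn by (rule order_trans)
  have Zi: "integrable ?J Z"
    by (rule integrableI_nonneg[OF Zm Z0]) (use nnZ in \<open>auto simp: le_less_trans ennreal_less_top\<close>)
  have "ennreal (?I Z) \<le> ennreal R" using nn_integral_eq_integral[OF Zi Z0] nnZ by simp
  then have IZ: "?I Z \<le> R" using R0 by (simp add: ennreal_le_iff)
  have eq: "AE t in ?J. (Hs_norm (3/2) (u t))\<^sup>2 = Z t" using main by eventually_elim simp
  show "integrable ?J (\<lambda>t. (Hs_norm (3/2) (u t))\<^sup>2)"
    by (rule integral_lebesgue_on_cong_AE(2)[OF _ Zm eq Zi]) simp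
  have "?I (\<lambda>t. (Hs_norm (3/2) (u t))\<^sup>2) = ?I Z"
    by (rule integral_lebesgue_on_cong_AE(1)[OF _ Zm eq]) simp
  then show "?I (\<lambda>t. (Hs_norm (3/2) (u t))\<^sup>2) \<le> 2 * (E\<^sup>2 * (b - a)) + 2 * smoothing_bound E D (b - a)"
    using IZ unfolding R_def by linarith
qed

end

text \<open>
  The mean value theorem turns the derivative bounds into growth and monotonicity.
\<close>

lemma C1_quintic_nonlinearity:
  fixes f :: "real \<Rightarrow> real"
  assumes C: "0 < C" and K: "0 < K" and f: "f C1_differentiable_on UNIV"
    and lower: "\<And>s. deriv f s \<ge> - K" and upper: "\<And>s. \<bar>deriv f s\<bar> \<le> C * (1 + \<bar>s\<bar> ^ 4)"
  shows "quintic_nonlinearity f (\<bar>f 0\<bar> + 2 * C) K"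
proof
  have d: "(f has_real_derivative deriv f s) (at s)" for s
  proof -
    obtain D where "\<And>x. (f has_vector_derivative D x) (at x)"
      using f unfolding C1_differentiable_on_def by auto
    then have "(f has_real_derivative D s) (at s)" by (simp add: has_real_derivative_iff_has_vector_derivative)
    then show ?thesis using DERIV_imp_deriv by metis
  qed
  show "continuous_on UNIV f"
    using d DERIV_isCont by (auto intro!: continuous_at_imp_continuous_on)
  show "0 \<le> \<bar>f 0\<bar> + 2 * C" "0 \<le> K" using C K by auto
  show "\<bar>f s\<bar> \<le> (\<bar>f 0\<bar> + 2 * C) * (1 + \<bar>s\<bar>^5)" for s
  proof -
    have "\<bar>f s - f 0\<bar> \<le> C * (1 + \<bar>s\<bar>^4) * \<bar>s\<bar>"
    proof -
      have "norm (f s - f 0) \<le> C * (1 + \<bar>s\<bar>^4) * norm (s - 0)"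
      proof (rule field_differentiable_bound[of "closed_segment 0 s" f "deriv f"])
        fix z assume z: "z \<in> closed_segment 0 s"
        show "(f has_field_derivative deriv f z) (at z within closed_segment 0 s)"
          using d by (rule has_field_derivative_at_within)
        have "\<bar>z\<bar> \<le> \<bar>s\<bar>" using z by (auto simp: closed_segment_eq_real_ivl split: if_splits)
        then have "\<bar>z\<bar>^4 \<le> \<bar>s\<bar>^4" by (rule power_mono) simp
        then have "C * (1 + \<bar>z\<bar>^4) \<le> C * (1 + \<bar>s\<bar>^4)" using C by simp
        then show "norm (deriv f z) \<le> C * (1 + \<bar>s\<bar>^4)" using upper[of z] by simp
      qed auto
      then show ?thesis by simp
    qed
    also have "\<dots> = C * (\<bar>s\<bar> + \<bar>s\<bar>^5)" by (simp add: algebra_simps eval_nat_numeral)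
    also have "\<dots> \<le> C * (2 * (1 + \<bar>s\<bar>^5))"
    proof -
      have "\<bar>s\<bar> \<le> 1 + \<bar>s\<bar>^5"
      proof (cases "\<bar>s\<bar> \<le> 1")
        case False
        then have "\<bar>s\<bar>^1 \<le> \<bar>s\<bar>^5" by (intro power_increasing) auto
        then show ?thesis by simp
      qed (simp add: add_increasing2)
      moreover have "0 \<le> \<bar>s\<bar>^5" by simp
      ultimately have "\<bar>s\<bar> + \<bar>s\<bar>^5 \<le> 2 * (1 + \<bar>s\<bar>^5)" by simp
      then show ?thesis using C by (intro mult_left_mono) auto
    qed
    finally have 1: "\<bar>f s - f 0\<bar> \<le> 2 * C * (1 + \<bar>s\<bar>^5)" by (simp only: mult_ac)
    have "\<bar>f 0\<bar> * 1 \<le> \<bar>f 0\<bar> * (1 + \<bar>s\<bar>^5)" by (intro mult_left_mono) auto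
    then show ?thesis using 1 unfolding distrib_right by linarith
  qed
  have inc: "f s + K * s \<le> f t + K * t" if "s \<le> t" for s t
  proof (rule DERIV_nonneg_imp_nondecreasing[OF that])
    fix x
    have "((\<lambda>x. f x + K * x) has_real_derivative deriv f x + K) (at x)"
      using d[of x] by (auto intro!: derivative_eq_intros)
    moreover have "0 \<le> deriv f x + K" using lower[of x] by linarith
    ultimately show "\<exists>y. ((\<lambda>x. f x + K * x) has_real_derivative y) (at x) \<and> 0 \<le> y" by blast
  qed
  show "0 \<le> ((f s + K * s) - (f t + K * t)) * (s - t)" for s t
    using inc[of s t] inc[of t s] by (cases "s \<le> t") (auto intro: mult_nonneg_nonneg mult_nonpos_nonpos)
qed

theorem theorem3p4:
  fixes \<alpha> \<gamma> C \<kappa> K :: real and f :: "real \<Rightarrow> real"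
  assumes "\<alpha> > 0" and "\<gamma> > 0"
    and "C > 0" and "\<kappa> > 0" and "K > 0"
    and "f C1_differentiable_on UNIV"
    and "\<And>s. f s * s \<ge> - C + \<kappa> * \<bar>s\<bar>\<^sup>2"
    and "\<And>s. deriv f s \<ge> - K"
    and "\<And>s. \<bar>deriv f s\<bar> \<le> C * (1 + \<bar>s\<bar> ^ 4)"
  shows "\<exists>Q :: real \<Rightarrow> real. mono_on {0..} Q \<and>
    (\<forall>g u0 u1 u v.
       L2_torus g \<longrightarrow> energy_space u0 u1 \<longrightarrow>
       weak_energy_solution \<alpha> \<gamma> f g u0 u1 u v \<longrightarrow>
         (\<forall>T>0. L2_Hs {0<..<T} (3/2) u) \<and>
         (\<forall>\<tau>\<ge>0. L2_Hs_norm {\<tau>..\<tau> + 1} (3/2) u \<le>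
            Q (Linf_energy_norm {\<tau>..\<tau> + 1} u v +
               L2_Hs_norm {\<tau>..\<tau> + 1} (1/2) v +
               L2_norm g)))"
proof -
  define A where "A = \<bar>f 0\<bar> + 2 * C"
  have q: "quintic_nonlinearity f A K"
    unfolding A_def using assms by (intro C1_quintic_nonlinearity) auto
  (* the sum of the coefficients of the three squared norms in the bound of H32_smoothing *)
  define c where "c = 20 + 6 * K + 3 * (\<alpha> + \<gamma>)"
  have c: "0 \<le> c" using assms by (simp add: c_def)
  show ?thesis
  proof (intro exI[of _ "\<lambda>z. sqrt c * z"] conjI allI impI)
    show "mono_on {0..} (\<lambda>z. sqrt c * z)"
      using c by (auto intro!: mono_onI mult_left_mono)
    fix g u0 u1 :: "real^3 \<Rightarrow> real" and u v :: "real \<Rightarrow> real^3 \<Rightarrow> real"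
    assume g: "L2_torus g" and sol: "weak_energy_solution \<alpha> \<gamma> f g u0 u1 u v"
    obtain U V where UV: "weakly_continuous_energy U V"
      "AE t in lebesgue_on {0<..}. (AE x in torus. U t x = u t x) \<and> (AE x in torus. V t x = v t x)"
      using sol unfolding weak_energy_solution_def initial_value_def by blast
    interpret quintic_nonlinearity f A K by (rule q)
    interpret solution_modes f A K \<alpha> \<gamma> g u v U V
      by unfold_locales (use assms g UV sol in \<open>simp_all add: weak_energy_solution_def\<close>)
    {
      fix T :: real assume T: "0 < T"
      obtain E where E: "AE t in lebesgue_on {0..T}. energy_norm (u t) (v t) \<le> E" "0 \<le> E"
        using energy_bound_exists[OF T] by blast
      note S = H32_smoothing[OF order_refl T E order_refl]
      have "integrable (lebesgue_on {0<..<T}) (\<lambda>t. (Hs_norm (3/2) (u t))\<^sup>2)"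
      proof -
        have "set_integrable lebesgue {0..T} (\<lambda>t. (Hs_norm (3/2) (u t))\<^sup>2)"
          using S(2) by (simp add: integrable_restrict_space set_integrable_def)
        then have "set_integrable lebesgue {0<..<T} (\<lambda>t. (Hs_norm (3/2) (u t))\<^sup>2)"
          by (rule set_integrable_subset) auto
        then show ?thesis by (simp add: integrable_restrict_space set_integrable_def)
      qed
      moreover have "AE t in lebesgue_on {0<..<T}. Hs (3/2) (u t)"
        by (rule AE_lebesgue_on_subset[OF S(1)]) auto
      ultimately show "L2_Hs {0<..<T} (3/2) u"
        using lin[OF T] by (simp add: L2_Hs_def Linf_energy_def)
    }
    fix \<tau> :: real assume \<tau>: "0 \<le> \<tau>"
    let ?E = "Linf_energy_norm {\<tau>..\<tau> + 1} u v" and ?D = "L2_Hs_norm {\<tau>..\<tau> + 1} (1/2) v" and ?G = "L2_norm g"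
    let ?z = "?E + ?D + ?G"
    have fin: "energy_esssup {0<..<\<tau> + 2} u v < \<infinity>"
      using lin[of "\<tau> + 2"] \<tau> by (simp add: Linf_energy_def)
    have E: "AE t in lebesgue_on {\<tau>..\<tau> + 1}. energy_norm (u t) (v t) \<le> ?E" "0 \<le> ?E"
      by (rule energy_esssup_bound[OF fin \<tau>]; simp)+
    have D: "(\<integral>t. (Hs_norm (1/2) (v t))\<^sup>2 \<partial>lebesgue_on {\<tau>..\<tau> + 1}) \<le> ?D\<^sup>2"
      unfolding L2_Hs_norm_def by (subst real_sqrt_pow2) (auto intro!: integral_nonneg_AE)
    have D0: "0 \<le> ?D" unfolding L2_Hs_norm_def by (auto intro!: integral_nonneg_AE)
    have G: "L2_inner g g = ?G\<^sup>2" "0 \<le> ?G" by (simp_all add: L2_norm_sq, simp add: L2_norm_def L2_inner_nonneg)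
    have "?E\<^sup>2 \<le> ?z\<^sup>2" "?D\<^sup>2 \<le> ?z\<^sup>2" "?G\<^sup>2 \<le> ?z\<^sup>2"
      using E(2) D0 G(2) by (auto intro!: power_mono)
    note le = this
    have "(\<integral>t. (Hs_norm (3/2) (u t))\<^sup>2 \<partial>lebesgue_on {\<tau>..\<tau> + 1})
       \<le> 2 * (?E\<^sup>2 * (\<tau> + 1 - \<tau>)) + 2 * smoothing_bound ?E (?D\<^sup>2) (\<tau> + 1 - \<tau>)"
      by (rule H32_smoothing(3)[OF \<tau> _ E D]) simp
    also have "\<dots> = (11 + 6 * K + 3 * (\<alpha> + \<gamma>)) * ?E\<^sup>2 + 6 * ?D\<^sup>2 + 3 * ?G\<^sup>2"
      unfolding smoothing_bound_def G(1) by (simp add: algebra_simps)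
    also have "\<dots> \<le> (11 + 6 * K + 3 * (\<alpha> + \<gamma>)) * ?z\<^sup>2 + 6 * ?z\<^sup>2 + 3 * ?z\<^sup>2"
      using le assms by (intro add_mono mult_left_mono) auto
    also have "\<dots> = c * ?z\<^sup>2" by (simp add: c_def algebra_simps)
    finally have "L2_Hs_norm {\<tau>..\<tau> + 1} (3/2) u \<le> sqrt (c * ?z\<^sup>2)"
      unfolding L2_Hs_norm_def by (rule real_sqrt_le_mono)
    also have "\<dots> = sqrt c * ?z" using E(2) D0 G(2) by (simp add: real_sqrt_mult)
    finally show "L2_Hs_norm {\<tau>..\<tau> + 1} (3/2) u \<le> sqrt c * ?z" .
  qed
qed

end
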